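(* Let $n$ be a positive integer with $n\equiv 1\pmod 4$, and let $M=(n-1)/2$ or $M=n-1$. Then \[ \sum_{k=0}^{M}[6k+1]\frac{(q;q^2)_k^2(q^2;q^4)_k(q;q^4)_k^2}{(q^2;q^2)_k^2(q^4;q^4)_k^3}q^{2k} \equiv [n]\frac{(q^2;q^4)_{(n-1)/4}^2}{(q^4;q^4)_{(n-1)/4}^2}\bigg\{1+[n]^2(2-q^n)\sum_{j=1}^{(n-1)/2}\frac{(-1)^{j+1}q^{2j}}{[2j]^2}\bigg\}\pmod{[n]\Phi_n(q)^4}. \]
   Context: For a complex number $x$ and integer $n\ge 0$, $(x;q)_n=\prod_{j=0}^{n-1}(1-xq^j)$ (with $(x;q)_0=1$). $[r]=(1-q^r)/(1-q)$ denotes the $q$-integer, and $\Phi_n(q)$ is the $n$-th cyclotomic polynomial in $q$. A congruence $A(q)\equiv B(q)\pmod{P(q)}$ between rational functions in $q$ whose denominators are coprime to the polynomial $P(q)$ means that $A(q)-B(q)$ is a rational function whose numerator is divisible by $P(q)$ and whose denominator is coprime to $P(q)$. *)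

theory Defs
  imports
    Complex_Main
    "HOL-Computational_Algebra.Computational_Algebra"
begin

definition q_pochhammer :: "'a \<Rightarrow> 'a \<Rightarrow> nat \<Rightarrow> 'a::comm_ring_1"
  where "q_pochhammer x p n = (\<Prod>j<n. 1 - x * p ^ j)"

text \<open>
  In a field, \<open>div\<close> is ordinary division \<open>/\<close>; in a polynomial ring, with \<open>q\<close> the indeterminate,
  the division is exact. So the same constant provides \<open>[r]\<close> both as a rational function and as
  a polynomial; see \<open>to_fract_q_int\<close> below.
\<close>
definition q_int :: "'a::idom_divide \<Rightarrow> nat \<Rightarrow> 'a"
  where "q_int q r = (1 - q ^ r) div (1 - q)"

definition cyclotomic_poly :: "nat \<Rightarrow> complex poly"
  where "cyclotomic_poly n =
    (\<Prod>\<zeta> | \<zeta> ^ n = 1 \<and> (\<forall>m. 0 < m \<and> m < n \<longrightarrow> \<zeta> ^ m \<noteq> 1). [:- \<zeta>, 1:])"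

definition denom_coprime :: "'a::field poly \<Rightarrow> 'a poly fract \<Rightarrow> bool"
  where "denom_coprime P A \<longleftrightarrow>
    (\<exists>a b. b \<noteq> 0 \<and> coprime b P \<and> A = Fract a b)"

text \<open>
  The congruence includes that both sides lie in its domain of definition, the rational functions
  whose denominators are coprime to the modulus. Since \<open>b\<close> is coprime to \<open>P\<close>, the condition
  \<open>P dvd a\<close> does not depend on whether the fraction is in lowest terms.
\<close>
definition ratfun_cong :: "'a::field poly fract \<Rightarrow> 'a poly fract \<Rightarrow> 'a poly \<Rightarrow> bool"
  where "ratfun_cong A B P \<longleftrightarrow>
    denom_coprime P A \<and> denom_coprime P B \<and>
    (\<exists>a b. b \<noteq> 0 \<and> coprime b P \<and> P dvd a \<and> A - B = Fract a b)"

lemma q_int_eq_sum: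
  fixes q :: "'a::idom_divide"
  assumes "q \<noteq> 1"
  shows "q_int q r = (\<Sum>i<r. q ^ i)"
proof -
  have "1 - q ^ r = (1 - q) * (\<Sum>i<r. q ^ i)"
    by (rule one_diff_power_eq)
  then show ?thesis
    using assms by (simp add: q_int_def)
qed

lemma to_fract_q_int:
  "to_fract (q_int [:0, 1::'a::field:] r) = q_int (to_fract [:0, 1:]) r"
proof -
  have ne: "[:0, 1::'a:] \<noteq> 1"
    by (simp add: one_pCons)
  then have ne': "to_fract [:0, 1::'a:] \<noteq> 1"
    by (metis to_fract_1 to_fract_eq_iff)
  have pow: "to_fract (p ^ i) = to_fract p ^ i" for p :: "'a poly" and i
    by (induction i) simp_all
  have "to_fract (\<Sum>i<r. p ^ i) = (\<Sum>i<r. to_fract p ^ i)" for p :: "'a poly"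
    by (induction r) (simp_all add: pow)
  then show ?thesis
    by (simp add: q_int_eq_sum[OF ne] q_int_eq_sum[OF ne'])
qed

end

theory Submission
  imports Defs
begin

text \<open>
  Replace the summand by a two-parameter deformation \<open>F(s, t)\<close>, with \<open>s = 2 - x - 1/x\<close> and
  \<open>t = 2 - y - 1/y\<close>, which gives back the sum at \<open>s = t = 0\<close>. At \<open>x = q\<^sup>n\<close> or \<open>y = q\<^sup>n\<close>, that is at
  \<open>s0 = -(1 - q\<^sup>n)\<^sup>2 / q\<^sup>n\<close>, the series terminates and Gasper and Rahman's quadratic summation evaluates
  \<open>F(s0, t) = G(t)\<close> and \<open>F(s, s0) = G(s)\<close> with one and the same product \<open>G\<close>. Since \<open>s0\<close> is divisible by
  \<open>\<Phi>\<^sub>n\<^sup>2\<close>, and since the reduction of \<open>F\<close> modulo \<open>\<Phi>\<^sub>n\<close> vanishes identically, the second difference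
  \<open>F(0, 0) - F(s0, 0) - F(0, s0) + F(s0, s0)\<close> is divisible by \<open>\<Phi>\<^sub>n\<^sup>5\<close>. Hence the sum is congruent to
  \<open>2 G(0) - G(s0)\<close>, and expanding \<open>G(s0)/G(0)\<close> to first order in \<open>s0\<close> gives the right-hand side.
  For a proper divisor \<open>d > 1\<close> of \<open>n\<close>, the sum splits into blocks of length \<open>d\<close>, each of which vanishes
  modulo \<open>\<Phi>\<^sub>d\<close> by the same vanishing result.
\<close>

section \<open>A quadratic summation and its contiguous relations\<close>

text \<open>Two parameters are what raises the exponent. With one, the same reasoning gives F(0,0) -
  F(s0,0) = s0 times a divided difference, hence only the cube of \<Phi>_n. With two, the mixed
  difference is s0^2 times a quantity whose value at a primitive root is a mixed partial derivative
  of the zero function. The reduction vanishes because a root \<zeta> of odd order 2m+1 satisfies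
  \<zeta> = (\<zeta>^2)^(-m): there the series has base \<zeta>^2 and a = \<zeta>, a degeneration of
  the case a = q^(-m) for generic q. The summation itself is climbed to from the one-term series b =
  1 or d = 1 by steps b -> b/q^2 and d -> d/q^2; in base q^2 these move x or y by q^4 and reach the
  required point exactly when n = 1 mod 4. The factor 2 - q^n in the theorem is 1/q^n expanded to
  first order at q^n = 1. As 2 - q^n - 1/q^n is s0 again, replacing one by the other costs only (1 -
  q^n)^2 s0, a term of order four.\<close>

text \<open>
  With \<open>\<beta> = b + q/b\<close> and \<open>\<delta> = d + q/d\<close> this is the ratio of consecutive terms, at \<open>x = q\<^sup>k\<close>, of Gasper and
  Rahman's quadratic series (their (3.8.12) with \<open>f = q/d\<close>), up to the factor \<open>(1 - a q\<^sup>3\<^sup>k) q\<^sup>k\<close>. Using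
  \<open>\<beta>\<close> and \<open>\<delta>\<close> builds in the symmetries \<open>b \<leftrightarrow> q/b\<close> and \<open>d \<leftrightarrow> q/d\<close>.
\<close>

definition term_ratio :: "'a::field \<Rightarrow> 'a \<Rightarrow> 'a \<Rightarrow> 'a \<Rightarrow> 'a \<Rightarrow> 'a"
  where "term_ratio q a \<beta> \<delta> x =
    ((1 - a * x) * (1 - a^2 * x^2) * (1 - \<beta> * x + q * x^2) * (1 - \<delta> * x^2 + q * x^4)) /
    ((1 - q^2 * x^2) * (1 - q * x / a) * (1 - a * \<beta> * q * x^2 + a^2 * q^3 * x^4)
      * (1 - a * \<delta> * x + a^2 * q * x^2))"

definition quad_term :: "'a::field \<Rightarrow> 'a \<Rightarrow> 'a \<Rightarrow> 'a \<Rightarrow> nat \<Rightarrow> 'a"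
  where "quad_term q a \<beta> \<delta> k =
    (1 - a * q^(3 * k)) * q^k * (\<Prod>i<k. term_ratio q a \<beta> \<delta> (q^i))"

text \<open>
  Found by \<open>q\<close>-Gosper summation: they say that the combinations of the series at \<open>d\<close> and \<open>d/q\<^sup>2\<close>
  (respectively \<open>b\<close> and \<open>b/q\<^sup>2\<close>) in the two contiguous relations telescope. Here \<open>K = q\<^sup>k\<close> and
  \<open>e = 1/d\<close> (respectively \<open>e = 1/b\<close>).
\<close>

lemma certificate_d:
  fixes q a e K \<beta> :: "'a::field"
  shows "(1-q^2*e)*(1-a*q*e*\<beta>+a^2*q^3*e^2)*(1-a*K^3)*K*(1-q*e*K^2)*(q*e-a*K)*(q^2*e-a*K)
    + (1-q*e)*(a^2-a*q*e*\<beta>+q^3*e^2)*(1-a*K^3)*K*(q^2*e-K^2)*(1-a*q*e*K)*(1-a*q^2*e*K)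
    = q*e*(1-q^3*e^2)*(a*(1-a*K)*(1-a^2*K^2)*(1-\<beta>*K+q*K^2)*(q^2*e-K^2)*(1-e*q*K^2)
      - (1-K^2)*(a-K)*(q*e-a*K)*(q-a*\<beta>*K^2+a^2*K^4)*(1-a*q^2*e*K))"
  by algebra

lemma certificate_b:
  fixes r e K \<eta> :: "'a::field"
  shows "- ((1-r^2*e*K)*(1-r^4*e*K)*(r*e-K^2)*(1-r*K^3)*K*(1-r^4*\<eta>*e+r^8*e^2))
    - (1-r^2*\<eta>*e+r^4*e^2)*(1-r*K^3)*K*(r^2*e-K)*(r^4*e-K)*(1-r^5*e*K^2)
    = r*e*(1+r^3*e)*((1-r^2*e*K)*(1-r*\<eta>*K^2+r^2*K^4)*(1-r^2*K^2)*(1-r*K)*(r^4*e-K)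
      - r^2*(1-K^2)*(r-K)*(r*e-K^2)*(1-\<eta>*K+K^2)*(1-r^5*e*K^2))"
  by algebra

text \<open>The difference of the two sides is a constant times a telescoping sum. Its lower
  boundary vanishes through a factor 1 - (q^k)^2, its upper one because \<open>van\<close> says that
  the series for d/q^2, where d = 1/e, terminates before N. The factors (1 - q e)(1 - q^2 e) stay on
  both sides to avoid division and are cancelled on application.\<close>

lemma contiguous_d:
  fixes q a e \<beta> :: "'a::field"
  assumes [simp]: "q \<noteq> 0" "a \<noteq> 0" "e \<noteq> 0"
    and nz: "\<And>i. i < N \<Longrightarrow> 1 - q^2 * (q^i)^2 \<noteq> 0"
      "\<And>i. i < N \<Longrightarrow> a - q * q^i \<noteq> 0"
      "\<And>i. i < N \<Longrightarrow> 1 - a * \<beta> * q * (q^i)^2 + a^2 * q^3 * (q^i)^4 \<noteq> 0"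
      "\<And>i. i < N + 3 \<Longrightarrow> 1 - a * q * e * q^i \<noteq> 0"
      "\<And>i. i < N \<Longrightarrow> e - a * q^i \<noteq> 0" "q * e - a \<noteq> 0" "q^2 * e - a \<noteq> 0"
    and van: "\<exists>i<N. q^2 * e = (q^i)^2"
  shows "(1 - a*q*e*\<beta> + a^2*q^3*e^2) * (a - q*e) * (a - q^2*e) * ((1 - q*e) * (1 - q^2*e)
          * (\<Sum>k<N. quad_term q a \<beta> (1/(q^2*e) + q^3*e) k))
       = (a^2 - a*q*e*\<beta> + q^3*e^2) * (1 - a*q*e) * (1 - a*q^2*e) * ((1 - q*e) * (1 - q^2*e)
          * (\<Sum>k<N. quad_term q a \<beta> (1/e + q*e) k))"
proof -
  \<comment> \<open>Both term ratios equal \<open>h\<close> times a shift quotient u(q x)/u(x) with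
    u a polynomial. Hence, up to constants, \<open>P\<close> and \<open>P'\<close> are polynomials
    in q^k times the common product \<open>H\<close>; this is what \<open>L1\<close> and
    \<open>L2\<close> say.\<close>
  define h where "h x = a*(1-a*x)*(1-a^2*x^2)*(1-\<beta>*x+q*x^2)*(q^2*e-x^2)*(1-q*e*x^2) /
    (q^2*(1-q^2*x^2)*(a-q*x)*(1-a*\<beta>*q*x^2+a^2*q^3*x^4)*(1-a*q^3*e*x)*(e-a*x))" for x
  define H where "H k = (\<Prod>i<k. h (q^i))" for k
  define P where "P k = (\<Prod>i<k. term_ratio q a \<beta> (1/e + q*e) (q^i))" for k
  define P' where "P' k = (\<Prod>i<k. term_ratio q a \<beta> (1/(q^2*e) + q^3*e) (q^i))" for k
  \<comment> \<open>The antidifference read off from \<open>certificate_d\<close>: the two products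
    in the bracket on its right-hand side, multiplied by \<open>H k\<close>, are
    \<open>G (Suc k)\<close> and \<open>G k\<close>.\<close>
  define G where "G k = H k * ((1-(q^k)^2)*(a-q^k)*(q*e-a*q^k)*(q-a*\<beta>*(q^k)^2+a^2*(q^k)^4)*(1-a*q^2*e*q^k))" for k
  have r: "term_ratio q a \<beta> (1/e + q*e) x * (q^2*e-x^2) * (1-a*q*e*x)
     = h x * (q^2*e - (q*x)^2) * (1-a*q^3*e*x)"
    if "1-a*q*e*x \<noteq> 0" "1-a*q^3*e*x \<noteq> 0" "e-a*x \<noteq> 0" "1-q^2*x^2 \<noteq> 0" "a-q*x \<noteq> 0"
      "1-a*\<beta>*q*x^2+a^2*q^3*x^4 \<noteq> 0" for x
  proof -
    have 1: "1 - (1/e+q*e)*x^2 + q*x^4 = (e-x^2)*(1-q*e*x^2)/e"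
      by (simp add: field_simps power2_eq_square power4_eq_xxxx)
    have 2: "1 - a*(1/e+q*e)*x + a^2*q*x^2 = (e-a*x)*(1-a*q*e*x)/e"
      by (simp add: field_simps power2_eq_square)
    have 3: "1 - q*x/a = (a-q*x)/a" by (simp add: field_simps)
    have 4: "q^2*e - (q*x)^2 = q^2*(e-x^2)" by (simp add: algebra_simps power_mult_distrib)
    show ?thesis unfolding term_ratio_def h_def 1 2 3 4 using that by (simp add: divide_simps)
  qed
  have r': "term_ratio q a \<beta> (1/(q^2*e) + q^3*e) x * ((1-q*e*x^2)*(q*e-a*x)*(q^2*e-a*x))
     = h x * ((1-q*e*(q*x)^2)*(q*e-a*(q*x))*(q^2*e-a*(q*x)))"
    if "1-a*q^3*e*x \<noteq> 0" "e-a*x \<noteq> 0" "1-q^2*x^2 \<noteq> 0" "a-q*x \<noteq> 0"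
      "1-a*\<beta>*q*x^2+a^2*q^3*x^4 \<noteq> 0" "q^2*e-a*x \<noteq> 0" for x
  proof -
    have 1: "1 - (1/(q^2*e)+q^3*e)*x^2 + q*x^4 = (q^2*e-x^2)*(1-q^3*e*x^2)/(q^2*e)"
      by (simp add: field_simps) algebra
    have 2: "1 - a*(1/(q^2*e)+q^3*e)*x + a^2*q*x^2 = (q^2*e-a*x)*(1-a*q^3*e*x)/(q^2*e)"
      by (simp add: field_simps) algebra
    have 3: "1 - q*x/a = (a-q*x)/a" by (simp add: field_simps)
    have 4: "q*e-a*(q*x) = q*(e-a*x)" "q^2*e-a*(q*x) = q*(q*e-a*x)" "q*e*(q*x)^2 = q^3*e*x^2"
      by algebra+
    show ?thesis unfolding term_ratio_def h_def 1 2 3 4 using that 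
      by (simp add: divide_simps) algebra
  qed

  have L1: "(1-q^2*e)*(1-a*q*e)*(1-a*q^2*e)*P k = - (H k*((q^2*e-(q^k)^2)*(1-a*q*e*q^k)*(1-a*q^2*e*q^k)))"
    if "k \<le> N" for k using that
  proof (induction k)
    case 0 show ?case by (simp add: P_def H_def) algebra
  next
    case (Suc k)
    have 5: "1-a*q*e*q^k \<noteq> 0" "1-a*q^3*e*q^k \<noteq> 0" "1-a*q^2*e*q^k \<noteq> 0"
      using nz(4)[of k] nz(4)[of "k+1"] nz(4)[of "k+2"] Suc.prems by (auto simp: algebra_simps power2_eq_square power3_eq_cube)
    note r0 = r[of "q^k", OF 5(1,2) nz(5) nz(1) nz(2) nz(3)]
    have "(1-q^2*e)*(1-a*q*e)*(1-a*q^2*e)*P (Suc k)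
        = (1-q^2*e)*(1-a*q*e)*(1-a*q^2*e)*P k * term_ratio q a \<beta> (1/e + q*e) (q^k)"
      by (simp add: P_def)
    also have "\<dots> = - (H k * (1-a*q^2*e*q^k) * (term_ratio q a \<beta> (1/e + q*e) (q^k)*(q^2*e-(q^k)^2)*(1-a*q*e*q^k)))"
      unfolding Suc.IH[OF Suc_leD[OF Suc.prems]] by (simp only: mult_ac mult_minus_left mult_minus_right)
    also have "\<dots> = - (H (Suc k) * (1-a*q^2*e*q^k) * ((q^2*e - (q*q^k)^2) * (1-a*q^3*e*q^k)))"
      using r0 Suc.prems by (simp add: H_def)
    also have "\<dots> = - (H (Suc k)*((q^2*e-(q*q^k)^2)*(1-a*q*e*(q*q^k))*(1-a*q^2*e*(q*q^k))))"
    proof -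
      have "a*q*e*(q*x) = a*q^2*e*x" "a*q^2*e*(q*x) = a*q^3*e*x" for x by algebra+
      note eqs = this
      show ?thesis unfolding eqs by (simp only: mult_ac)
    qed
    finally show ?case by simp
  qed
  have L2: "(1-q*e)*(q*e-a)*(q^2*e-a)*P' k = H k*((1-q*e*(q^k)^2)*(q*e-a*q^k)*(q^2*e-a*q^k))"
    if "k \<le> N" for k using that
  proof (induction k)
    case 0 show ?case by (simp add: P'_def H_def)
  next
    case (Suc k)
    have 5: "1-a*q^3*e*q^k \<noteq> 0"
      using nz(4)[of "k+2"] Suc.prems by (auto simp: algebra_simps power2_eq_square power3_eq_cube)
    have 6: "q^2*e-a*q^k \<noteq> 0"
    \<comment> \<open>For k >= 2 the expression is q^2 times an earlier \<open>e - a * q^l\<close>;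
      the values k = 0, 1 come from the two separate hypotheses.\<close>
    proof (cases "k < 2")
      case True
      then consider "k = 0" | "k = 1" by linarith
      then show ?thesis using nz(6,7) by cases (auto simp: power2_eq_square)
    next
      case False
      then obtain l where "k = l+2" by (metis add.commute le_Suc_ex not_less)
      then show ?thesis using nz(5)[of l] Suc.prems by (simp add: power_add power2_eq_square algebra_simps)
    qed
    note r0 = r'[of "q^k", OF 5(1) nz(5) nz(1) nz(2) nz(3) 6]
    have "(1-q*e)*(q*e-a)*(q^2*e-a)*P' (Suc k)
        = (1-q*e)*(q*e-a)*(q^2*e-a)*P' k * term_ratio q a \<beta> (1/(q^2*e) + q^3*e) (q^k)"
      by (simp add: P'_def)
    also have "\<dots> = H k * (term_ratio q a \<beta> (1/(q^2*e) + q^3*e) (q^k) * ((1-q*e*(q^k)^2)*(q*e-a*q^k)*(q^2*e-a*q^k)))"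
      unfolding Suc.IH[OF Suc_leD[OF Suc.prems]] by (simp only: mult_ac)
    also have "\<dots> = H (Suc k) * ((1-q*e*(q*q^k)^2)*(q*e-a*(q*q^k))*(q^2*e-a*(q*q^k)))"
      using r0 Suc.prems by (simp add: H_def)
    finally show ?case by simp
  qed
  have GS: "G (Suc k) = H k * (a*(1-a*q^k)*(1-a^2*(q^k)^2)*(1-\<beta>*q^k+q*(q^k)^2)*(q^2*e-(q^k)^2)*(1-e*q*(q^k)^2))"
    if "k < N" for k
  proof -
    define K where "K = q^k"
    have 5: "1-a*q^3*e*K \<noteq> 0"
      using nz(4)[of "k+2"] that by (auto simp: K_def algebra_simps power2_eq_square power3_eq_cube)
    have 4: "1-(q*K)^2 = 1-q^2*K^2" "q*e-a*(q*K) = q*(e-a*K)" "q-a*\<beta>*(q*K)^2+a^2*(q*K)^4 = q*(1-a*\<beta>*q*K^2+a^2*q^3*K^4)"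
      "1-a*q^2*e*(q*K) = 1-a*q^3*e*K" by algebra+
    have "G (Suc k) = H k * (h K * ((1-q^2*K^2)*(a-q*K)*(q*(e-a*K))*(q*(1-a*\<beta>*q*K^2+a^2*q^3*K^4))*(1-a*q^3*e*K)))"
      unfolding 4[symmetric] by (simp add: G_def H_def K_def)
    also have "h K * ((1-q^2*K^2)*(a-q*K)*(q*(e-a*K))*(q*(1-a*\<beta>*q*K^2+a^2*q^3*K^4))*(1-a*q^3*e*K))
      = a*(1-a*K)*(1-a^2*K^2)*(1-\<beta>*K+q*K^2)*(q^2*e-K^2)*(1-e*q*K^2)"
    proof -
      have "X / (q^2*A*B*C*D*E) * (A*B*(q*E)*(q*C)*D) = X"
        if "A \<noteq> 0" "B \<noteq> 0" "C \<noteq> 0" "D \<noteq> 0" "E \<noteq> 0" for A B C D E X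
        using that by (simp add: field_simps power2_eq_square)
      from this[OF nz(1)[OF that, folded K_def] nz(2)[OF that, folded K_def] nz(3)[OF that, folded K_def] 5 nz(5)[OF that, folded K_def]]
      show ?thesis unfolding h_def by (simp only: mult.commute[of e q])
    qed
    finally show ?thesis by (simp add: K_def)
  qed
  have step: "(1 - a*q*e*\<beta> + a^2*q^3*e^2) * (a - q*e) * (a - q^2*e) * ((1 - q*e) * (1 - q^2*e) * quad_term q a \<beta> (1/(q^2*e) + q^3*e) k)
     - (a^2 - a*q*e*\<beta> + q^3*e^2) * (1 - a*q*e) * (1 - a*q^2*e) * ((1 - q*e) * (1 - q^2*e) * quad_term q a \<beta> (1/e + q*e) k)
     = q*e*(1-q^3*e^2) * (G (Suc k) - G k)" if "k < N" for k
  proof -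
    define K where "K = q^k"
    define D where "D = 1 - a*q*e*\<beta> + a^2*q^3*e^2"
    define M where "M = a^2 - a*q*e*\<beta> + q^3*e^2"
    have 1: "quad_term q a \<beta> (1/(q^2*e) + q^3*e) k = (1-a*K^3)*K*P' k" "quad_term q a \<beta> (1/e + q*e) k = (1-a*K^3)*K*P k"
      by (simp_all add: quad_term_def P'_def P_def K_def power_mult[symmetric] mult.commute)
    have "D * (a - q*e) * (a - q^2*e) * ((1 - q*e) * (1 - q^2*e) * ((1-a*K^3)*K*P' k))
     - M * (1 - a*q*e) * (1 - a*q^2*e) * ((1 - q*e) * (1 - q^2*e) * ((1-a*K^3)*K*P k))
     = D * (1-q^2*e) * ((1-a*K^3)*K) * ((1-q*e)*(q*e-a)*(q^2*e-a)*P' k)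
      - M * (1-q*e) * ((1-a*K^3)*K) * ((1-q^2*e)*(1-a*q*e)*(1-a*q^2*e)*P k)"
    proof -
      have "D*(a-u)*(a-v)*((1-u)*(1-v)*(W*P')) - M*A*B*((1-u)*(1-v)*(W*P))
        = D*(1-v)*W*((1-u)*(u-a)*(v-a)*P') - M*(1-u)*W*((1-v)*A*B*P)" for u v A B W P P'
        by algebra
      then show ?thesis .
    qed
    also have "\<dots> = D * (1-q^2*e) * ((1-a*K^3)*K) * (H k*((1-q*e*K^2)*(q*e-a*K)*(q^2*e-a*K)))
      - M * (1-q*e) * ((1-a*K^3)*K) * (- (H k*((q^2*e-K^2)*(1-a*q*e*K)*(1-a*q^2*e*K))))"
      using L1[of k] L2[of k] that unfolding K_def by simp
    also have "\<dots> = H k * ((1-q^2*e)*D*(1-a*K^3)*K*(1-q*e*K^2)*(q*e-a*K)*(q^2*e-a*K)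
    + (1-q*e)*M*(1-a*K^3)*K*(q^2*e-K^2)*(1-a*q*e*K)*(1-a*q^2*e*K))"
      by (simp only: distrib_left mult_minus_right diff_minus_eq_add mult_ac)
    also have "\<dots> = H k * (q*e*(1-q^3*e^2)*(a*(1-a*K)*(1-a^2*K^2)*(1-\<beta>*K+q*K^2)*(q^2*e-K^2)*(1-e*q*K^2)
      - (1-K^2)*(a-K)*(q*e-a*K)*(q-a*\<beta>*K^2+a^2*K^4)*(1-a*q^2*e*K)))"
      unfolding D_def M_def certificate_d ..
    also have "\<dots> = q*e*(1-q^3*e^2) * (G (Suc k) - G k)"
    proof -
      have "Z*(C*(X - Y)) = C*(Z*X - Z*Y)" for Z C X Y :: 'a by algebra
      then show ?thesis unfolding GS[OF that] unfolding G_def K_def .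
    qed
    finally show ?thesis unfolding 1 D_def M_def .
  qed
  have HN: "H N = 0"
    using van by (auto simp: H_def h_def)
  have "(1 - a*q*e*\<beta> + a^2*q^3*e^2) * (a - q*e) * (a - q^2*e) * ((1 - q*e) * (1 - q^2*e) * (\<Sum>k<N. quad_term q a \<beta> (1/(q^2*e) + q^3*e) k))
     - (a^2 - a*q*e*\<beta> + q^3*e^2) * (1 - a*q*e) * (1 - a*q^2*e) * ((1 - q*e) * (1 - q^2*e) * (\<Sum>k<N. quad_term q a \<beta> (1/e + q*e) k))
     = (\<Sum>k<N. (1 - a*q*e*\<beta> + a^2*q^3*e^2) * (a - q*e) * (a - q^2*e) * ((1 - q*e) * (1 - q^2*e) * quad_term q a \<beta> (1/(q^2*e) + q^3*e) k)
     - (a^2 - a*q*e*\<beta> + q^3*e^2) * (1 - a*q*e) * (1 - a*q^2*e) * ((1 - q*e) * (1 - q^2*e) * quad_term q a \<beta> (1/e + q*e) k))"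
    by (simp only: sum_subtractf sum_distrib_left)
  also have "\<dots> = (\<Sum>k<N. q*e*(1-q^3*e^2) * (G (Suc k) - G k))"
    using step by simp
  also have "\<dots> = q*e*(1-q^3*e^2) * (G N - G 0)"
    by (simp only: sum_distrib_left[symmetric] sum_lessThan_telescope)
  also have "\<dots> = 0" by (simp add: G_def HN)
  finally show ?thesis by (simp only: right_minus_eq)
qed


text \<open>The same telescoping for the step b -> b/q^2, with b = 1/e and only for q = r^2, a = r,
  \<delta> = r \<eta>, the specialisation of the theorem. The relation in d keeps a and q
  independent because a later limit in a relies on it.\<close>

lemma contiguous_b:
  fixes r e \<eta> :: "'a::field"
  assumes [simp]: "r \<noteq> 0" "e \<noteq> 0"
    and nz: "\<And>i. i < N \<Longrightarrow> 1 - r^4 * ((r^2)^i)^2 \<noteq> 0"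
      "\<And>i. i < N \<Longrightarrow> 1 - r * (r^2)^i \<noteq> 0"
      "\<And>i. i < N \<Longrightarrow> 1 - r^2 * \<eta> * (r^2)^i + r^4 * ((r^2)^i)^2 \<noteq> 0"
      "\<And>i. i < N + 2 \<Longrightarrow> 1 - r^5 * e * ((r^2)^i)^2 \<noteq> 0"
      "\<And>i. i < N \<Longrightarrow> e - r^3 * ((r^2)^i)^2 \<noteq> 0" "r * e - 1 \<noteq> 0"
    and van: "\<exists>i<N. r^4 * e = (r^2)^i"
  shows "(1 - r^4*\<eta>*e + r^8*e^2) * (1 - r*e) * ((1 - r^2*e) * (1 - r^4*e)
          * (\<Sum>k<N. quad_term (r^2) r (1/(r^4*e) + r^6*e) (r*\<eta>) k))
       = (1 - r^2*\<eta>*e + r^4*e^2) * (1 - r^5*e) * ((1 - r^2*e) * (1 - r^4*e)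
          * (\<Sum>k<N. quad_term (r^2) r (1/e + r^2*e) (r*\<eta>) k))"
proof -
  define q where "q = r^2"
  have [simp]: "q \<noteq> 0" by (simp add: q_def)
  define h where "h x = (1-r^2*x^2)*(1-r*\<eta>*x^2+r^2*x^4)*(r^4*e-x)*(1-r^2*e*x) /
    (r^4*(1-r^4*x^2)*(1-r^2*\<eta>*x+r^4*x^2)*(1-r^9*e*x^2)*(e-r^3*x^2))" for x
  define H where "H k = (\<Prod>i<k. h (q^i))" for k
  define P where "P k = (\<Prod>i<k. term_ratio q r (1/e + r^2*e) (r*\<eta>) (q^i))" for k
  define P' where "P' k = (\<Prod>i<k. term_ratio q r (1/(r^4*e) + r^6*e) (r*\<eta>) (q^i))" for k
  define G where "G k = H k * (r^2*(1-(q^k)^2)*(r-q^k)*(r*e-(q^k)^2)*(1-\<eta>*q^k+(q^k)^2)*(1-r^5*e*(q^k)^2))" for k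
  have r: "term_ratio q r (1/e + r^2*e) (r*\<eta>) x * ((r^4*e-x)*(r^2*e-x)*(1-r^5*e*x^2))
     = h x * ((r^4*e-q*x)*(r^2*e-q*x)*(1-r^5*e*(q*x)^2))"
    if "1-r^5*e*x^2 \<noteq> 0" "1-r^9*e*x^2 \<noteq> 0" "e-r^3*x^2 \<noteq> 0" "1-r^4*x^2 \<noteq> 0" "1-r*x \<noteq> 0"
      "1-r^2*\<eta>*x+r^4*x^2 \<noteq> 0" for x
  proof -
    have 1: "1 - (1/e+r^2*e)*x + q*x^2 = (e-x)*(1-r^2*e*x)/e"
      by (simp add: field_simps power2_eq_square q_def)
    have 2: "1 - r*(1/e+r^2*e)*q*x^2 + r^2*q^3*x^4 = (e-r^3*x^2)*(1-r^5*e*x^2)/e"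
      by (simp add: field_simps q_def) algebra
    have 3: "1 - q*x/r = 1-r*x" "q^2*x^2 = r^4*x^2" "r*(r*\<eta>)*x = r^2*\<eta>*x" "r^2*q*x^2 = r^4*x^2" "q*x^4 = r^2*x^4"
      by (simp_all add: field_simps q_def power2_eq_square power4_eq_xxxx)
    have 4: "r^4*e - q*x = r^2*(r^2*e-x)" "r^2*e-q*x = r^2*(e-x)" "1-r^5*e*(q*x)^2 = 1-r^9*e*x^2"
      by (simp_all add: algebra_simps q_def power_mult_distrib flip: power_add power_mult)
    show ?thesis unfolding term_ratio_def h_def 1 2 3 4 using that by (simp add: divide_simps)
  qed
  have r': "term_ratio q r (1/(r^4*e) + r^6*e) (r*\<eta>) x * ((1-r^2*e*x)*(1-r^4*e*x)*(r*e-x^2))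
     = h x * ((1-r^2*e*(q*x))*(1-r^4*e*(q*x))*(r*e-(q*x)^2))"
    if "1-r^9*e*x^2 \<noteq> 0" "e-r^3*x^2 \<noteq> 0" "1-r^4*x^2 \<noteq> 0" "1-r*x \<noteq> 0"
      "1-r^2*\<eta>*x+r^4*x^2 \<noteq> 0" "r*e-x^2 \<noteq> 0" for x
  proof -
    have 1: "1 - (1/(r^4*e)+r^6*e)*x + q*x^2 = (r^4*e-x)*(1-r^6*e*x)/(r^4*e)"
      by (simp add: field_simps q_def) algebra
    have 2: "1 - r*(1/(r^4*e)+r^6*e)*q*x^2 + r^2*q^3*x^4 = (r*e-x^2)*(1-r^9*e*x^2)/(r*e)"
      by (simp add: field_simps q_def) algebra
    have 3: "1 - q*x/r = 1-r*x" "q^2*x^2 = r^4*x^2" "r*(r*\<eta>)*x = r^2*\<eta>*x" "r^2*q*x^2 = r^4*x^2" "q*x^4 = r^2*x^4"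
      by (simp_all add: field_simps q_def power2_eq_square power4_eq_xxxx)
    have 4: "1-r^2*e*(q*x) = 1-r^4*e*x" "1-r^4*e*(q*x) = 1-r^6*e*x" "r*e-(q*x)^2 = r*(e-r^3*x^2)"
      unfolding q_def by algebra+
    show ?thesis unfolding term_ratio_def h_def 1 2 3 4 using that
      by (simp add: divide_simps)
  qed
  have nz4: "1-r^9*e*(q^k)^2 \<noteq> 0" if "k < N" for k
  proof -
    have "r^5*e*(r^2*x)^2 = r^9*e*x^2" for x by algebra
    note eq = this
    show ?thesis using nz(4)[of "Suc k"] that unfolding power_Suc eq q_def by simp
  qed
  have L1: "(r^4*e-1)*(r^2*e-1)*(1-r^5*e)*P k = H k*((r^4*e-q^k)*(r^2*e-q^k)*(1-r^5*e*(q^k)^2))"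
    if "k \<le> N" for k using that
  proof (induction k)
    case 0 show ?case by (simp add: P_def H_def)
  next
    case (Suc k)
    then have k: "k < N" "k < N + 2" by auto
    have r0: "term_ratio q r (1/e + r^2*e) (r*\<eta>) (q^k) * ((r^4*e-q^k)*(r^2*e-q^k)*(1-r^5*e*(q^k)^2))
      = h (q^k) * ((r^4*e-q*q^k)*(r^2*e-q*q^k)*(1-r^5*e*(q*q^k)^2))"
      by (rule r) (use nz(1-5)[of k] nz4[of k] k in \<open>simp_all add: q_def\<close>)
    have "(r^4*e-1)*(r^2*e-1)*(1-r^5*e)*P (Suc k)
        = (r^4*e-1)*(r^2*e-1)*(1-r^5*e)*P k * term_ratio q r (1/e + r^2*e) (r*\<eta>) (q^k)"
      by (simp add: P_def)
    also have "\<dots> = H k * (term_ratio q r (1/e + r^2*e) (r*\<eta>) (q^k)*((r^4*e-q^k)*(r^2*e-q^k)*(1-r^5*e*(q^k)^2)))"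
      unfolding Suc.IH[OF Suc_leD[OF Suc.prems]] by (simp only: mult_ac)
    also have "\<dots> = H (Suc k) * ((r^4*e-q*q^k)*(r^2*e-q*q^k)*(1-r^5*e*(q*q^k)^2))"
      using r0 Suc.prems by (simp add: H_def)
    finally show ?case by simp
  qed
  have L2: "(1-r^2*e)*(1-r^4*e)*(r*e-1)*P' k = H k*((1-r^2*e*q^k)*(1-r^4*e*q^k)*(r*e-(q^k)^2))"
    if "k \<le> N" for k using that
  proof (induction k)
    case 0 show ?case by (simp add: P'_def H_def)
  next
    case (Suc k)
    then have k: "k < N" by auto
    have 6: "r*e-(q^k)^2 \<noteq> 0"
    proof (cases k)
      case 0
      then show ?thesis using nz(6) by simp
    next
      case (Suc l)
      then have "r*e-(q^k)^2 = r * (e - r^3*(q^l)^2)"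
        by (simp add: q_def algebra_simps power2_eq_square power3_eq_cube)
      then show ?thesis using nz(5)[of l] k Suc by (simp add: q_def)
    qed
    have r0: "term_ratio q r (1/(r^4*e) + r^6*e) (r*\<eta>) (q^k) * ((1-r^2*e*q^k)*(1-r^4*e*q^k)*(r*e-(q^k)^2))
      = h (q^k) * ((1-r^2*e*(q*q^k))*(1-r^4*e*(q*q^k))*(r*e-(q*q^k)^2))"
      by (rule r') (use nz(1-5)[of k] nz4[of k] k 6 in \<open>simp_all add: q_def\<close>)
    have "(1-r^2*e)*(1-r^4*e)*(r*e-1)*P' (Suc k)
        = (1-r^2*e)*(1-r^4*e)*(r*e-1)*P' k * term_ratio q r (1/(r^4*e) + r^6*e) (r*\<eta>) (q^k)"
      by (simp add: P'_def)
    also have "\<dots> = H k * (term_ratio q r (1/(r^4*e) + r^6*e) (r*\<eta>) (q^k) * ((1-r^2*e*q^k)*(1-r^4*e*q^k)*(r*e-(q^k)^2)))"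
      unfolding Suc.IH[OF Suc_leD[OF Suc.prems]] by (simp only: mult_ac)
    also have "\<dots> = H (Suc k) * ((1-r^2*e*(q*q^k))*(1-r^4*e*(q*q^k))*(r*e-(q*q^k)^2))"
      using r0 Suc.prems by (simp add: H_def)
    finally show ?case by simp
  qed
  have GS: "G (Suc k) = H k * ((1-r^2*e*q^k)*(1-r*\<eta>*(q^k)^2+r^2*(q^k)^4)*(1-r^2*(q^k)^2)*(1-r*q^k)*(r^4*e-q^k))"
    if "k < N" for k
  proof -
    define K where "K = q^k"
    have 4: "1-(q*K)^2 = 1-r^4*K^2" "r-q*K = r*(1-r*K)" "r*e-(q*K)^2 = r*(e-r^3*K^2)" 
      "1-\<eta>*(q*K)+(q*K)^2 = 1-r^2*\<eta>*K+r^4*K^2" "1-r^5*e*(q*K)^2 = 1-r^9*e*K^2"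
      unfolding q_def by algebra+
    have "G (Suc k) = H k * (h K * (r^2*(1-r^4*K^2)*(r*(1-r*K))*(r*(e-r^3*K^2))*(1-r^2*\<eta>*K+r^4*K^2)*(1-r^9*e*K^2)))"
      unfolding 4[symmetric] by (simp add: G_def H_def K_def)
    also have "h K * (r^2*(1-r^4*K^2)*(r*(1-r*K))*(r*(e-r^3*K^2))*(1-r^2*\<eta>*K+r^4*K^2)*(1-r^9*e*K^2))
      = (1-r^2*e*K)*(1-r*\<eta>*K^2+r^2*K^4)*(1-r^2*K^2)*(1-r*K)*(r^4*e-K)"
    proof -
      have "X1*X2*X3*X4 / (r^4*A*B*C*D) * (r^2*A*(r*Y)*(r*D)*B*C) = X4*X2*X1*Y*X3"
        if "A \<noteq> 0" "B \<noteq> 0" "C \<noteq> 0" "D \<noteq> 0" for A B C D X1 X2 X3 X4 Y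
        using that by (simp add: field_simps power2_eq_square power4_eq_xxxx)
      from this[OF nz(1)[OF that] nz(3)[OF that] nz4[OF that, unfolded q_def] nz(5)[OF that]]
      show ?thesis unfolding h_def K_def q_def .
    qed
    finally show ?thesis by (simp add: K_def)
  qed
  have step: "(1 - r^4*\<eta>*e + r^8*e^2) * (1 - r*e) * ((1 - r^2*e) * (1 - r^4*e) * quad_term q r (1/(r^4*e) + r^6*e) (r*\<eta>) k)
       - (1 - r^2*\<eta>*e + r^4*e^2) * (1 - r^5*e) * ((1 - r^2*e) * (1 - r^4*e) * quad_term q r (1/e + r^2*e) (r*\<eta>) k)
     = r*e*(1+r^3*e) * (G (Suc k) - G k)" if "k < N" for k
  proof -
    define K where "K = q^k"
    define D where "D = 1 - r^4*\<eta>*e + r^8*e^2"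
    define M where "M = 1 - r^2*\<eta>*e + r^4*e^2"
    have 1: "quad_term q r (1/(r^4*e) + r^6*e) (r*\<eta>) k = (1-r*K^3)*K*P' k" "quad_term q r (1/e + r^2*e) (r*\<eta>) k = (1-r*K^3)*K*P k"
      by (simp_all add: quad_term_def P'_def P_def K_def power_mult[symmetric] mult.commute)
    have "D * (1 - r*e) * ((1 - r^2*e) * (1 - r^4*e) * ((1-r*K^3)*K*P' k))
     - M * (1 - r^5*e) * ((1 - r^2*e) * (1 - r^4*e) * ((1-r*K^3)*K*P k))
     = - (D * ((1-r*K^3)*K) * ((1-r^2*e)*(1-r^4*e)*(r*e-1)*P' k))
      - M * ((1-r*K^3)*K) * ((r^4*e-1)*(r^2*e-1)*(1-r^5*e)*P k)"
    proof -
      have "D*(1-u)*((1-v)*(1-w)*(W*P')) - M*A*((1-v)*(1-w)*(W*P))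
        = - (D*W*((1-v)*(1-w)*(u-1)*P')) - M*W*((w-1)*(v-1)*A*P)" for u v w A W P P'
        by algebra
      then show ?thesis .
    qed
    also have "\<dots> = - (D * ((1-r*K^3)*K) * (H k*((1-r^2*e*K)*(1-r^4*e*K)*(r*e-K^2))))
      - M * ((1-r*K^3)*K) * (H k*((r^4*e-K)*(r^2*e-K)*(1-r^5*e*K^2)))"
      using L1[of k] L2[of k] that unfolding K_def by simp
    also have "\<dots> = H k * (- ((1-r^2*e*K)*(1-r^4*e*K)*(r*e-K^2)*(1-r*K^3)*K*D)
    - M*(1-r*K^3)*K*(r^2*e-K)*(r^4*e-K)*(1-r^5*e*K^2))"
    proof -
      have "- (D*(u*v)*(Z*(A*B*C))) - M*(u*v)*(Z*(E*F*I)) = Z*(- (A*B*C*u*v*D) - M*u*v*F*E*I)"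
        for Z A B C E F I u v :: 'a by algebra
      then show ?thesis .
    qed
    also have "\<dots> = H k * (r*e*(1+r^3*e)*((1-r^2*e*K)*(1-r*\<eta>*K^2+r^2*K^4)*(1-r^2*K^2)*(1-r*K)*(r^4*e-K)
      - r^2*(1-K^2)*(r-K)*(r*e-K^2)*(1-\<eta>*K+K^2)*(1-r^5*e*K^2)))"
      unfolding D_def M_def certificate_b ..
    also have "\<dots> = r*e*(1+r^3*e) * (G (Suc k) - G k)"
    proof -
      have "Z*(C*(X - Y)) = C*(Z*X - Z*Y)" for Z C X Y :: 'a by algebra
      then show ?thesis unfolding GS[OF that] unfolding G_def K_def .
    qed
    finally show ?thesis unfolding 1 D_def M_def .
  qed
  have HN: "H N = 0"
    using van by (auto simp: H_def h_def q_def)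
  have "(1 - r^4*\<eta>*e + r^8*e^2) * (1 - r*e) * ((1 - r^2*e) * (1 - r^4*e) * (\<Sum>k<N. quad_term q r (1/(r^4*e) + r^6*e) (r*\<eta>) k))
       - (1 - r^2*\<eta>*e + r^4*e^2) * (1 - r^5*e) * ((1 - r^2*e) * (1 - r^4*e) * (\<Sum>k<N. quad_term q r (1/e + r^2*e) (r*\<eta>) k))
    = (\<Sum>k<N. (1 - r^4*\<eta>*e + r^8*e^2) * (1 - r*e) * ((1 - r^2*e) * (1 - r^4*e) * quad_term q r (1/(r^4*e) + r^6*e) (r*\<eta>) k)
       - (1 - r^2*\<eta>*e + r^4*e^2) * (1 - r^5*e) * ((1 - r^2*e) * (1 - r^4*e) * quad_term q r (1/e + r^2*e) (r*\<eta>) k))"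
    by (simp only: sum_subtractf sum_distrib_left)
  also have "\<dots> = (\<Sum>k<N. r*e*(1+r^3*e) * (G (Suc k) - G k))"
    using step by simp
  also have "\<dots> = r*e*(1+r^3*e) * (G N - G 0)"
    by (simp only: sum_distrib_left[symmetric] sum_lessThan_telescope)
  also have "\<dots> = 0" by (simp add: G_def HN)
  finally show ?thesis by (simp only: right_minus_eq q_def)
qed

section \<open>Closed forms of the terminating series\<close>

lemma term_ratio_eq_0:
  assumes "1 - \<beta> * x + q * x^2 = 0 \<or> 1 - \<delta> * x^2 + q * x^4 = 0"
  shows "term_ratio q a \<beta> \<delta> x = 0"
  using assms by (auto simp: term_ratio_def)

lemma quad_term_eq_0:
  assumes "i < k" "term_ratio q a \<beta> \<delta> (q^i) = 0"
  shows "quad_term q a \<beta> \<delta> k = 0"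
  using assms by (auto simp: quad_term_def intro!: prod_zero)

text \<open>Here d = q^(-2j), and 1 - \<delta> x^2 + q x^4 = (1 - d x^2)(1 - q x^2/d) is zero at x =
  q^j.\<close>

lemma quad_term_d_eq_0:
  fixes q :: "'a::field"
  assumes "q \<noteq> 0" "j < k"
  shows "quad_term q a \<beta> (1/q^(2*j) + q * q^(2*j)) k = 0"
proof (rule quad_term_eq_0[OF assms(2)], rule term_ratio_eq_0, rule disjI2)
  have 1: "(q^j)^2 = q^(2*j)" "(q^j)^4 = q^(2*j) * q^(2*j)"
    by (simp_all flip: power_mult power_add add: mult.commute)
  show "1 - (1/q^(2*j) + q * q^(2*j)) * (q^j)^2 + q * (q^j)^4 = 0"
    unfolding 1 using assms(1) by (simp add: field_simps)
qed

lemma power_eq_power_iff: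
  fixes r :: "'a::field"
  assumes "r \<noteq> 0" and r1: "\<And>c. c > 0 \<Longrightarrow> r^c \<noteq> 1"
  shows "r^x = r^y \<longleftrightarrow> x = y"
proof -
  have "r^x \<noteq> r^y" if "x < y" for x y
    using r1[of "y - x"] that assms(1) by (auto simp: power_diff)
  then show ?thesis by (metis linorder_neqE_nat)
qed

text \<open>Iteration of \<open>contiguous_d\<close> at fixed N, from d = 1, where only the term k =
  0 survives, down to d = q^(-2j).\<close>

lemma sum_quad_term_d:
  fixes q a \<beta> :: "'a::field"
  assumes [simp]: "q \<noteq> 0" "a \<noteq> 0"
    and q: "\<And>c. c > 0 \<Longrightarrow> q^c \<noteq> 1"
    and a: "\<And>c. c \<le> 3 * N \<Longrightarrow> a * q^c \<noteq> 1" "\<And>c. c \<le> 3 * N \<Longrightarrow> a \<noteq> q^c"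
    and b: "\<And>i. i < N \<Longrightarrow> 1 - a * \<beta> * q * (q^i)^2 + a^2 * q^3 * (q^i)^4 \<noteq> 0"
    and j: "j < N"
  shows "(\<Sum>k<N. quad_term q a \<beta> (1/q^(2*j) + q * q^(2*j)) k) =
    (1 - a) * (\<Prod>c<2*j. (1 - a * q^(c+1)) / (a - q^(c+1)))
      * (\<Prod>i<j. (a^2 - a * \<beta> * q^(2*i+1) + q^(4*i+3)) / (1 - a * \<beta> * q^(2*i+1) + a^2 * q^(4*i+3)))"
  using j
proof (induction j)
  case 0
  have "(\<Sum>k<N. quad_term q a \<beta> (1/q^(2*0) + q * q^(2*0)) k) = (\<Sum>k\<in>{0}. quad_term q a \<beta> (1/q^(2*0) + q * q^(2*0)) k)"
    by (rule sum.mono_neutral_right) (use 0 quad_term_d_eq_0[of q 0 _ a \<beta>] in auto)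
  then show ?case by (simp add: quad_term_def)
next
  case (Suc j)
  define e where "e = q^(2*j)"
  define S where "S d = (\<Sum>k<N. quad_term q a \<beta> d k)" for d
  have [simp]: "e \<noteq> 0" by (simp add: e_def)
  have nz1: "1 - q*e \<noteq> 0" "1 - q^2*e \<noteq> 0"
    using q[of "2*j+1"] q[of "2*j+2"] by (simp_all add: e_def power_add power2_eq_square mult_ac)
  have nz2: "a - q*e \<noteq> 0" "a - q^2*e \<noteq> 0" 
    using a(2)[of "2*j+1"] a(2)[of "2*j+2"] Suc.prems by (simp_all add: e_def power_add power2_eq_square mult_ac)
  have nz3: "1 - a*q*e*\<beta> + a^2*q^3*e^2 \<noteq> 0"
  proof -
    have "(q^j)^2 = e" "(q^j)^4 = e^2" by (simp_all add: e_def mult.commute flip: power_mult)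
    with b[of j] Suc.prems show ?thesis by (simp add: mult_ac)
  qed
  have "(1 - a*q*e*\<beta> + a^2*q^3*e^2) * (a - q*e) * (a - q^2*e) * ((1 - q*e) * (1 - q^2*e) * S (1/(q^2*e) + q^3*e))
       = (a^2 - a*q*e*\<beta> + q^3*e^2) * (1 - a*q*e) * (1 - a*q^2*e) * ((1 - q*e) * (1 - q^2*e) * S (1/e + q*e))"
    unfolding S_def
  proof (rule contiguous_d)
    fix i assume "i < N"
    show "1 - q^2 * (q^i)^2 \<noteq> 0"
      using q[of "2+i*2"] by (simp add: power_add power_mult del: One_nat_def power_Suc add_2_eq_Suc add_2_eq_Suc')
    show "a - q * q^i \<noteq> 0" using a(2)[of "Suc i"] \<open>i < N\<close> by simp
    show "1 - a * \<beta> * q * (q^i)^2 + a^2 * q^3 * (q^i)^4 \<noteq> 0" using b \<open>i < N\<close> by simp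
    show "e - a * q^i \<noteq> 0"
    proof (cases "i \<le> 2*j")
      case True
      then have "e = q^(2*j-i) * q^i" by (simp add: e_def flip: power_add)
      moreover have "2*j-i \<le> 3*N" using Suc.prems by linarith
      ultimately show ?thesis using a(2)[of "2*j-i"] by auto
    next
      case False
      then have "q^i = e * q^(i-2*j)" by (simp add: e_def flip: power_add)
      then have "e - a*q^i = e * (1 - a * q^(i-2*j))" by (simp add: algebra_simps)
      then show ?thesis using a(1)[of "i-2*j"] \<open>i < N\<close> by auto
    qed
  next
    fix i assume "i < N + 3"
    then show "1 - a * q * e * q^i \<noteq> 0"
      using a(1)[of "1+2*j+i"] Suc.prems by (simp add: e_def power_add mult_ac)
  next
    show "\<exists>i<N. q^2 * e = (q^i)^2"
      by (rule exI[of _ "Suc j"]) (use Suc.prems in \<open>simp add: e_def power2_eq_square mult_ac mult_2_right flip: power_add\<close>)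
  qed (use nz2 in auto)
  then have "(1 - a*q*e*\<beta> + a^2*q^3*e^2) * (a - q*e) * (a - q^2*e) * S (1/(q^2*e) + q^3*e)
       = (a^2 - a*q*e*\<beta> + q^3*e^2) * (1 - a*q*e) * (1 - a*q^2*e) * S (1/e + q*e)"
    using nz1 by (simp add: mult.left_commute mult.assoc)
  then have S: "S (1/(q^2*e) + q^3*e) = S (1/e+q*e) * (((1 - a*q*e) / (a - q*e)) * ((1 - a*q^2*e) / (a - q^2*e)))
      * ((a^2 - a*q*e*\<beta> + q^3*e^2) / (1 - a*q*e*\<beta> + a^2*q^3*e^2))"
    using nz2 nz3 by (simp add: divide_simps mult_ac)
  have e1: "1/q^(2*Suc j) + q * q^(2*Suc j) = 1/(q^2*e) + q^3*e"
    by (simp add: e_def power2_eq_square power3_eq_cube mult_ac)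
  have e2: "q^(2*j+1) = q*e" "q^(4*j+3) = q^3*e^2" "q^(2*j+1+1) = q^2*e"
    using power_add[of q "2*j" "2*j"]
    by (simp_all add: e_def power_add power2_eq_square power3_eq_cube power_mult[symmetric] mult_ac)
  have e3: "a*\<beta>*(q*e) = a*q*e*\<beta>" "a*(q*e) = a*q*e" "a*(q^2*e) = a*q^2*e" "a^2*(q^3*e^2) = a^2*q^3*e^2" by algebra+
  have "2 * Suc j = Suc (Suc (2*j))" by simp
  then have p: "(\<Prod>c<2*Suc j. f c) = (\<Prod>c<2*j. f c) * (f (2*j) * f (2*j+1))" for f :: "nat \<Rightarrow> 'a"
    by (simp add: mult.assoc)
  have IH: "S (1/e+q*e) = (1 - a) * (\<Prod>c<2*j. (1 - a * q^(c+1)) / (a - q^(c+1)))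
      * (\<Prod>i<j. (a^2 - a * \<beta> * q^(2*i+1) + q^(4*i+3)) / (1 - a * \<beta> * q^(2*i+1) + a^2 * q^(4*i+3)))"
    using Suc by (simp add: S_def e_def)
  show ?case unfolding e1 S_def[symmetric] S IH p prod.lessThan_Suc e2 e3
    by (simp only: mult_ac)
qed

lemma quad_term_b_eq_0:
  fixes r :: "'a::field"
  assumes "r \<noteq> 0" "2 * j < k"
  shows "quad_term (r^2) r (1/r^(4*j) + r^2 * r^(4*j)) \<delta> k = 0"
proof (rule quad_term_eq_0[OF assms(2)], rule term_ratio_eq_0, rule disjI1)
  have 1: "(r^2)^(2*j) = r^(4*j)" by (simp flip: power_mult)
  show "1 - (1/r^(4*j) + r^2 * r^(4*j)) * (r^2)^(2*j) + r^2 * ((r^2)^(2*j))^2 = 0"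
    unfolding 1 using assms(1) by (simp add: field_simps power2_eq_square)
qed

text \<open>Iteration of \<open>contiguous_b\<close> from b = 1 down to b = r^(-4j). The factors (1
  - r^5 e)/(1 - r e) of the successive steps telescope into the leading 1 - r^(4j+1).\<close>

lemma sum_quad_term_b:
  fixes r \<eta> :: "'a::field"
  assumes [simp]: "r \<noteq> 0"
    and r: "\<And>c. c > 0 \<Longrightarrow> r^c \<noteq> 1"
    and eta: "\<And>i. 1 - \<eta> * r^(2*i+2) + r^(4*i+4) \<noteq> 0"
    and j: "2 * j < N"
  shows "(\<Sum>k<N. quad_term (r^2) r (1/r^(4*j) + r^2 * r^(4*j)) (r*\<eta>) k) =
    (1 - r^(4*j+1)) * (\<Prod>i<j. (1 - \<eta> * r^(4*i+2) + r^(8*i+4)) / (1 - \<eta> * r^(4*i+4) + r^(8*i+8)))"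
  using j
proof (induction j)
  case 0
  have "(\<Sum>k<N. quad_term (r^2) r (1/r^(4*0) + r^2 * r^(4*0)) (r*\<eta>) k) = (\<Sum>k\<in>{0}. quad_term (r^2) r (1/r^(4*0) + r^2 * r^(4*0)) (r*\<eta>) k)"
    by (rule sum.mono_neutral_right) (use 0 quad_term_b_eq_0[of r 0 _ "r*\<eta>"] in auto)
  then show ?case by (simp add: quad_term_def)
next
  case (Suc j)
  define e where "e = r^(4*j)"
  define S where "S b = (\<Sum>k<N. quad_term (r^2) r b (r*\<eta>) k)" for b
  have [simp]: "e \<noteq> 0" by (simp add: e_def)
  have ne: "r^x \<noteq> r^y" if "x < y" for x y
    using power_eq_power_iff[of r x y] r that by simp
  have nz1: "1 - r*e \<noteq> 0" "1 - r^2*e \<noteq> 0" "1 - r^4*e \<noteq> 0"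
    using r[of "4*j+1"] r[of "4*j+2"] r[of "4*j+4"] by (simp_all add: e_def add.commute flip: power_add power_Suc)
  have p4: "r^(4*j+2) = r^2*e" "r^(4*j+4) = r^4*e" "r^(8*j+4) = r^4*e^2" "r^(8*j+8) = r^8*e^2"
    "r^(4*j+1) = r*e" "r^(4*Suc j+1) = r^5*e"
    by (simp_all add: e_def add.commute flip: power_add power_Suc power_mult)
  have nz3: "1 - r^4*\<eta>*e + r^8*e^2 \<noteq> 0"
  proof -
    have "2*(2*j+1)+2 = 4*j+4" "4*(2*j+1)+4 = 8*j+8" by simp_all
    note idx = this
    show ?thesis using eta[of "2*j+1"] unfolding idx p4 by (simp only: mult_ac not_False_eq_True)
  qed
  have "(1 - r^4*\<eta>*e + r^8*e^2) * (1 - r*e) * ((1 - r^2*e) * (1 - r^4*e) * S (1/(r^4*e) + r^6*e))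
       = (1 - r^2*\<eta>*e + r^4*e^2) * (1 - r^5*e) * ((1 - r^2*e) * (1 - r^4*e) * S (1/e + r^2*e))"
    unfolding S_def
  proof (rule contiguous_b)
    fix i assume "i < N"
    have p2: "(r^2)^i = r^(2*i)" by (simp add: power_mult)
    show "1 - r^4 * ((r^2)^i)^2 \<noteq> 0"
      using r[of "4+2*i*2"] by (simp add: p2 power_add power_mult flip: power_mult)
    show "1 - r * (r^2)^i \<noteq> 0"
      using r[of "1+2*i"] by (simp add: p2)
    have idx: "r^2*\<eta>*(r^2)^i = \<eta> * r^(2*i+2)" "r^4*((r^2)^i)^2 = r^(4*i+4)"
      unfolding p2 by (simp_all add: power_add power2_eq_square[of r] mult_ac flip: power_mult)
    show "1 - r^2*\<eta>*(r^2)^i + r^4*((r^2)^i)^2 \<noteq> 0"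
      using eta[of i] by (simp only: idx not_False_eq_True)
    \<comment> \<open>The exponents 4j and 4i + 3 differ modulo 4.\<close>
    have "e \<noteq> r^(3+2*i*2)"
    proof (cases "4*j < 3+2*i*2")
      case True
      then show ?thesis unfolding e_def by (rule ne)
    next
      case False
      then have "3+2*i*2 < 4*j" by presburger
      then show ?thesis unfolding e_def by (rule ne[symmetric])
    qed
    then show "e - r^3 * ((r^2)^i)^2 \<noteq> 0" by (simp add: p2 power_add flip: power_mult)
  next
    fix i
    have p2: "(r^2)^i = r^(2*i)" by (simp add: power_mult)
    show "1 - r^5 * e * ((r^2)^i)^2 \<noteq> 0"
      using r[of "5+4*j+2*i*2"] by (simp add: e_def p2 power_add flip: power_mult)
  next
    have "4 + 4*j = 2*(2*Suc j)" by simp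
    then have "r^4 * e = (r^2)^(2*Suc j)"
      unfolding e_def power_add[symmetric] power_mult[symmetric] by (rule arg_cong)
    then show "\<exists>i<N. r^4 * e = (r^2)^i"
      using Suc.prems by blast
  qed (use nz1 in auto)
  then have "(1 - r^4*\<eta>*e + r^8*e^2) * (1 - r*e) * S (1/(r^4*e) + r^6*e)
       = (1 - r^2*\<eta>*e + r^4*e^2) * (1 - r^5*e) * S (1/e + r^2*e)"
    using nz1 by (simp add: mult.left_commute mult.assoc)
  then have S: "S (1/(r^4*e) + r^6*e) = S (1/e+r^2*e) * ((1 - r^5*e) / (1 - r*e))
      * ((1 - r^2*\<eta>*e + r^4*e^2) / (1 - r^4*\<eta>*e + r^8*e^2))"
    using nz1 nz3 by (simp add: divide_simps mult_ac)
  have e1: "1/r^(4*Suc j) + r^2 * r^(4*Suc j) = 1/(r^4*e) + r^6*e"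
    by (simp add: e_def flip: power_add)
  have e3: "\<eta>*(r^2*e) = r^2*\<eta>*e" "\<eta>*(r^4*e) = r^4*\<eta>*e" by algebra+
  have IH: "S (1/e+r^2*e) = (1 - r*e) * (\<Prod>i<j. (1 - \<eta> * r^(4*i+2) + r^(8*i+4)) / (1 - \<eta> * r^(4*i+4) + r^(8*i+8)))"
    using Suc by (simp add: S_def e_def)
  show ?case unfolding e1 S_def[symmetric] S IH prod.lessThan_Suc p4 e3
    using nz1(1) by (simp add: mult_ac)
qed

section \<open>Vanishing at roots of unity\<close>

lemma isCont_eq_if_eventually_eq:
  fixes f g :: "complex \<Rightarrow> complex"
  assumes "isCont f c" "isCont g c" "eventually (\<lambda>z. f z = g z) (at c)"
  shows "f c = g c"
proof -
  have lim: "f \<midarrow>c\<rightarrow> f c" "g \<midarrow>c\<rightarrow> g c" using assms by (simp_all add: isCont_def)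
  then have "f \<midarrow>c\<rightarrow> g c"
    using assms(3) by (subst tendsto_cong[of f g]) auto
  with lim(1) show ?thesis by (rule LIM_unique)
qed

lemma eventually_not_in_finite:
  fixes x :: "'a::t1_space"
  assumes "finite B"
  shows "eventually (\<lambda>a. a \<notin> B) (at x)"
proof -
  have "eventually (\<lambda>a. \<forall>b\<in>B. a \<noteq> b) (at x)"
    using assms by (intro eventually_ball_finite ballI eventually_neq_at_within)
  then show ?thesis by (rule eventually_mono) auto
qed

lemma isCont_quad_term:
  fixes q a \<beta> \<delta> :: "complex \<Rightarrow> complex"
  assumes cont: "isCont q c" "isCont a c" "isCont \<beta> c" "isCont \<delta> c" and "a c \<noteq> 0"
    and nz: "\<And>i. i < k \<Longrightarrow> 1 - (q c)^2 * ((q c)^i)^2 \<noteq> 0"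
      "\<And>i. i < k \<Longrightarrow> 1 - q c * (q c)^i / a c \<noteq> 0"
      "\<And>i. i < k \<Longrightarrow> 1 - a c * \<beta> c * q c * ((q c)^i)^2 + (a c)^2 * (q c)^3 * ((q c)^i)^4 \<noteq> 0"
      "\<And>i. i < k \<Longrightarrow> 1 - a c * \<delta> c * (q c)^i + (a c)^2 * q c * ((q c)^i)^2 \<noteq> 0"
  shows "isCont (\<lambda>z. quad_term (q z) (a z) (\<beta> z) (\<delta> z) k) c"
  unfolding quad_term_def term_ratio_def
  by (intro continuous_intros cont) (use nz \<open>a c \<noteq> 0\<close> in auto)

context
  fixes q :: complex and m :: nat
  assumes q0: "q \<noteq> 0" and q1: "\<And>c. c > 0 \<Longrightarrow> q^c \<noteq> 1" and m: "m > 0"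
begin

lemma q_pow_inj: "q^x = q^y \<longleftrightarrow> x = y"
  by (rule power_eq_power_iff[OF q0]) (rule q1)

text \<open>
  For generic \<open>a\<close> the sum with \<open>d = q\<^sup>-\<^sup>2\<^sup>j\<close> has a closed form containing \<open>(aq;q)\<^sub>2\<^sub>j\<close>, which vanishes in the
  limit \<open>a \<rightarrow> q\<^sup>-\<^sup>m\<close>.
\<close>

lemma sum_quad_term_at_zero_of_d:
  assumes b: "\<And>i. i < 2*m+1 \<Longrightarrow> 1 - (1/q^m) * \<beta> * q * (q^i)^2 + (1/q^m)^2 * q^3 * (q^i)^4 \<noteq> 0"
    and j: "m \<le> j" "j < 2*m+1"
  shows "(\<Sum>k\<le>m. quad_term q (1/q^m) \<beta> (1/q^(2*j) + q * q^(2*j)) k) = 0"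
proof -
  \<comment> \<open>One truncation that works for all the values m <= j <= 2m, since
    \<open>sum_quad_term_d\<close> asks for j < N.\<close>
  define N where "N = 2*m+1"
  define \<delta> where "\<delta> = 1/q^(2*j) + q * q^(2*j)"
  define f where "f a = (\<Sum>k<N. quad_term q a \<beta> \<delta> k)" for a
  define g where "g a = (1 - a) * (\<Prod>c<2*j. (1 - a * q^(c+1)) / (a - q^(c+1)))
      * (\<Prod>i<j. (a^2 - a * \<beta> * q^(2*i+1) + q^(4*i+3)) / (1 - a * \<beta> * q^(2*i+1) + a^2 * q^(4*i+3)))" for a
  have qm: "1/q^m \<noteq> q^c" if "c > 0 \<or> m > 0" for c
    using q_pow_inj[of "c+m" 0] m q0 by (auto simp: field_simps power_add)
  have pw: "q * (q^i)^2 = q^(2*i+1)" "q^3 * (q^i)^4 = q^(4*i+3)" for i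
    by (simp_all add: power_add mult_ac flip: power_mult)
  have b': "1 - (1/q^m) * \<beta> * q^(2*i+1) + (1/q^m)^2 * q^(4*i+3) \<noteq> 0" if "i < 2*m+1" for i
    using b[OF that] unfolding pw[symmetric] by (simp only: mult.assoc not_False_eq_True)
  have "isCont f (1/q^m)"
    unfolding f_def
  proof (rule continuous_sum)
    fix k assume "k \<in> {..<N}"
    show "isCont (\<lambda>a. quad_term q a \<beta> \<delta> k) (1/q^m)"
    proof (cases "k \<le> j")
      case False
      then show ?thesis using quad_term_d_eq_0[of q j k _ \<beta>] q0 by (simp add: \<delta>_def)
    next
      case True
      show ?thesis
      proof (rule isCont_quad_term)
        fix i assume i: "i < k"
        show "1 - q^2 * (q^i)^2 \<noteq> 0"
          using q1[of "2+i*2"] by (simp add: power_add power_mult del: One_nat_def power_Suc add_2_eq_Suc add_2_eq_Suc')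
        show "1 - q * q^i / (1/q^m) \<noteq> 0"
          using q1[of "1+i+m"] by (simp add: power_add mult.assoc)
        show "1 - 1/q^m * \<beta> * q * (q^i)^2 + (1/q^m)^2 * q^3 * (q^i)^4 \<noteq> 0"
          using b[of i] i True j by simp
        have "1 - 1/q^m * \<delta> * q^i + (1/q^m)^2 * q * (q^i)^2
          = (1 - q^i/q^(m+2*j)) * (1 - q^(2*j+1+i)/q^m)"
          using q0 by (simp add: \<delta>_def field_simps power_add power2_eq_square)
        moreover have "q^i \<noteq> q^(m+2*j)" "q^(2*j+1+i) \<noteq> q^m"
          unfolding q_pow_inj using i True j m by auto
        ultimately show "1 - 1/q^m * \<delta> * q^i + (1/q^m)^2 * q * (q^i)^2 \<noteq> 0"
          using q0 by simp
      qed (use q0 in simp_all)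
    qed
  qed
  moreover have "isCont g (1/q^m)"
  proof -
    have n1: "1/q^m - q^(c+1) \<noteq> 0" for c using qm[of "c+1"] by simp
    have n2: "1 - (1/q^m) * \<beta> * q^(2*i+1) + (1/q^m)^2 * q^(4*i+3) \<noteq> 0" if "i < j" for i
      using b'[of i] that j by simp
    show ?thesis unfolding g_def
      by (intro continuous_intros) (simp_all only: n1 n2 lessThan_iff not_False_eq_True)
  qed
  moreover have "eventually (\<lambda>a. f a = g a) (at (1/q^m))"
  proof -
    define B where "B = (\<lambda>c. 1/q^c) ` {..3*N} \<union> (\<lambda>c. q^c) ` {..3*N} \<union> {0}"
    have 1: "eventually (\<lambda>a. a \<notin> B) (at (1/q^m))"
      by (rule eventually_not_in_finite) (simp add: B_def)
    have 2: "eventually (\<lambda>a. \<forall>i\<in>{..<N}. 1 - a * \<beta> * q * (q^i)^2 + a^2 * q^3 * (q^i)^4 \<noteq> 0) (at (1/q^m))"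
    proof (rule eventually_ball_finite)
      show "\<forall>i\<in>{..<N}. \<forall>\<^sub>F a in at (1 / q ^ m). 1 - a * \<beta> * q * (q ^ i)\<^sup>2 + a\<^sup>2 * q ^ 3 * (q ^ i) ^ 4 \<noteq> 0"
      proof
        fix i assume "i \<in> {..<N}"
        have "(\<lambda>a. 1 - a * \<beta> * q * (q^i)^2 + a^2 * q^3 * (q^i)^4) \<midarrow>1/q^m\<rightarrow> 1 - (1/q^m) * \<beta> * q * (q^i)^2 + (1/q^m)^2 * q^3 * (q^i)^4"
          by (intro tendsto_intros)
        then show "\<forall>\<^sub>F a in at (1 / q ^ m). 1 - a * \<beta> * q * (q ^ i)\<^sup>2 + a\<^sup>2 * q ^ 3 * (q ^ i) ^ 4 \<noteq> 0"
          by (rule tendsto_imp_eventually_ne) (use b \<open>i \<in> {..<N}\<close> in \<open>auto simp: N_def\<close>)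
      qed
    qed simp
    from 1 2 show ?thesis
    proof eventually_elim
      case (elim a)
      have "a \<noteq> q^c" "a * q^c \<noteq> 1" if "c \<le> 3*N" for c
        using elim(1) that q0 by (auto simp: B_def field_simps)
      then show ?case
        unfolding f_def g_def \<delta>_def
        by (intro sum_quad_term_d) (use elim q0 q1 j in \<open>auto simp: B_def N_def\<close>)
    qed
  qed
  ultimately have "f (1/q^m) = g (1/q^m)" by (rule isCont_eq_if_eventually_eq)
  also have "g (1/q^m) = 0"
  proof -
    have "(\<Prod>c<2*j. (1 - 1/q^m * q^(c+1)) / (1/q^m - q^(c+1))) = 0"
    proof (rule prod_zero)
      have "1 - 1/q^m * q^(m-1+1) = 0" using q0 m by simp
      then show "\<exists>c\<in>{..<2*j}. (1 - 1/q^m * q^(c+1)) / (1/q^m - q^(c+1)) = 0"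
        using m j by (intro bexI[of _ "m-1"]) (simp_all only: div_0, auto)
    qed simp
    then show ?thesis by (simp add: g_def)
  qed
  \<comment> \<open>At a = q^(-m) the factor 1 - a x of the term ratio vanishes at x = q^m, so the
    sum stops at m.\<close>
  also have "f (1/q^m) = (\<Sum>k\<le>m. quad_term q (1/q^m) \<beta> \<delta> k)"
    unfolding f_def
  proof (rule sum.mono_neutral_right)
    show "\<forall>k\<in>{..<N} - {..m}. quad_term q (1/q^m) \<beta> \<delta> k = 0"
      using q0 by (auto intro!: quad_term_eq_0[of m] simp: term_ratio_def)
  qed (auto simp: N_def)
  finally show ?thesis by (simp add: \<delta>_def)
qed

text \<open>
  After clearing denominators the sum is a polynomial in \<open>\<delta>\<close> of degree at most \<open>m\<close>, and the previous
  lemma provides \<open>m + 1\<close> zeros.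
\<close>

lemma sum_quad_term_vanishes_generic_b:
  assumes b: "\<And>i. i < 2*m+1 \<Longrightarrow> 1 - (1/q^m) * \<beta> * q * (q^i)^2 + (1/q^m)^2 * q^3 * (q^i)^4 \<noteq> 0"
    and d: "\<And>i. i < m \<Longrightarrow> 1 - (1/q^m) * \<delta> * q^i + (1/q^m)^2 * q * (q^i)^2 \<noteq> 0"
  shows "(\<Sum>k\<le>m. quad_term q (1/q^m) \<beta> \<delta> k) = 0"
proof -
  define a where "a = 1/q^m"
  \<comment> \<open>\<open>L i\<close> and \<open>D i\<close> are the numerator and denominator
    factors of \<open>term_ratio\<close> at q^i that contain \<delta>, as linear polynomials in
    \<delta>; \<open>w\<close> collects all the others.\<close>
  define L where "L i = [:1 + q*(q^i)^4, -((q^i)^2):]" for i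
  define D where "D i = [:1 + a^2 * q * (q^i)^2, - (a * q^i):]" for i
  define w where "w x = ((1 - a * x) * (1 - a^2 * x^2) * (1 - \<beta> * x + q * x^2)) /
    ((1 - q^2 * x^2) * (1 - q * x / a) * (1 - a * \<beta> * q * x^2 + a^2 * q^3 * x^4))" for x
  define c where "c k = (1 - a*q^(3*k)) * q^k * (\<Prod>i<k. w (q^i))" for k
  define P where "P = (\<Sum>k\<le>m. smult (c k) ((\<Prod>i<k. L i) * (\<Prod>i\<in>{k..<m}. D i)))"
  have PL: "poly (L i) x = 1 - x*(q^i)^2 + q*(q^i)^4" and PD: "poly (D i) x = 1 - a*x*q^i + a^2*q*(q^i)^2" for i x
    by (simp_all add: L_def D_def algebra_simps)
  have eq: "poly P x = (\<Sum>k\<le>m. quad_term q a \<beta> x k) * (\<Prod>i<m. poly (D i) x)"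
    if "\<And>i. i < m \<Longrightarrow> poly (D i) x \<noteq> 0" for x
  proof -
    have "poly P x = (\<Sum>k\<le>m. c k * ((\<Prod>i<k. poly (L i) x) * (\<Prod>i\<in>{k..<m}. poly (D i) x)))"
      by (simp add: P_def poly_sum poly_prod)
    also have "\<dots> = (\<Sum>k\<le>m. quad_term q a \<beta> x k * (\<Prod>i<m. poly (D i) x))"
    proof (rule sum.cong)
      fix k assume k: "k \<in> {..m}"
      have "{..<m} = {..<k} \<union> {k..<m}" using k by auto
      then have s: "(\<Prod>i<m. poly (D i) x) = (\<Prod>i<k. poly (D i) x) * (\<Prod>i\<in>{k..<m}. poly (D i) x)"
        by (simp add: prod.union_disjoint ivl_disj_int)
      have nz: "(\<Prod>i<k. poly (D i) x) \<noteq> 0" using that k by auto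
      have "term_ratio q a \<beta> x y = w y * (1 - x*y^2 + q*y^4) / (1 - a*x*y + a^2*q*y^2)" for y
        by (simp add: term_ratio_def w_def)
      then have "quad_term q a \<beta> x k = c k * (\<Prod>i<k. poly (L i) x) / (\<Prod>i<k. poly (D i) x)"
        by (simp add: quad_term_def c_def PL PD prod_dividef prod.distrib)
      then show "c k * ((\<Prod>i<k. poly (L i) x) * (\<Prod>i\<in>{k..<m}. poly (D i) x)) = quad_term q a \<beta> x k * (\<Prod>i<m. poly (D i) x)"
        using nz by (simp add: s)
    qed simp
    finally show ?thesis by (simp add: sum_distrib_right)
  qed
  \<comment> \<open>The m + 1 values of \<delta> belonging to d = q^(-2j) with m <= j <= 2m, at
    which the denominators \<open>D i\<close> are nonzero.\<close>
  define Z where "Z = (\<lambda>j. 1/q^(2*j) + q * q^(2*j)) ` {m..<2*m+1}"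
  have Z0: "poly P x = 0" if "x \<in> Z" for x
  proof -
    from that obtain j where j: "m \<le> j" "j < 2*m+1" "x = 1/q^(2*j) + q * q^(2*j)" by (auto simp: Z_def)
    have "poly (D i) x \<noteq> 0" if i: "i < m" for i
    proof -
      have "poly (D i) x = (1 - q^i/q^(m+2*j)) * (1 - q^(2*j+1+i)/q^m)"
        using q0 by (simp add: PD j(3) a_def field_simps power_add power2_eq_square)
      moreover have "q^i \<noteq> q^(m+2*j)" "q^(2*j+1+i) \<noteq> q^m"
        unfolding q_pow_inj using i j m by auto
      ultimately show ?thesis using q0 by simp
    qed
    then show ?thesis
      using eq[of x] sum_quad_term_at_zero_of_d[OF b j(1,2)] by (simp add: a_def j(3))
  qed
  have "inj_on (\<lambda>j. 1/q^(2*j) + q * q^(2*j)) {m..<2*m+1}"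
  proof (rule inj_onI)
    fix i j assume "1/q^(2*i) + q * q^(2*i) = 1/q^(2*j) + q * q^(2*j)"
    \<comment> \<open>The map d -> d + q/d identifies only d and q/d. The second possibility would
      force an odd power of q to be 1.\<close>
    then have "(q^(2*i) - q^(2*j)) * (q^(1+2*i+2*j) - 1) = 0"
      using q0 by (simp add: field_simps power_add)
    then show "i = j"
      using q1[of "1+2*i+2*j"] q_pow_inj[of "2*i" "2*j"] by auto
  qed
  then have cZ: "card Z = m+1" by (simp add: Z_def card_image)
  have "degree P \<le> m"
    unfolding P_def
  proof (rule degree_sum_le)
    fix k assume "k \<in> {..m}"
    have "degree (\<Prod>i<k. L i) \<le> k"
      by (rule order.trans[OF degree_prod_sum_le]) (auto simp: L_def intro!: order.trans[OF sum_bounded_above[where K=1]])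
    moreover have "degree (\<Prod>i\<in>{k..<m}. D i) \<le> m - k"
      by (rule order.trans[OF degree_prod_sum_le]) (auto simp: D_def intro!: order.trans[OF sum_bounded_above[where K=1]])
    ultimately have "degree ((\<Prod>i<k. L i) * (\<Prod>i\<in>{k..<m}. D i)) \<le> m"
      using degree_mult_le[of "\<Prod>i<k. L i" "\<Prod>i\<in>{k..<m}. D i"] \<open>k \<in> {..m}\<close> by auto
    then show "degree (smult (c k) ((\<Prod>i<k. L i) * (\<Prod>i\<in>{k..<m}. D i))) \<le> m"
      by (rule order.trans[OF degree_smult_le])
  qed simp
  have "P = 0"
  proof (rule ccontr)
    assume "P \<noteq> 0"
    then have "card {x. poly P x = 0} \<le> degree P" "finite {x. poly P x = 0}"
      by (simp_all add: card_poly_roots_bound poly_roots_finite)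
    moreover have "Z \<subseteq> {x. poly P x = 0}" using Z0 by auto
    ultimately have "card Z \<le> degree P" by (meson card_mono order.trans)
    with cZ \<open>degree P \<le> m\<close> show False by simp
  qed
  have D0: "poly (D i) \<delta> \<noteq> 0" if "i < m" for i
    using d[OF that] unfolding PD a_def .
  have "(\<Sum>k\<le>m. quad_term q a \<beta> \<delta> k) * (\<Prod>i<m. poly (D i) \<delta>) = 0"
    using eq[OF D0] unfolding \<open>P = 0\<close> by simp
  moreover have "(\<Prod>i<m. poly (D i) \<delta>) \<noteq> 0" using D0 by simp
  ultimately show ?thesis unfolding a_def by (metis mult_eq_0_iff)
qed

text \<open>Drops the conditions on \<beta> for m <= i <= 2m, which came from the longer truncation.
  They exclude finitely many \<beta>, and the sum up to m is continuous in \<beta> at the given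
  point.\<close>

lemma sum_quad_term_vanishes:
  assumes b: "\<And>i. i < m \<Longrightarrow> 1 - (1/q^m) * \<beta> * q * (q^i)^2 + (1/q^m)^2 * q^3 * (q^i)^4 \<noteq> 0"
    and d: "\<And>i. i < m \<Longrightarrow> 1 - (1/q^m) * \<delta> * q^i + (1/q^m)^2 * q * (q^i)^2 \<noteq> 0"
  shows "(\<Sum>k\<le>m. quad_term q (1/q^m) \<beta> \<delta> k) = 0"
proof -
  define f where "f \<beta> = (\<Sum>k\<le>m. quad_term q (1/q^m) \<beta> \<delta> k)" for \<beta>
  have "isCont f \<beta>"
    unfolding f_def
  proof (rule continuous_sum, rule isCont_quad_term)
    fix k i assume "k \<in> {..m}" "i < k"
    then have i: "i < m" by simp
    show "1 - q^2 * (q^i)^2 \<noteq> 0"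
      using q1[of "2+i*2"] by (simp add: power_add power_mult del: One_nat_def power_Suc add_2_eq_Suc add_2_eq_Suc')
    show "1 - q * q^i / (1/q^m) \<noteq> 0"
      using q1[of "1+i+m"] by (simp add: power_add mult.assoc)
    show "1 - 1/q^m * \<beta> * q * (q^i)^2 + (1/q^m)^2 * q^3 * (q^i)^4 \<noteq> 0" using b i by simp
    show "1 - 1/q^m * \<delta> * q^i + (1/q^m)^2 * q * (q^i)^2 \<noteq> 0" using d i by simp
  qed (use q0 in simp_all)
  moreover have "isCont (\<lambda>_. 0) \<beta>" by simp
  moreover have "eventually (\<lambda>x. f x = 0) (at \<beta>)"
  proof -
    define B where "B = (\<lambda>i. (1 + (1/q^m)^2 * q^3 * (q^i)^4) / ((1/q^m) * q * (q^i)^2)) ` {..<2*m+1}"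
    have 1: "eventually (\<lambda>a. a \<notin> B) (at (\<beta>))"
      by (rule eventually_not_in_finite) (simp add: B_def)
    then show ?thesis
    proof eventually_elim
      case (elim x)
      have x: "1 - (1/q^m) * x * q * (q^i)^2 + (1/q^m)^2 * q^3 * (q^i)^4 \<noteq> 0" if "i < 2*m+1" for i
      proof
        assume eq: "1 - (1/q^m) * x * q * (q^i)^2 + (1/q^m)^2 * q^3 * (q^i)^4 = 0"
        have "x * (u*v*w) = 1 + C" if "1 - u*x*v*w + C = 0" for u v w C :: complex
          using that by algebra
        from this[OF eq] have "x * ((1/q^m) * q * (q^i)^2) = 1 + (1/q^m)^2 * q^3 * (q^i)^4" .
        moreover have "(1/q^m) * q * (q^i)^2 \<noteq> 0" using q0 by simp
        ultimately have "x = (1 + (1/q^m)^2 * q^3 * (q^i)^4) / ((1/q^m) * q * (q^i)^2)"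
          by (rule eq_divide_imp[rotated])
        then show False using elim that unfolding B_def by blast
      qed
      show ?case unfolding f_def by (rule sum_quad_term_vanishes_generic_b[OF x d])
    qed
  qed
  ultimately have "f \<beta> = 0" by (rule isCont_eq_if_eventually_eq)
  then show ?thesis by (simp add: f_def)
qed

end

lemma root_of_unity_dvd:
  fixes \<zeta> :: complex
  assumes "\<zeta>^d = 1" "\<And>c. 0 < c \<Longrightarrow> c < d \<Longrightarrow> \<zeta>^c \<noteq> 1" "d > 0"
  shows "\<zeta>^c = 1 \<longleftrightarrow> d dvd c"
proof -
  have "\<zeta>^c = \<zeta>^(d * (c div d) + c mod d)" by simp
  also have "\<dots> = \<zeta>^(c mod d)" unfolding power_add power_mult using assms(1) by simp
  finally have *: "\<zeta>^c = \<zeta>^(c mod d)" .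
  show ?thesis
  proof
    assume "\<zeta>^c = 1"
    then have "\<zeta>^(c mod d) = 1" using * by simp
    then have "\<not> 0 < c mod d" using assms(2)[of "c mod d"] assms(3) by auto
    then show "d dvd c" by auto
  next
    assume "d dvd c"
    then show "\<zeta>^c = 1" using * by simp
  qed
qed

text \<open>
  Limit \<open>q \<rightarrow> \<zeta>\<^sup>2\<close> from inside the unit disc; note \<open>(\<zeta>\<^sup>2)\<^sup>-\<^sup>m = \<zeta>\<close>, so that \<open>a = q\<^sup>-\<^sup>m\<close> becomes the value
  \<open>a\<^sup>2 = q\<close> needed later.
\<close>

lemma sum_quad_term_root_of_unity:
  fixes \<zeta> :: complex
  assumes z: "\<zeta>^(2*m+1) = 1" "\<And>c. 0 < c \<Longrightarrow> c < 2*m+1 \<Longrightarrow> \<zeta>^c \<noteq> 1" and m: "m > 0"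
    and b: "\<And>i. i < m \<Longrightarrow> 1 - \<zeta> * \<beta> * \<zeta>^2 * ((\<zeta>^2)^i)^2 + \<zeta>^2 * (\<zeta>^2)^3 * ((\<zeta>^2)^i)^4 \<noteq> 0"
    and d: "\<And>i. i < m \<Longrightarrow> 1 - \<zeta> * \<delta> * (\<zeta>^2)^i + \<zeta>^2 * \<zeta>^2 * ((\<zeta>^2)^i)^2 \<noteq> 0"
  shows "(\<Sum>k\<le>m. quad_term (\<zeta>^2) \<zeta> \<beta> \<delta> k) = 0"
proof -
  define p where "p = \<zeta>^2"
  have dvd: "\<zeta>^c = 1 \<longleftrightarrow> 2*m+1 dvd c" for c
    using root_of_unity_dvd[OF z(1) z(2)] by simp
  have z0: "\<zeta> \<noteq> 0" using z(1) by auto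
  have pm: "1/p^m = \<zeta>"
    using z(1) z0 by (simp add: p_def field_simps flip: power_mult)
  have np: "norm p = 1"
    using power_eq_1_iff[of \<zeta> "2*m+1"] z(1) by (simp add: p_def norm_power)
  define f where "f x = (\<Sum>k\<le>m. quad_term x (1/x^m) \<beta> \<delta> k)" for x
  \<comment> \<open>Radial approach to p. The double \<open>Suc\<close> keeps the radius positive
    already at l = 0; a norm strictly between 0 and 1 rules out roots of unity.\<close>
  define x where "x l = p * of_real (1 - inverse (real (Suc (Suc l))))" for l
  have "x \<longlonglongrightarrow> p * of_real (1 - 0)"
    unfolding x_def
    by (intro tendsto_intros LIMSEQ_Suc[OF LIMSEQ_inverse_real_of_nat])
  then have x: "x \<longlonglongrightarrow> p" by simp
  have "isCont f p"
    unfolding f_def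
  proof (rule continuous_sum, rule isCont_quad_term)
    fix k i assume "k \<in> {..m}" "i < k"
    then have i: "i < m" by simp
    have "\<not> 2*m+1 dvd 4*(i+1)"
    proof
      assume "2*m+1 dvd 4*(i+1)"
      moreover have "coprime (2*m+1) (2*2)" unfolding coprime_mult_right_iff by simp
      then have "coprime (2*m+1) 4" by simp
      ultimately have "2*m+1 dvd i+1" using coprime_dvd_mult_right_iff by blast
      then show False using i by (auto dest: dvd_imp_le)
    qed
    then have "\<zeta>^(4*(i+1)) \<noteq> 1" using dvd by simp
    moreover have "p^2 * (p^i)^2 = \<zeta>^(4*(i+1))"
      by (simp add: p_def algebra_simps flip: power_mult power_add)
    ultimately show "1 - p^2 * (p^i)^2 \<noteq> 0" by simp
    have "p * p^i / (1/p^m) = \<zeta>^(2*i+1)"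
      unfolding pm using z0 by (simp add: p_def power2_eq_square power_mult)
    then show "1 - p * p^i / (1/p^m) \<noteq> 0"
      using z(2)[of "2*i+1"] i by simp
    show "1 - 1/p^m * \<beta> * p * (p^i)^2 + (1/p^m)^2 * p^3 * (p^i)^4 \<noteq> 0"
      using b[OF i] unfolding pm unfolding p_def .
    show "1 - 1/p^m * \<delta> * p^i + (1/p^m)^2 * p * (p^i)^2 \<noteq> 0"
      using d[OF i] unfolding pm unfolding p_def .
  qed (use z0 in \<open>auto intro!: continuous_intros simp: p_def\<close>)
  then have "(\<lambda>l. f (x l)) \<longlonglongrightarrow> f p" by (rule isCont_tendsto_compose[OF _ x])
  moreover have "eventually (\<lambda>l. f (x l) = 0) sequentially"
  proof -
    have p0: "p^m \<noteq> 0" using z0 by (simp add: p_def)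
    have 1: "eventually (\<lambda>l. \<forall>i\<in>{..<m}. 1 - (1/(x l)^m) * \<beta> * x l * ((x l)^i)^2 + (1/(x l)^m)^2 * (x l)^3 * ((x l)^i)^4 \<noteq> 0) sequentially"
    proof (intro eventually_ball_finite ballI)
      fix i assume "i \<in> {..<m}"
      have "(\<lambda>l. 1 - (1/(x l)^m) * \<beta> * x l * ((x l)^i)^2 + (1/(x l)^m)^2 * (x l)^3 * ((x l)^i)^4) \<longlonglongrightarrow>
         1 - (1/p^m) * \<beta> * p * (p^i)^2 + (1/p^m)^2 * p^3 * (p^i)^4"
        by (intro tendsto_intros x p0)
      then show "eventually (\<lambda>l. 1 - (1/(x l)^m) * \<beta> * x l * ((x l)^i)^2 + (1/(x l)^m)^2 * (x l)^3 * ((x l)^i)^4 \<noteq> 0) sequentially"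
        by (rule tendsto_imp_eventually_ne) (use b[of i] \<open>i \<in> {..<m}\<close> in \<open>unfold pm, simp add: p_def\<close>)
    qed simp
    have 2: "eventually (\<lambda>l. \<forall>i\<in>{..<m}. 1 - (1/(x l)^m) * \<delta> * (x l)^i + (1/(x l)^m)^2 * (x l) * ((x l)^i)^2 \<noteq> 0) sequentially"
    proof (intro eventually_ball_finite ballI)
      fix i assume "i \<in> {..<m}"
      have "(\<lambda>l. 1 - (1/(x l)^m) * \<delta> * (x l)^i + (1/(x l)^m)^2 * (x l) * ((x l)^i)^2) \<longlonglongrightarrow>
         1 - (1/p^m) * \<delta> * p^i + (1/p^m)^2 * p * (p^i)^2"
        by (intro tendsto_intros x p0)
      then show "eventually (\<lambda>l. 1 - (1/(x l)^m) * \<delta> * (x l)^i + (1/(x l)^m)^2 * (x l) * ((x l)^i)^2 \<noteq> 0) sequentially"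
        by (rule tendsto_imp_eventually_ne) (use d[of i] \<open>i \<in> {..<m}\<close> in \<open>unfold pm, simp add: p_def\<close>)
    qed simp
    from 1 2 show ?thesis
    proof eventually_elim
      case (elim l)
      have pos: "0 < 1 - inverse (real (Suc (Suc l)))" "1 - inverse (real (Suc (Suc l))) < 1"
        by (simp_all add: field_simps)
      then have nx: "0 < norm (x l)" "norm (x l) < 1"
        using np by (simp_all add: x_def norm_mult del: of_real_diff)
      have ne1: "(x l)^c \<noteq> 1" if "c > 0" for c
      proof
        assume "(x l)^c = 1"
        then have "norm (x l)^c = 1" by (simp flip: norm_power)
        moreover have "norm (x l)^c < 1" using nx that by (simp add: power_less_one_iff)
        ultimately show False by simp
      qed
      show ?case unfolding f_def
        by (rule sum_quad_term_vanishes) (use elim nx ne1 m in auto)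
    qed
  qed
  then have "(\<lambda>l. f (x l)) \<longlonglongrightarrow> 0" by (rule tendsto_eventually)
  ultimately have "f p = 0" by (rule LIMSEQ_unique)
  then show ?thesis unfolding f_def pm unfolding p_def .
qed

section \<open>The local ring of rational functions at a point\<close>

text \<open>Membership in the e-th power of the maximal ideal of the local ring at \<zeta>. The case
  e = 0 says that A is regular at \<zeta>.\<close>

definition vanishes_at :: "complex \<Rightarrow> nat \<Rightarrow> complex poly fract \<Rightarrow> bool"
  where "vanishes_at \<zeta> e A \<longleftrightarrow> (\<exists>a b. poly b \<zeta> \<noteq> 0 \<and> [:-\<zeta>, 1:]^e dvd a \<and> A = Fract a b)"

text \<open>The residue map of the local ring, as a relation, so that stating a value includes
  regularity at \<zeta>.\<close>

definition evals_to :: "complex \<Rightarrow> complex poly fract \<Rightarrow> complex \<Rightarrow> bool"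
  where "evals_to \<zeta> A v \<longleftrightarrow> (\<exists>a b. poly b \<zeta> \<noteq> 0 \<and> A = Fract a b \<and> v = poly a \<zeta> / poly b \<zeta>)"

lemma nonzero_if_poly_nonzero: "poly b \<zeta> \<noteq> (0::complex) \<Longrightarrow> b \<noteq> 0"
  by auto

lemma vanishes_at_0 [simp]: "vanishes_at \<zeta> e 0"
  unfolding vanishes_at_def Zero_fract_def by (rule exI[of _ 0], rule exI[of _ 1]) auto

lemma vanishes_at_add:
  assumes "vanishes_at \<zeta> e A" "vanishes_at \<zeta> e B"
  shows "vanishes_at \<zeta> e (A + B)"
proof -
  obtain a b c d where *: "poly b \<zeta> \<noteq> 0" "[:-\<zeta>, 1:]^e dvd a" "A = Fract a b"
    "poly d \<zeta> \<noteq> 0" "[:-\<zeta>, 1:]^e dvd c" "B = Fract c d"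
    using assms unfolding vanishes_at_def by metis
  then have "A + B = Fract (a * d + c * b) (b * d)" by (simp add: nonzero_if_poly_nonzero)
  then show ?thesis unfolding vanishes_at_def
    using * by (intro exI[of _ "a * d + c * b"] exI[of _ "b * d"]) simp
qed

lemma vanishes_at_mult:
  assumes "vanishes_at \<zeta> e A" "vanishes_at \<zeta> f B"
  shows "vanishes_at \<zeta> (e + f) (A * B)"
proof -
  obtain a b c d where *: "poly b \<zeta> \<noteq> 0" "[:-\<zeta>, 1:]^e dvd a" "A = Fract a b"
    "poly d \<zeta> \<noteq> 0" "[:-\<zeta>, 1:]^f dvd c" "B = Fract c d"
    using assms unfolding vanishes_at_def by metis
  then have "A * B = Fract (a * c) (b * d)" by simp
  then show ?thesis unfolding vanishes_at_def
    using * by (intro exI[of _ "a * c"] exI[of _ "b * d"]) (simp add: power_add mult_dvd_mono)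
qed

lemma vanishes_at_mono:
  assumes "vanishes_at \<zeta> e A" "f \<le> e"
  shows "vanishes_at \<zeta> f A"
proof -
  obtain a b where *: "poly b \<zeta> \<noteq> 0" "[:-\<zeta>, 1:]^e dvd a" "A = Fract a b"
    using assms unfolding vanishes_at_def by metis
  moreover have "[:-\<zeta>, 1:]^f dvd a" by (rule dvd_trans[OF le_imp_power_dvd[OF assms(2)] *(2)])
  ultimately show ?thesis unfolding vanishes_at_def by (intro exI[of _ a] exI[of _ b]) simp
qed

lemma vanishes_at_uminus: "vanishes_at \<zeta> e A \<Longrightarrow> vanishes_at \<zeta> e (- A)"
  unfolding vanishes_at_def by (metis dvd_minus_iff minus_fract)

lemma vanishes_at_diff: "vanishes_at \<zeta> e A \<Longrightarrow> vanishes_at \<zeta> e B \<Longrightarrow> vanishes_at \<zeta> e (A - B)"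
  using vanishes_at_add[of \<zeta> e A "- B"] vanishes_at_uminus by simp

lemma vanishes_at_sum: "(\<And>i. i \<in> I \<Longrightarrow> vanishes_at \<zeta> e (f i)) \<Longrightarrow> vanishes_at \<zeta> e (\<Sum>i\<in>I. f i)"
  by (induction I rule: infinite_finite_induct) (auto intro: vanishes_at_add)

lemma evals_toI: "poly b \<zeta> \<noteq> 0 \<Longrightarrow> A = Fract a b \<Longrightarrow> v = poly a \<zeta> / poly b \<zeta> \<Longrightarrow> evals_to \<zeta> A v"
  unfolding evals_to_def by blast

lemma evals_to_0: "evals_to \<zeta> 0 0"
  by (rule evals_toI[of 1 _ _ 0]) (auto simp: Zero_fract_def)

lemma evals_to_1: "evals_to \<zeta> 1 1"
  by (rule evals_toI[of 1 _ _ 1]) (auto simp: One_fract_def)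

lemma evals_to_X: "evals_to \<zeta> (to_fract [:0, 1:]) \<zeta>"
  by (rule evals_toI[of 1 _ _ "[:0,1:]"]) (auto simp: to_fract_def)

lemma evals_to_add:
  assumes "evals_to \<zeta> A v" "evals_to \<zeta> B w" shows "evals_to \<zeta> (A + B) (v + w)"
proof -
  obtain a b c d where *: "poly b \<zeta> \<noteq> 0" "v = poly a \<zeta> / poly b \<zeta>" "A = Fract a b"
    "poly d \<zeta> \<noteq> 0" "w = poly c \<zeta> / poly d \<zeta>" "B = Fract c d"
    using assms unfolding evals_to_def by metis
  then have "A + B = Fract (a * d + c * b) (b * d)" by (simp add: nonzero_if_poly_nonzero)
  then show ?thesis
    by (rule evals_toI[rotated]) (use * in \<open>auto simp: add_frac_eq\<close>)
qed

lemma evals_to_mult: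
  assumes "evals_to \<zeta> A v" "evals_to \<zeta> B w" shows "evals_to \<zeta> (A * B) (v * w)"
proof -
  obtain a b c d where *: "poly b \<zeta> \<noteq> 0" "v = poly a \<zeta> / poly b \<zeta>" "A = Fract a b"
    "poly d \<zeta> \<noteq> 0" "w = poly c \<zeta> / poly d \<zeta>" "B = Fract c d"
    using assms unfolding evals_to_def by metis
  then have "A * B = Fract (a * c) (b * d)" by simp
  then show ?thesis
    by (rule evals_toI[rotated]) (use * in auto)
qed

lemma evals_to_inverse:
  assumes "evals_to \<zeta> A v" "v \<noteq> 0" shows "evals_to \<zeta> (inverse A) (inverse v)"
proof -
  obtain a b where *: "poly b \<zeta> \<noteq> 0" "v = poly a \<zeta> / poly b \<zeta>" "A = Fract a b"
    using assms unfolding evals_to_def by metis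
  then show ?thesis
    using assms(2) by (intro evals_toI[of a _ _ b]) auto
qed

lemma evals_to_uminus: "evals_to \<zeta> A v \<Longrightarrow> evals_to \<zeta> (- A) (- v)"
  unfolding evals_to_def by (metis minus_divide_left minus_fract poly_minus)

lemma evals_to_diff: "evals_to \<zeta> A v \<Longrightarrow> evals_to \<zeta> B w \<Longrightarrow> evals_to \<zeta> (A - B) (v - w)"
  using evals_to_add[of \<zeta> A v "- B" "- w"] evals_to_uminus by simp

lemma evals_to_divide: "evals_to \<zeta> A v \<Longrightarrow> evals_to \<zeta> B w \<Longrightarrow> w \<noteq> 0 \<Longrightarrow> evals_to \<zeta> (A / B) (v / w)"
  using evals_to_mult[of \<zeta> A v "inverse B" "inverse w"] evals_to_inverse by (simp add: divide_inverse)

lemma evals_to_power: "evals_to \<zeta> A v \<Longrightarrow> evals_to \<zeta> (A ^ n) (v ^ n)"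
  by (induction n) (auto intro: evals_to_mult evals_to_1)

lemma evals_to_sum: "(\<And>i. i \<in> I \<Longrightarrow> evals_to \<zeta> (f i) (g i)) \<Longrightarrow> evals_to \<zeta> (\<Sum>i\<in>I. f i) (\<Sum>i\<in>I. g i)"
  by (induction I rule: infinite_finite_induct) (auto intro: evals_to_add evals_to_0)

lemma evals_to_prod: "(\<And>i. i \<in> I \<Longrightarrow> evals_to \<zeta> (f i) (g i)) \<Longrightarrow> evals_to \<zeta> (\<Prod>i\<in>I. f i) (\<Prod>i\<in>I. g i)"
  by (induction I rule: infinite_finite_induct) (auto intro: evals_to_mult evals_to_1)

lemma evals_to_2: "evals_to \<zeta> 2 2"
  using evals_to_add[OF evals_to_1 evals_to_1] by simp

lemmas evals_to_intros = evals_to_0 evals_to_1 evals_to_2 evals_to_X evals_to_add evals_to_mult evals_to_uminus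
  evals_to_diff evals_to_divide evals_to_power evals_to_sum evals_to_prod

lemma vanishes_at_1I: "evals_to \<zeta> A 0 \<Longrightarrow> vanishes_at \<zeta> 1 A"
  unfolding evals_to_def vanishes_at_def by (auto simp: poly_eq_0_iff_dvd)

lemma vanishes_at_0I: "evals_to \<zeta> A v \<Longrightarrow> vanishes_at \<zeta> 0 A"
  unfolding evals_to_def vanishes_at_def by auto

lemma vanishes_at_0E:
  assumes "vanishes_at \<zeta> 0 A" obtains v where "evals_to \<zeta> A v"
  using assms unfolding evals_to_def vanishes_at_def by auto

lemma vanishes_at_divide_unit:
  assumes "vanishes_at \<zeta> e A" "evals_to \<zeta> u v" "v \<noteq> 0"
  shows "vanishes_at \<zeta> e (A / u)"
  using vanishes_at_mult[OF assms(1) vanishes_at_0I[OF evals_to_inverse[OF assms(2,3)]]]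
  by (simp add: divide_inverse)

lemma evals_to_nonzero: "evals_to \<zeta> A v \<Longrightarrow> v \<noteq> 0 \<Longrightarrow> A \<noteq> 0"
  by (auto simp: evals_to_def Zero_fract_def eq_fract nonzero_if_poly_nonzero)

section \<open>From local orders of vanishing to a congruence of rational functions\<close>

lemma linear_power_dvd_cancel:
  fixes a b :: "complex poly"
  assumes "[:-\<zeta>, 1:]^e dvd a * b" "poly b \<zeta> \<noteq> 0"
  shows "[:-\<zeta>, 1:]^e dvd a"
proof (cases "a = 0")
  case False
  have "b \<noteq> 0" using assms(2) by auto
  moreover have "order \<zeta> b = 0" using assms(2) by (simp add: order_root \<open>b \<noteq> 0\<close>)
  ultimately show ?thesis using assms(1) False by (simp add: order_divides order_mult)
qed simp

lemma prod_linear_power_dvd: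
  fixes a :: "complex poly"
  assumes "finite R" "\<And>\<zeta>. \<zeta> \<in> R \<Longrightarrow> [:-\<zeta>, 1:]^(e \<zeta>) dvd a"
  shows "(\<Prod>\<zeta>\<in>R. [:-\<zeta>, 1:]^(e \<zeta>)) dvd a"
  using assms
proof (induction R rule: finite_induct)
  case (insert z R)
  then obtain c where c: "a = (\<Prod>\<zeta>\<in>R. [:-\<zeta>, 1:]^(e \<zeta>)) * c" by (auto elim: dvdE)
  have "[:-z, 1:]^(e z) dvd c * (\<Prod>\<zeta>\<in>R. [:-\<zeta>, 1:]^(e \<zeta>))"
    using insert.prems[of z] c by (simp add: mult.commute)
  moreover have "poly (\<Prod>\<zeta>\<in>R. [:-\<zeta>, 1:]^(e \<zeta>)) z \<noteq> 0"
    using insert.hyps by (auto simp: poly_prod)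
  ultimately have "[:-z, 1:]^(e z) dvd c" by (rule linear_power_dvd_cancel)
  then show ?case using insert.hyps c by (simp add: mult_dvd_mono mult.commute)
qed simp

text \<open>Local conditions at different \<zeta> come with different fractions. One with
  denominator of least degree serves them all: if its denominator had a root \<zeta> where A is
  regular, the numerator would share it and a linear factor could be cancelled.\<close>

lemma minimal_fract:
  fixes A :: "complex poly fract"
  obtains a b where "b \<noteq> 0" "A = Fract a b"
    "\<And>\<zeta> e. vanishes_at \<zeta> e A \<Longrightarrow> poly b \<zeta> \<noteq> 0 \<and> [:-\<zeta>, 1:]^e dvd a"
proof -
  define Q where "Q n \<longleftrightarrow> (\<exists>a b. b \<noteq> 0 \<and> A = Fract a b \<and> degree b = n)" for n
  have "\<exists>n. Q n" unfolding Q_def by (cases A) auto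
  then have Q: "Q (LEAST n. Q n)" and least: "\<And>n. Q n \<Longrightarrow> (LEAST n. Q n) \<le> n"
    by (auto intro: LeastI_ex Least_le)
  then obtain a b where ab: "b \<noteq> 0" "A = Fract a b" "degree b = (LEAST n. Q n)"
    unfolding Q_def by blast
  have "poly b \<zeta> \<noteq> 0 \<and> [:-\<zeta>, 1:]^e dvd a" if v: "vanishes_at \<zeta> e A" for \<zeta> e
  proof -
    obtain c d where cd: "poly d \<zeta> \<noteq> 0" "[:-\<zeta>, 1:]^e dvd c" "A = Fract c d"
      using v unfolding vanishes_at_def by metis
    have eq: "a * d = c * b" using ab cd by (simp add: eq_fract nonzero_if_poly_nonzero)
    have b: "poly b \<zeta> \<noteq> 0"
    proof
      assume 0: "poly b \<zeta> = 0"
      then have "poly (a * d) \<zeta> = 0" using eq by simp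
      then have "poly a \<zeta> = 0" using cd(1) by simp
      then obtain a' b' where a': "a = [:-\<zeta>, 1:] * a'" and b': "b = [:-\<zeta>, 1:] * b'"
        using 0 by (auto simp: poly_eq_0_iff_dvd elim!: dvdE)
      have "b' \<noteq> 0" using b' ab(1) by auto
      moreover have "A = Fract a' b'"
        unfolding ab(2) eq_fract(1)[OF ab(1) \<open>b' \<noteq> 0\<close>] by (simp only: a' b' mult_ac)
      ultimately have "Q (degree b')" unfolding Q_def by blast
      then have "degree b \<le> degree b'" using least ab(3) by simp
      moreover have "degree b = Suc (degree b')"
        unfolding b' using \<open>b' \<noteq> 0\<close> by (subst degree_mult_eq) auto
      ultimately show False by simp
    qed
    moreover have "[:-\<zeta>, 1:]^e dvd a"
      by (rule linear_power_dvd_cancel[of _ _ _ d]) (use eq cd in \<open>auto intro: dvd_mult2\<close>)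
    ultimately show ?thesis ..
  qed
  then show ?thesis using that ab by blast
qed

lemma coprime_polyI:
  fixes b P :: "complex poly"
  assumes "b \<noteq> 0" "\<And>z. poly P z = 0 \<Longrightarrow> poly b z \<noteq> 0"
  shows "coprime b P"
proof (rule coprimeI)
  fix d assume d: "d dvd b" "d dvd P"
  have "degree d = 0"
  proof (rule ccontr)
    assume "degree d \<noteq> 0"
    then have "\<not> constant (poly d)" by (simp add: constant_degree)
    then obtain z where "poly d z = 0" using fundamental_theorem_of_algebra by blast
    then have "poly b z = 0" "poly P z = 0" using d by (auto elim!: dvdE)
    then show False using assms(2) by auto
  qed
  then show "is_unit d" using d(1) assms(1) by (auto simp: is_unit_iff_degree)
qed

text \<open>Local-to-global principle: over the complex numbers, divisibility by P and coprimality
  to P can be tested at the roots of P with multiplicity.\<close>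

lemma ratfun_congI:
  assumes "finite R" and P: "P dvd (\<Prod>\<zeta>\<in>R. [:-\<zeta>, 1:]^(e \<zeta>))"
    and loc: "\<And>\<zeta>. \<zeta> \<in> R \<Longrightarrow> vanishes_at \<zeta> 0 B" "\<And>\<zeta>. \<zeta> \<in> R \<Longrightarrow> vanishes_at \<zeta> (e \<zeta>) (A - B)"
  shows "ratfun_cong A B P"
proof -
  have roots: "z \<in> R" if "poly P z = 0" for z
  proof -
    have "poly (\<Prod>\<zeta>\<in>R. [:-\<zeta>, 1:]^(e \<zeta>)) z = 0" using P that by (auto elim!: dvdE)
    then show ?thesis using assms(1) by (auto simp: poly_prod split: if_splits)
  qed
  have locA: "vanishes_at \<zeta> 0 A" if "\<zeta> \<in> R" for \<zeta>
    using vanishes_at_add[OF vanishes_at_mono[OF loc(2)[OF that]] loc(1)[OF that]] by simp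
  have dc: "denom_coprime P C" if C: "\<And>\<zeta>. \<zeta> \<in> R \<Longrightarrow> vanishes_at \<zeta> 0 C" for C
  proof (rule minimal_fract[of C])
    fix a b assume "b \<noteq> 0" "C = Fract a b"
      "\<And>\<zeta> e. vanishes_at \<zeta> e C \<Longrightarrow> poly b \<zeta> \<noteq> 0 \<and> [:- \<zeta>, 1:] ^ e dvd a"
    then show ?thesis
      unfolding denom_coprime_def using C roots coprime_polyI[of b P] by blast
  qed
  have "\<exists>a b. b \<noteq> 0 \<and> coprime b P \<and> P dvd a \<and> A - B = Fract a b"
  proof (rule minimal_fract[of "A - B"])
    fix a b assume *: "b \<noteq> 0" "A - B = Fract a b"
      "\<And>\<zeta> e. vanishes_at \<zeta> e (A - B) \<Longrightarrow> poly b \<zeta> \<noteq> 0 \<and> [:- \<zeta>, 1:] ^ e dvd a"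
    have "coprime b P" using *(1,3) loc(2) roots by (intro coprime_polyI) blast+
    moreover have "P dvd a"
      by (rule dvd_trans[OF P], rule prod_linear_power_dvd[OF assms(1)]) (use *(3) loc(2) in metis)
    ultimately show ?thesis using * by blast
  qed
  then show ?thesis unfolding ratfun_cong_def using dc locA loc(1) by blast
qed

text \<open>The two polynomials agree up to sign, since the roots of unity are simple roots; stating
  divisibility avoids carrying the sign.\<close>

lemma one_minus_X_power_dvd:
  assumes "n > 0"
  shows "1 - [:0, 1:]^n dvd (\<Prod>\<zeta> | \<zeta>^n = 1. [:-\<zeta>, 1::complex:])"
proof -
  define p where "p = 1 - [:0, 1::complex:]^n"
  have pr: "poly p z = 1 - z^n" for z by (simp add: p_def poly_power)
  have "rsquarefree p"
    unfolding rsquarefree_roots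
  proof (intro allI notI)
    fix a assume "poly p a = 0 \<and> poly (pderiv p) a = 0"
    then have "a^n = 1" "of_nat n * a^(n-1) = 0"
      using assms by (auto simp: pr p_def pderiv_diff pderiv_power poly_power pderiv_pCons)
    then show False using assms by (auto simp: power_0_left)
  qed
  then have "p = smult (lead_coeff p) (\<Prod>z | poly p z = 0. [:-z, 1:])"
    using complex_poly_decompose_rsquarefree by metis
  moreover have "{z. poly p z = 0} = {z. z^n = 1}" by (auto simp: pr)
  ultimately have "p = smult (lead_coeff p) (\<Prod>z | z^n = 1. [:-z, 1:])" by simp
  moreover have "lead_coeff p \<noteq> 0"
  proof -
    have "poly p 0 \<noteq> 0" using assms by (simp add: pr zero_power)
    then have "p \<noteq> 0" by auto
    then show ?thesis by simp
  qed
  ultimately show ?thesis unfolding p_def by (metis dvd_refl smult_dvd_iff)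
qed

text \<open>The order of [n] \<Phi>_n^4 at an n-th root of unity other than 1: one from [n], and
  four more from \<Phi>_n^4 if the root is primitive.\<close>

definition modulus_exponent :: "nat \<Rightarrow> complex \<Rightarrow> nat"
  where "modulus_exponent n \<zeta> = (if \<forall>m. 0 < m \<and> m < n \<longrightarrow> \<zeta>^m \<noteq> 1 then 5 else 1)"

lemma modulus_dvd:
  assumes "n > 1"
  shows "q_int [:0, 1:] n * cyclotomic_poly n ^ 4 dvd
    (\<Prod>\<zeta> | \<zeta>^n = 1 \<and> \<zeta> \<noteq> 1. [:-\<zeta>, 1:]^(modulus_exponent n \<zeta>))"
proof -
  have fin: "finite {\<zeta>::complex. \<zeta>^n = 1}" using assms by (intro finite_roots_unity) simp
  define R where "R = {\<zeta>::complex. \<zeta>^n = 1 \<and> \<zeta> \<noteq> 1}"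
  define R' where "R' = {\<zeta>::complex. \<zeta>^n = 1 \<and> (\<forall>m. 0 < m \<and> m < n \<longrightarrow> \<zeta>^m \<noteq> 1)}"
  have R: "{\<zeta>::complex. \<zeta>^n = 1} = insert 1 R" "1 \<notin> R" "finite R"
    using fin by (auto simp: R_def intro: finite_subset[OF _ fin])
  have R': "R' \<subseteq> R" using assms by (auto simp: R_def R'_def)
  have ne: "1 - [:0, 1::complex:] \<noteq> 0" by (simp add: one_pCons)
  have "(1 - [:0, 1::complex:]) * q_int [:0, 1:] n = 1 - [:0, 1:]^n"
  proof -
    have "[:0, 1::complex:] \<noteq> 1" using ne by auto
    from q_int_eq_sum[OF this] show ?thesis by (simp only: one_diff_power_eq)
  qed
  also have "\<dots> dvd [:-1, 1::complex:] * (\<Prod>\<zeta>\<in>R. [:-\<zeta>, 1:])"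
    using one_minus_X_power_dvd[of n] assms R by simp
  finally have "(1 - [:0, 1:]) * q_int [:0, 1:] n dvd [:-1, 1::complex:] * (\<Prod>\<zeta>\<in>R. [:-\<zeta>, 1:])" .
  also have "\<dots> = (1 - [:0, 1::complex:]) * (- (\<Prod>\<zeta>\<in>R. [:-\<zeta>, 1:]))"
    by (simp add: one_pCons)
  finally have 1: "q_int [:0, 1:] n dvd (\<Prod>\<zeta>\<in>R. [:-\<zeta>, 1::complex:])"
    using ne by (subst (asm) dvd_mult_cancel_left) auto
  have "(\<Prod>\<zeta>\<in>R. [:-\<zeta>, 1::complex:]^(modulus_exponent n \<zeta>)) =
    (\<Prod>\<zeta>\<in>R. [:-\<zeta>, 1:] * (if \<zeta> \<in> R' then [:-\<zeta>, 1:]^4 else 1))"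
  proof (rule prod.cong)
    fix \<zeta> assume "\<zeta> \<in> R"
    then have *: "\<zeta> \<in> R' \<longleftrightarrow> (\<forall>m. 0 < m \<and> m < n \<longrightarrow> \<zeta>^m \<noteq> 1)" by (simp add: R_def R'_def)
    have "modulus_exponent n \<zeta> = (if \<zeta> \<in> R' then 5 else 1)"
      by (simp only: modulus_exponent_def *)
    then show "[:-\<zeta>, 1::complex:]^(modulus_exponent n \<zeta>) = [:-\<zeta>, 1:] * (if \<zeta> \<in> R' then [:-\<zeta>, 1:]^4 else 1)"
      by (simp add: eval_nat_numeral)
  qed simp
  also have "\<dots> = (\<Prod>\<zeta>\<in>R. [:-\<zeta>, 1:]) * cyclotomic_poly n ^ 4"
    unfolding prod.distrib cyclotomic_poly_def R'_def[symmetric] prod_power_distrib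
    using R(3) R' by (simp add: prod.If_cases Int_absorb1)
  finally show ?thesis using 1 by (simp add: R_def[symmetric] mult_dvd_mono)
qed

section \<open>The two-parameter deformation\<close>

text \<open>
  The deformation parameters are \<open>s = 2 - x - 1/x\<close> and \<open>t = 2 - y - 1/y\<close>; the summand of the theorem
  is the case \<open>s = t = 0\<close>, that is \<open>x = y = 1\<close>.
\<close>

definition factor_s :: "'a::field \<Rightarrow> 'a \<Rightarrow> nat \<Rightarrow> 'a"
  where "factor_s r s k = (\<Prod>i<k. ((1 - r^(2*i+1))^2 + r^(2*i+1) * s) / ((1 - r^(4*i+4))^2 + r^(4*i+4) * s))"

text \<open>The dependence on s and that on t sit in separate factors, so each term of F is a weight
  times a function of s times a function of t, and its mixed second difference is a product of two
  differences. The parameter-free quotient could go to either side.\<close>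

definition factor_t :: "'a::field \<Rightarrow> 'a \<Rightarrow> nat \<Rightarrow> 'a"
  where "factor_t r t k = (\<Prod>i<k. ((1 - r^(4*i+2)) * ((1 - r^(4*i+1))^2 + r^(4*i+1) * t)) /
    ((1 - r^(4*i+4)) * ((1 - r^(2*i+2))^2 + r^(2*i+2) * t)))"

text \<open>With 2 - s = x + 1/x, the value \<beta> = r (2 - s) is b + r^2/b for b = r x; likewise d
  = r y. For base r^2 and a = r the factors 1 - a K and 1 - q K/a, where K = q^i, coincide and
  cancel, which is where the hypothesis on r^(2i+1) is used.\<close>

lemma quad_term_factor:
  fixes r s t :: "'a::field"
  assumes "r \<noteq> 0" "\<And>i. i < k \<Longrightarrow> r^(2*i+1) \<noteq> 1"
  shows "quad_term (r^2) r (r * (2 - s)) (r * (2 - t)) k = (1 - r^(6*k+1)) * r^(2*k) * (factor_s r s k * factor_t r t k)"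
proof -
  have "term_ratio (r^2) r (r * (2 - s)) (r * (2 - t)) ((r^2)^i) =
    (((1 - r^(2*i+1))^2 + r^(2*i+1) * s) / ((1 - r^(4*i+4))^2 + r^(4*i+4) * s)) *
    (((1 - r^(4*i+2)) * ((1 - r^(4*i+1))^2 + r^(4*i+1) * t)) /
    ((1 - r^(4*i+4)) * ((1 - r^(2*i+2))^2 + r^(2*i+2) * t)))" if "i < k" for i
  proof -
    define x where "x = r^(2*i)"
    have p: "(r^2)^i = x" "r^(2*i+1) = r*x" "r^(4*i+4) = r^4*x^2" "r^(4*i+2) = r^2*x^2"
      "r^(4*i+1) = r*x^2" "r^(2*i+2) = r^2*x"
      by (simp_all add: x_def power_add mult.commute flip: power_mult) (simp_all add: power2_eq_square)
    have nz: "1 - r*x \<noteq> 0" using assms(2)[OF that] unfolding p by simp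
    have e: "r^2*x/r = r*x" using assms(1) by (simp add: power2_eq_square)
    have 1: "1 - (r*(2-s))*x + r^2*x^2 = (1-r*x)^2 + r*x*s"
      "1 - (r*(2-t))*x^2 + r^2*x^4 = (1-r*x^2)^2 + r*x^2*t"
      "1 - (r^2)^2*x^2 = 1 - r^4*x^2"
      "1 - r*(r*(2-s))*r^2*x^2 + r^2*(r^2)^3*x^4 = (1-r^4*x^2)^2 + r^4*x^2*s"
      "1 - r*(r*(2-t))*x + r^2*r^2*x^2 = (1-r^2*x)^2 + r^2*x*t"
      by algebra+
    show ?thesis unfolding p term_ratio_def 1 e using nz by (simp add: mult.commute mult.left_commute)
  qed
  then have "(\<Prod>i<k. term_ratio (r^2) r (r * (2 - s)) (r * (2 - t)) ((r^2)^i)) = factor_s r s k * factor_t r t k"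
    unfolding factor_s_def factor_t_def prod.distrib[symmetric] by (intro prod.cong) auto
  then show ?thesis
    by (simp add: quad_term_def mult.commute flip: power_mult)
qed

section \<open>First-order expansions and the mixed second difference\<close>

text \<open>
  The pair \<open>(A, A')\<close> consists of the values at \<open>0\<close> and at \<open>s\<close> of a rational function whose reduction
  at \<open>q = \<zeta>\<close> is \<open>f\<close>.
\<close>

definition first_order :: "complex \<Rightarrow> complex poly fract \<Rightarrow> complex poly fract \<Rightarrow> complex poly fract \<Rightarrow> (complex \<Rightarrow> complex) \<Rightarrow> bool"
  where "first_order \<zeta> s A A' f \<longleftrightarrow> evals_to \<zeta> A (f 0) \<and>
    (\<exists>\<gamma> D. A' - A = s * \<gamma> \<and> evals_to \<zeta> \<gamma> D \<and> (f has_field_derivative D) (at 0))"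

lemma first_order_const: "evals_to \<zeta> A v \<Longrightarrow> first_order \<zeta> s A A (\<lambda>_. v)"
  unfolding first_order_def by (auto intro!: exI[of _ 0] evals_to_0)

text \<open>The product \<open>w * 0\<close> is left unsimplified so that the rule unifies with the
  factors of \<open>factor_s x 0 k\<close> and \<open>factor_t x 0 k\<close>.\<close>

lemma first_order_linear:
  assumes "evals_to \<zeta> u a" "evals_to \<zeta> w b"
  shows "first_order \<zeta> s (u + w * 0) (u + w * s) (\<lambda>x. a + b * x)"
proof -
  have "((\<lambda>x. a + b * x) has_field_derivative b) (at 0)"
    by (auto intro!: derivative_eq_intros)
  then show ?thesis unfolding first_order_def using assms by (auto intro!: exI[of _ w] exI[of _ b])
qed

lemma first_order_mult:
  assumes "evals_to \<zeta> s 0" "first_order \<zeta> s A A' f" "first_order \<zeta> s B B' g"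
  shows "first_order \<zeta> s (A * B) (A' * B') (\<lambda>x. f x * g x)"
proof -
  obtain c C d D where *: "A' - A = s * c" "evals_to \<zeta> c C" "(f has_field_derivative C) (at 0)"
    "B' - B = s * d" "evals_to \<zeta> d D" "(g has_field_derivative D) (at 0)"
    "evals_to \<zeta> A (f 0)" "evals_to \<zeta> B (g 0)"
    using assms unfolding first_order_def by metis
  have "A' * B' - A * B = s * (c * B + A * d + s * c * d)"
    using *(1,4) by algebra
  moreover have "evals_to \<zeta> (c * B + A * d + s * c * d) (C * g 0 + f 0 * D + 0 * C * D)"
    by (intro evals_to_intros * assms(1))
  moreover have "((\<lambda>x. f x * g x) has_field_derivative (C * g 0 + f 0 * D + 0 * C * D)) (at 0)"
    using *(3,6) by (auto intro!: derivative_eq_intros)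
  ultimately show ?thesis unfolding first_order_def using * by (blast intro: evals_to_mult)
qed

lemma first_order_inverse:
  assumes "evals_to \<zeta> s 0" "first_order \<zeta> s A A' f" "f 0 \<noteq> 0"
  shows "first_order \<zeta> s (inverse A) (inverse A') (\<lambda>x. inverse (f x))"
proof -
  obtain c C where *: "A' - A = s * c" "evals_to \<zeta> c C" "(f has_field_derivative C) (at 0)"
    "evals_to \<zeta> A (f 0)"
    using assms unfolding first_order_def by metis
  have "A' = A + s * c" using *(1) by (simp add: algebra_simps)
  moreover have "evals_to \<zeta> (A + s * c) (f 0 + 0 * C)" by (intro evals_to_intros * assms(1))
  ultimately have A': "evals_to \<zeta> A' (f 0)" by simp
  have nz: "A \<noteq> 0" "A' \<noteq> 0" using evals_to_nonzero[OF *(4) assms(3)] evals_to_nonzero[OF A' assms(3)] by auto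
  have "inverse A' - inverse A = - (A' - A) / (A' * A)" using nz by (simp add: field_simps)
  also have "\<dots> = s * (- (c / (A' * A)))" by (simp add: *(1))
  finally have "inverse A' - inverse A = s * (- (c / (A' * A)))" .
  moreover have "evals_to \<zeta> (- (c / (A' * A))) (- (C / (f 0 * f 0)))"
    using assms(3) by (intro evals_to_intros * A') auto
  moreover have "((\<lambda>x. inverse (f x)) has_field_derivative (- (C / (f 0 * f 0)))) (at 0)"
    using *(3) assms(3) by (auto intro!: derivative_eq_intros simp: divide_inverse)
  ultimately show ?thesis unfolding first_order_def using * assms(3) by (blast intro: evals_to_inverse)
qed

lemma first_order_divide:
  assumes "evals_to \<zeta> s 0" "first_order \<zeta> s A A' f" "first_order \<zeta> s B B' g" "g 0 \<noteq> 0"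
  shows "first_order \<zeta> s (A / B) (A' / B') (\<lambda>x. f x / g x)"
  using first_order_mult[OF assms(1,2) first_order_inverse[OF assms(1,3,4)]] by (simp add: divide_inverse)

lemma first_order_prod:
  assumes "evals_to \<zeta> s 0" "\<And>i. i \<in> I \<Longrightarrow> first_order \<zeta> s (A i) (A' i) (f i)"
  shows "first_order \<zeta> s (\<Prod>i\<in>I. A i) (\<Prod>i\<in>I. A' i) (\<lambda>x. \<Prod>i\<in>I. f i x)"
  using assms(2)
proof (induction I rule: infinite_finite_induct)
  case (insert i F)
  then show ?case using first_order_mult[OF assms(1), of "A i" "A' i" "f i"] by simp
qed (auto intro!: first_order_const evals_to_1)

lemma derivative_of_eventually_zero:
  fixes f :: "complex \<Rightarrow> complex"
  assumes "(f has_field_derivative D) (at 0)" "eventually (\<lambda>x. f x = 0) (nhds 0)"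
  shows "D = 0"
proof -
  have "((\<lambda>_. 0) has_field_derivative D) (at (0::complex))"
    using assms DERIV_cong_ev[of 0 0 f "\<lambda>_. 0" D D] by simp
  then show ?thesis using DERIV_unique DERIV_const by metis
qed

text \<open>E is the weighted sum of products of the two divided differences. Its value at \<zeta>
  is the mixed partial derivative at the origin of a function that vanishes near the origin.\<close>

lemma second_difference:
  assumes s: "evals_to \<zeta> s 0" and "finite I"
    and w: "\<And>k. k \<in> I \<Longrightarrow> evals_to \<zeta> (w k) (v k)"
    and A: "\<And>k. k \<in> I \<Longrightarrow> first_order \<zeta> s (A k) (A' k) (f k)"
    and B: "\<And>k. k \<in> I \<Longrightarrow> first_order \<zeta> s (B k) (B' k) (g k)"
    and zero: "eventually (\<lambda>y. eventually (\<lambda>x. (\<Sum>k\<in>I. v k * (f k x * g k y)) = 0) (nhds 0)) (nhds 0)"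
  obtains E where "evals_to \<zeta> E 0" "(\<Sum>k\<in>I. w k * ((A' k - A k) * (B' k - B k))) = s^2 * E"
proof -
  from A have "\<forall>k\<in>I. \<exists>\<gamma> D. A' k - A k = s * \<gamma> \<and> evals_to \<zeta> \<gamma> D \<and> (f k has_field_derivative D) (at 0)"
    unfolding first_order_def by blast
  then obtain a da where a: "\<And>k. k \<in> I \<Longrightarrow> A' k - A k = s * a k" "\<And>k. k \<in> I \<Longrightarrow> evals_to \<zeta> (a k) (da k)"
    "\<And>k. k \<in> I \<Longrightarrow> (f k has_field_derivative da k) (at 0)"
    by metis
  from B have "\<forall>k\<in>I. \<exists>\<gamma> D. B' k - B k = s * \<gamma> \<and> evals_to \<zeta> \<gamma> D \<and> (g k has_field_derivative D) (at 0)"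
    unfolding first_order_def by blast
  then obtain b db where b: "\<And>k. k \<in> I \<Longrightarrow> B' k - B k = s * b k" "\<And>k. k \<in> I \<Longrightarrow> evals_to \<zeta> (b k) (db k)"
    "\<And>k. k \<in> I \<Longrightarrow> (g k has_field_derivative db k) (at 0)"
    by metis
  define E where "E = (\<Sum>k\<in>I. w k * (a k * b k))"
  have "evals_to \<zeta> E (\<Sum>k\<in>I. v k * (da k * db k))"
    unfolding E_def by (intro evals_to_intros w a b)
  moreover have "(\<Sum>k\<in>I. v k * (da k * db k)) = 0"
  \<comment> \<open>Differentiate in x first, for each fixed y near 0, and then in y.\<close>
  proof (rule derivative_of_eventually_zero)
    show "((\<lambda>y. \<Sum>k\<in>I. v k * (da k * g k y)) has_field_derivative (\<Sum>k\<in>I. v k * (da k * db k))) (at 0)"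
      by (intro DERIV_sum DERIV_cmult b)
    show "eventually (\<lambda>y. (\<Sum>k\<in>I. v k * (da k * g k y)) = 0) (nhds 0)"
      using zero
    proof eventually_elim
      case (elim y)
      have "((\<lambda>x. \<Sum>k\<in>I. v k * (f k x * g k y)) has_field_derivative (\<Sum>k\<in>I. v k * (da k * g k y))) (at 0)"
        by (intro DERIV_sum DERIV_cmult DERIV_cmult_right a)
      then show ?case using elim by (rule derivative_of_eventually_zero)
    qed
  qed
  ultimately have "evals_to \<zeta> E 0" by simp
  moreover have "(\<Sum>k\<in>I. w k * ((A' k - A k) * (B' k - B k))) = s^2 * E"
    unfolding E_def sum_distrib_left
    by (intro sum.cong refl) (simp add: a(1) b(1) power2_eq_square mult_ac)
  ultimately show ?thesis by (rule that)
qed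

lemma first_order_factor_s:
  assumes s: "evals_to \<zeta> s 0" and x: "evals_to \<zeta> x \<zeta>" and "\<And>i. i < k \<Longrightarrow> \<zeta>^(4*i+4) \<noteq> 1"
  shows "first_order \<zeta> s (factor_s x 0 k) (factor_s x s k) (\<lambda>y. factor_s \<zeta> y k)"
  unfolding factor_s_def
  by (intro first_order_prod first_order_divide first_order_linear s evals_to_intros x) (use assms(3) in auto)

lemma first_order_factor_t:
  assumes s: "evals_to \<zeta> s 0" and x: "evals_to \<zeta> x \<zeta>" and "\<And>i. i < k \<Longrightarrow> \<zeta>^(4*i+4) \<noteq> 1"
   "\<And>i. i < k \<Longrightarrow> \<zeta>^(2*i+2) \<noteq> 1"
  shows "first_order \<zeta> s (factor_t x 0 k) (factor_t x s k) (\<lambda>y. factor_t \<zeta> y k)"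
  unfolding factor_t_def
  by (intro first_order_prod first_order_divide first_order_mult first_order_linear first_order_const s evals_to_intros x) (use assms(3,4) in auto)

text \<open>Regularity of the second-order coefficient suffices: it will be multiplied by s^2, of
  order four, and by a closed form of order at least one.\<close>

lemma product_second_order:
  fixes k :: nat
  assumes s: "evals_to \<zeta> s 0"
    and u: "\<And>i. i < k \<Longrightarrow> vanishes_at \<zeta> 0 (u i)" and v: "\<And>i. i < k \<Longrightarrow> vanishes_at \<zeta> 0 (v i)"
  shows "\<exists>\<omega>. vanishes_at \<zeta> 0 \<omega> \<and>
    (\<Prod>i<k. (1 + u i * s) / (1 + v i * s)) = 1 + s * (\<Sum>i<k. u i - v i) + s^2 * \<omega>"
  using u v
proof (induction k)
  case 0
  then show ?case by (intro exI[of _ 0]) simp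
next
  case (Suc k)
  obtain \<omega> where o: "vanishes_at \<zeta> 0 \<omega>"
    "(\<Prod>i<k. (1 + u i * s) / (1 + v i * s)) = 1 + s * (\<Sum>i<k. u i - v i) + s^2 * \<omega>"
    using Suc.IH[OF Suc.prems(1)[OF less_SucI] Suc.prems(2)[OF less_SucI]] by auto
  obtain U where U: "evals_to \<zeta> (u k) U" using Suc.prems(1)[of k] by (auto elim: vanishes_at_0E)
  obtain V where V: "evals_to \<zeta> (v k) V" using Suc.prems(2)[of k] by (auto elim: vanishes_at_0E)
  obtain O' where O: "evals_to \<zeta> \<omega> O'" using o(1) by (auto elim: vanishes_at_0E)
  have "vanishes_at \<zeta> 0 (\<Sum>i<k. u i - v i)"
    using Suc.prems by (intro vanishes_at_sum vanishes_at_diff) auto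
  then obtain S' where S: "evals_to \<zeta> (\<Sum>i<k. u i - v i) S'" by (auto elim: vanishes_at_0E)
  define S where "S = (\<Sum>i<k. u i - v i)"
  have den: "evals_to \<zeta> (1 + v k * s) (1 + V * 0)" by (intro evals_to_intros V s)
  then have nz: "1 + v k * s \<noteq> 0" using evals_to_nonzero by fastforce
  define \<rho> where "\<rho> = - (v k * (u k - v k) / (1 + v k * s))"
  have \<rho>: "(1 + u k * s) / (1 + v k * s) = 1 + (u k - v k) * s + s^2 * \<rho>"
    using nz unfolding \<rho>_def by (simp add: divide_simps) algebra
  have "evals_to \<zeta> \<rho> (- (V * (U - V) / (1 + V * 0)))"
    unfolding \<rho>_def by (intro evals_to_intros U V s den) simp
  then obtain R where R: "evals_to \<zeta> \<rho> R" ..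
  define \<omega>' where "\<omega>' = \<omega> * (1 + (u k - v k) * s + s^2 * \<rho>) + S * (u k - v k) + \<rho> + s * S * \<rho>"
  have "evals_to \<zeta> \<omega>' (O' * (1 + (U - V) * 0 + 0^2 * R) + S' * (U - V) + R + 0 * S' * R)"
    unfolding \<omega>'_def S_def by (intro evals_to_intros U V s O S R)
  then have "vanishes_at \<zeta> 0 \<omega>'" by (rule vanishes_at_0I)
  moreover have "(\<Prod>i<Suc k. (1 + u i * s) / (1 + v i * s)) = 1 + s * (\<Sum>i<Suc k. u i - v i) + s^2 * \<omega>'"
    unfolding prod.lessThan_Suc sum.lessThan_Suc o(2) \<rho> \<omega>'_def S_def[symmetric] by algebra
  ultimately show ?case by blast
qed

section \<open>Evaluations at the terminating point\<close>

text \<open>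
  At \<open>s = s0\<close> or \<open>t = s0\<close>, that is \<open>x\<close> or \<open>y\<close> equal to \<open>q\<^sup>n\<close> with \<open>n = 4j + 1\<close>, the series terminates, and both
  evaluations are given by the same function of the other parameter.
\<close>

definition closed_form :: "'a::field \<Rightarrow> nat \<Rightarrow> 'a \<Rightarrow> 'a"
  where "closed_form r j s = (1 - r^(4*j+1)) *
    (\<Prod>i<j. ((1 - r^(4*i+2))^2 + r^(4*i+2) * s) / ((1 - r^(4*i+4))^2 + r^(4*i+4) * s))"

context
  fixes r :: "'a::field" and j :: nat and s0 :: 'a
  assumes r0: "r \<noteq> 0" and r1: "\<And>c. c > 0 \<Longrightarrow> r^c \<noteq> 1"
  defines "s0 \<equiv> 2 - r^(4*j+1) - 1 / r^(4*j+1)"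
begin

text \<open>In base q = r^2 this is b + q/b for b = q^(-2j), the terminating value both of
  \<open>sum_quad_term_b\<close> and of \<open>sum_quad_term_d\<close>. The exponent 4j+1 in
  \<open>s0\<close> is chosen for this.\<close>

lemma special_point: "r * (2 - s0) = 1/r^(4*j) + r^2 * r^(4*j)"
  using r0 by (simp add: s0_def field_simps power2_eq_square)

lemma power_inj: "r^x = r^y \<longleftrightarrow> x = y"
  by (rule power_eq_power_iff[OF r0]) (rule r1)

text \<open>The case t = 0, that is \<eta> = 2, in which the quadratic factors become squares. The
  corner where both parameters are \<open>s0\<close> is covered by
  \<open>sum_special_t\<close>.\<close>

lemma sum_special_s: "(\<Sum>k<2*j+1. quad_term (r^2) r (r * (2 - s0)) (r * 2) k) = closed_form r j 0"
proof -
  have sq: "1 - 2 * r^c + r^(2*c) = (1 - r^c)^2" for c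
  proof -
    have p: "r^(2*c) = (r^c)^2" by (simp add: mult.commute flip: power_mult)
    show ?thesis unfolding p by algebra
  qed
  have idx: "2*(2*i+2) = 4*i+4" "2*(4*i+2) = 8*i+4" "2*(4*i+4) = 8*i+8" for i :: nat by simp_all
  have eta: "1 - 2 * r^(2*i+2) + r^(4*i+4) \<noteq> 0" for i
    using r1[of "2*i+2"] unfolding sq[of "2*i+2", unfolded idx] by simp
  have "(\<Sum>k<2*j+1. quad_term (r^2) r (r * (2 - s0)) (r * 2) k) = (1 - r^(4*j+1)) *
    (\<Prod>i<j. (1 - 2 * r^(4*i+2) + r^(8*i+4)) / (1 - 2 * r^(4*i+4) + r^(8*i+8)))"
    unfolding special_point by (rule sum_quad_term_b[OF r0 r1 eta]) simp_all
  also have "\<dots> = closed_form r j 0"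
    unfolding closed_form_def sq[of "4*i+2" for i, unfolded idx] sq[of "4*i+4" for i, unfolded idx] by simp
  finally show ?thesis .
qed

text \<open>For base r^2 and a = r the general closed form collapses: the product over c telescopes
  to 1 - r^(4j+1) up to r^(-2j), which cancels against the r^2 extracted from each of the j
  numerators.\<close>

lemma sum_special_t:
  assumes s: "\<And>i. (1 - r^(4*i+4))^2 + r^(4*i+4) * s \<noteq> 0"
  shows "(\<Sum>k<2*j+1. quad_term (r^2) r (r * (2 - s)) (r * (2 - s0)) k) = closed_form r j s"
proof -
  have q1: "(r^2)^c \<noteq> 1" if "c > 0" for c using r1[of "2*c"] that by (simp add: power_mult)
  have a1: "r * (r^2)^c \<noteq> 1" for c using r1[of "1+2*c"] by (simp add: power_mult)
  have a2: "r \<noteq> (r^2)^c" for c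
  proof
    assume "r = (r^2)^c"
    then have "r^1 = r^(2*c)" by (simp add: power_mult)
    then show False unfolding power_inj by presburger
  qed
  have den: "1 - r * (r*(2-s)) * (r^2)^(2*i+1) + r^2 * (r^2)^(4*i+3) = (1 - r^(4*i+4))^2 + r^(4*i+4) * s" for i
  proof -
    define x where "x = r^(4*i)"
    have p: "(r^2)^(2*i+1) = r^2*x" "(r^2)^(4*i+3) = r^6*x^2" "r^(4*i+4) = r^4*x"
      by (simp_all add: x_def power_add flip: power_mult)
    show ?thesis unfolding p by algebra
  qed
  have num: "r^2 - r * (r*(2-s)) * (r^2)^(2*i+1) + (r^2)^(4*i+3) = r^2 * ((1 - r^(4*i+2))^2 + r^(4*i+2) * s)" for i
  proof -
    define x where "x = r^(4*i)"
    have p: "(r^2)^(2*i+1) = r^2*x" "(r^2)^(4*i+3) = r^6*x^2" "r^(4*i+2) = r^2*x"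
      by (simp_all add: x_def power_add flip: power_mult) (simp_all add: power2_eq_square)
    show ?thesis unfolding p by algebra
  qed
  have den': "1 - r * (r*(2-s)) * r^2 * ((r^2)^i)^2 + r^2 * (r^2)^3 * ((r^2)^i)^4 \<noteq> 0" for i
  proof -
    have "r^2 * ((r^2)^i)^2 = (r^2)^(2*i+1)" "(r^2)^3 * ((r^2)^i)^4 = (r^2)^(4*i+3)"
      by (simp_all add: power_add mult.commute flip: power_mult)
    then show ?thesis using den[of i] s[of i] by (simp only: mult.assoc not_False_eq_True)
  qed
  have tel: "(1 - r) * (\<Prod>c<m. (1 - r * (r^2)^(c+1)) / (r - (r^2)^(c+1))) * r^m = 1 - r^(2*m+1)" for m
  proof (induction m)
    case (Suc m)
    have e: "r - (r^2)^(m+1) = r * (1 - r^(2*m+1))" "r * (r^2)^(m+1) = r^(2*Suc m+1)"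
    proof -
      have p: "(r^2)^(m+1) = r * r^(2*m+1)"
        unfolding power_mult[symmetric] power_Suc[symmetric] by (rule arg_cong[of _ _ "power r"]) simp
      show "r - (r^2)^(m+1) = r * (1 - r^(2*m+1))" unfolding p by algebra
      show "r * (r^2)^(m+1) = r^(2*Suc m+1)"
        unfolding power_mult[symmetric] power_Suc[symmetric] by (rule arg_cong[of _ _ "power r"]) simp
    qed
    have nz: "1 - r^(2*m+1) \<noteq> 0" using r1[of "2*m+1"] by simp
    have "(1 - r) * (\<Prod>c<Suc m. (1 - r * (r^2)^(c+1)) / (r - (r^2)^(c+1))) * r^Suc m
      = ((1 - r) * (\<Prod>c<m. (1 - r * (r^2)^(c+1)) / (r - (r^2)^(c+1))) * r^m) * ((1 - r^(2*Suc m+1)) / (r * (1 - r^(2*m+1))) * r)"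
      unfolding prod.lessThan_Suc e by (simp only: power_Suc mult_ac)
    then show ?case unfolding Suc.IH using nz r0 by simp
  qed simp
  have p: "(r^2)^(2*j) = r^(4*j)" by (simp flip: power_mult)
  have pr: "(\<Prod>i<j. r^2 * f i) = r^(2*j) * (\<Prod>i<j. f i)" for f :: "nat \<Rightarrow> 'a"
    by (simp add: prod.distrib power_mult)
  have "(\<Sum>k<2*j+1. quad_term (r^2) r (r * (2 - s)) (r * (2 - s0)) k) =
    (1 - r) * (\<Prod>c<2*j. (1 - r * (r^2)^(c+1)) / (r - (r^2)^(c+1)))
      * (\<Prod>i<j. (r^2 - r * (r*(2-s)) * (r^2)^(2*i+1) + (r^2)^(4*i+3)) / (1 - r * (r*(2-s)) * (r^2)^(2*i+1) + r^2 * (r^2)^(4*i+3)))"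
    unfolding special_point p[symmetric]
    by (rule sum_quad_term_d) (use r0 q1 a1 a2 den' in auto)
  also have "\<dots> = (1 - r) * (\<Prod>c<2*j. (1 - r * (r^2)^(c+1)) / (r - (r^2)^(c+1))) * r^(2*j)
      * (\<Prod>i<j. ((1 - r^(4*i+2))^2 + r^(4*i+2) * s) / ((1 - r^(4*i+4))^2 + r^(4*i+4) * s))"
    unfolding num den times_divide_eq_right[symmetric] pr by (simp only: mult_ac)
  also have "\<dots> = closed_form r j s" unfolding tel closed_form_def by simp
  finally show ?thesis .
qed

end

section \<open>The summand and its reduction at roots of unity\<close>

definition summand_ratio :: "'a::field \<Rightarrow> nat \<Rightarrow> 'a"
  where "summand_ratio r i = ((1 - r^(2*i+1))^2 * (1 - r^(4*i+2)) * (1 - r^(4*i+1))^2) /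
    ((1 - r^(2*i+2))^2 * (1 - r^(4*i+4))^3)"

lemma factor_at_0: "factor_s r 0 k * factor_t r 0 k = (\<Prod>i<k. summand_ratio r i)"
  unfolding factor_s_def factor_t_def prod.distrib[symmetric]
  by (intro prod.cong refl) (simp add: summand_ratio_def power2_eq_square power3_eq_cube mult_ac)

definition summand :: "'a::field \<Rightarrow> nat \<Rightarrow> 'a"
  where "summand q k = q_int q (6 * k + 1) *
       ((q_pochhammer q (q ^ 2) k) ^ 2 * q_pochhammer (q ^ 2) (q ^ 4) k
          * (q_pochhammer q (q ^ 4) k) ^ 2) /
       ((q_pochhammer (q ^ 2) (q ^ 2) k) ^ 2 * (q_pochhammer (q ^ 4) (q ^ 4) k) ^ 3)
       * q ^ (2 * k)"

lemma q_pochhammer_power: "q_pochhammer (q^a) (q^b) k = (\<Prod>i<k. 1 - q^(a+b*i))"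
  unfolding q_pochhammer_def by (simp add: power_add power_mult)

lemma prod_summand_ratio:
  "(\<Prod>i<k. summand_ratio q i) = (q_pochhammer q (q ^ 2) k / q_pochhammer (q ^ 2) (q ^ 2) k)^2
    * (q_pochhammer (q ^ 2) (q ^ 4) k / q_pochhammer (q ^ 4) (q ^ 4) k)
    * (q_pochhammer q (q ^ 4) k / q_pochhammer (q ^ 4) (q ^ 4) k)^2"
  unfolding q_pochhammer_power q_pochhammer_power[of q 1, simplified]
    prod_dividef[symmetric] prod_power_distrib prod.distrib[symmetric]
  by (intro prod.cong refl) (simp add: summand_ratio_def power2_eq_square power3_eq_cube mult_ac add_ac)

lemma summand_eq:
  fixes q :: "'a::field"
  assumes "q \<noteq> 1"
  shows "(1 - q) * summand q k = (1 - q^(6*k+1)) * q^(2*k) * (\<Prod>i<k. summand_ratio q i)"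
proof -
  have "1 - q \<noteq> 0" using assms by simp
  then have "(1 - q) * q_int q (6*k+1) = 1 - q^(6*k+1)" by (simp add: q_int_def)
  moreover have "(1 - q) * summand q k = ((1 - q) * q_int q (6*k+1)) * q^(2*k) * (\<Prod>i<k. summand_ratio q i)"
    unfolding summand_def prod_summand_ratio by (simp add: power_divide power2_eq_square power3_eq_cube mult_ac)
  ultimately show ?thesis by simp
qed

text \<open>The identity is needed in a neighbourhood of (0,0), since it is going to be
  differentiated in both variables. The denominators are nonzero at 0, hence near 0, and
  \<open>sum_quad_term_root_of_unity\<close> applies with \<beta> = \<zeta> (2 - x) and \<delta> =
  \<zeta> (2 - y).\<close>

lemma sum_root_of_unity_deformed:
  fixes \<zeta> :: complex
  assumes z: "\<zeta>^(2*m+1) = 1" "\<And>c. 0 < c \<Longrightarrow> c < 2*m+1 \<Longrightarrow> \<zeta>^c \<noteq> 1" and m: "m > 0"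
  shows "eventually (\<lambda>y. eventually (\<lambda>x. (\<Sum>k\<le>m. ((1 - \<zeta>^(6*k+1)) * \<zeta>^(2*k)) *
    (factor_s \<zeta> x k * factor_t \<zeta> y k)) = 0) (nhds 0)) (nhds 0)"
proof -
  have z0: "\<zeta> \<noteq> 0" using z(1) by auto
  have dvd: "\<zeta>^c = 1 \<longleftrightarrow> 2*m+1 dvd c" for c
    using root_of_unity_dvd[OF z(1) z(2)] by simp
  have nz4: "\<zeta>^(4*i+4) \<noteq> 1" if "i < m" for i
  proof -
    have "coprime (2*m+1) (2*2)" unfolding coprime_mult_right_iff by simp
    then have "coprime (2*m+1) 4" by simp
    moreover have "\<not> 2*m+1 dvd i+1" using that by (auto dest: dvd_imp_le)
    ultimately have "\<not> 2*m+1 dvd 4*(i+1)" using coprime_dvd_mult_right_iff by blast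
    moreover have e: "4*i+4 = 4*(i+1)" by simp
    ultimately show ?thesis unfolding e dvd by simp
  qed
  have nz2: "\<zeta>^(2*i+2) \<noteq> 1" if "i < m" for i
    using z(2)[of "2*i+2"] that by simp
  have ev1: "eventually (\<lambda>x. \<forall>i\<in>{..<m}. (1 - \<zeta>^(4*i+4))^2 + \<zeta>^(4*i+4) * x \<noteq> 0) (nhds 0)"
  proof (intro eventually_ball_finite ballI)
    fix i assume "i \<in> {..<m}"
    have "((\<lambda>x. (1 - \<zeta>^(4*i+4))^2 + \<zeta>^(4*i+4) * x) \<longlongrightarrow> (1 - \<zeta>^(4*i+4))^2 + \<zeta>^(4*i+4) * 0) (nhds 0)"
      by (intro tendsto_intros filterlim_ident)
    then show "eventually (\<lambda>x. (1 - \<zeta>^(4*i+4))^2 + \<zeta>^(4*i+4) * x \<noteq> 0) (nhds 0)"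
      by (rule tendsto_imp_eventually_ne) (use nz4[of i] \<open>i \<in> _\<close> in simp)
  qed simp
  have ev2: "eventually (\<lambda>x. \<forall>i\<in>{..<m}. (1 - \<zeta>^(2*i+2))^2 + \<zeta>^(2*i+2) * x \<noteq> 0) (nhds 0)"
  proof (intro eventually_ball_finite ballI)
    fix i assume "i \<in> {..<m}"
    have "((\<lambda>x. (1 - \<zeta>^(2*i+2))^2 + \<zeta>^(2*i+2) * x) \<longlongrightarrow> (1 - \<zeta>^(2*i+2))^2 + \<zeta>^(2*i+2) * 0) (nhds 0)"
      by (intro tendsto_intros filterlim_ident)
    then show "eventually (\<lambda>x. (1 - \<zeta>^(2*i+2))^2 + \<zeta>^(2*i+2) * x \<noteq> 0) (nhds 0)"
      by (rule tendsto_imp_eventually_ne) (use nz2[of i] \<open>i \<in> _\<close> in simp)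
  qed simp
  show ?thesis
    using ev2
  proof eventually_elim
    case y: (elim y)
    show ?case
      using ev1
    proof eventually_elim
      case x: (elim x)
      have "(\<Sum>k\<le>m. quad_term (\<zeta>^2) \<zeta> (\<zeta> * (2 - x)) (\<zeta> * (2 - y)) k) = 0"
      proof (rule sum_quad_term_root_of_unity[OF z m])
        fix i assume i: "i < m"
        define w where "w = \<zeta>^(2*i)"
        have p: "(\<zeta>^2)^i = w" "\<zeta>^(4*i+4) = \<zeta>^4*w^2" "\<zeta>^(2*i+2) = \<zeta>^2*w"
          by (simp_all add: w_def power_add mult.commute flip: power_mult) (simp_all add: power2_eq_square)
        have "1 - \<zeta> * (\<zeta>*(2-x)) * \<zeta>^2 * w^2 + \<zeta>^2 * (\<zeta>^2)^3 * w^4 = (1 - \<zeta>^4*w^2)^2 + \<zeta>^4*w^2 * x"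
          by algebra
        then show "1 - \<zeta> * (\<zeta>*(2-x)) * \<zeta>^2 * ((\<zeta>^2)^i)^2 + \<zeta>^2 * (\<zeta>^2)^3 * ((\<zeta>^2)^i)^4 \<noteq> 0"
          using x i unfolding p(1) p(2)[symmetric] by (metis lessThan_iff)
        have "1 - \<zeta> * (\<zeta>*(2-y)) * w + \<zeta>^2 * \<zeta>^2 * w^2 = (1 - \<zeta>^2*w)^2 + \<zeta>^2*w * y"
          by algebra
        then show "1 - \<zeta> * (\<zeta>*(2-y)) * (\<zeta>^2)^i + \<zeta>^2 * \<zeta>^2 * ((\<zeta>^2)^i)^2 \<noteq> 0"
          using y i unfolding p(1) p(3)[symmetric] by (metis lessThan_iff)
      qed
      also have "(\<Sum>k\<le>m. quad_term (\<zeta>^2) \<zeta> (\<zeta> * (2 - x)) (\<zeta> * (2 - y)) k)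
        = (\<Sum>k\<le>m. ((1 - \<zeta>^(6*k+1)) * \<zeta>^(2*k)) * (factor_s \<zeta> x k * factor_t \<zeta> y k))"
      proof (intro sum.cong refl quad_term_factor z0)
        fix k i assume "k \<in> {..m}" "i < k"
        then show "\<zeta>^(2*i+1) \<noteq> 1" using z(2)[of "2*i+1"] by simp
      qed
      finally show ?case .
    qed
  qed
qed

text \<open>Unlike a punctured neighbourhood, \<open>nhds 0\<close> contains the point x = y =
  0.\<close>

lemma sum_root_of_unity:
  fixes \<zeta> :: complex
  assumes z: "\<zeta>^(2*m+1) = 1" "\<And>c. 0 < c \<Longrightarrow> c < 2*m+1 \<Longrightarrow> \<zeta>^c \<noteq> 1" and m: "m > 0"
  shows "(\<Sum>k\<le>m. (1 - \<zeta>^(6*k+1)) * \<zeta>^(2*k) * (\<Prod>i<k. summand_ratio \<zeta> i)) = 0"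
  using eventually_nhds_x_imp_x[OF eventually_nhds_x_imp_x[OF sum_root_of_unity_deformed[OF assms]]]
  by (simp only: factor_at_0)

section \<open>Regularity and vanishing at a root of unity of odd order d\<close>

context
  fixes X :: "complex poly fract"
  defines "X \<equiv> to_fract [:0, 1:]"
begin

lemma X_power_ne_1: "c > 0 \<Longrightarrow> X^c \<noteq> 1"
proof
  assume c: "c > 0" "X^c = 1"
  have "to_fract p ^ c = to_fract (p^c)" for p :: "complex poly" by (induction c) simp_all
  then have "X^c = to_fract ([:0, 1:]^c)" unfolding X_def .
  then have "to_fract ([:0, 1::complex:]^c) = to_fract 1" using c by simp
  then have "[:0, 1::complex:]^c = 1" by (simp only: to_fract_eq_iff)
  then have "poly ([:0, 1::complex:]^c) 0 = 1" by simp
  then show False using c(1) by (simp add: poly_power zero_power)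
qed

lemma X_ne: "X \<noteq> 0" "X \<noteq> 1" "1 - X \<noteq> 0"
  using X_power_ne_1[of 1] by (auto simp: X_def)

lemma evals_to_X': "evals_to \<zeta> X \<zeta>"
  unfolding X_def by (rule evals_to_X)

lemma evals_to_1_minus: "evals_to \<zeta> (1 - X^c) (1 - \<zeta>^c)"
  by (intro evals_to_intros evals_to_X')

context
  fixes \<zeta> :: complex and d m :: nat
  assumes zd: "\<zeta>^d = 1" and zc': "\<forall>c. 0 < c \<and> c < d \<longrightarrow> \<zeta>^c \<noteq> 1" and d: "d = 2*m+1" and m: "m > 0"
begin

lemma root_power_ne_1: "0 < c \<Longrightarrow> c < d \<Longrightarrow> \<zeta>^c \<noteq> 1"
  using zc' by blast

lemma zeta_power_eq_1_iff: "\<zeta>^c = 1 \<longleftrightarrow> d dvd c"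
  using root_of_unity_dvd[OF zd root_power_ne_1] d by simp

lemma coprime_d: "coprime 2 d" "coprime 4 d"
proof -
  show *: "coprime 2 d" using d by simp
  then have "coprime (2*2) d" unfolding coprime_mult_left_iff by simp
  then show "coprime 4 d" by simp
qed

lemma vanishes_at_1_minus: "d dvd c \<Longrightarrow> vanishes_at \<zeta> 1 (1 - X^c)"
  using evals_to_1_minus[of \<zeta> c] zeta_power_eq_1_iff[of c] by (intro vanishes_at_1I) simp

text \<open>Both sides of the quotient contain 1 - X^d; after cancelling it, the denominator takes
  the value b/d at \<zeta>.\<close>

lemma ratio_1_minus:
  assumes "d dvd a" "d dvd b" "b > 0"
  shows "vanishes_at \<zeta> 0 ((1 - X^a) / (1 - X^b))"
proof -
  obtain x y where xy: "a = d * x" "b = d * y" "y > 0" using assms by (auto elim!: dvdE)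
  have nz: "1 - X^d \<noteq> 0" using X_power_ne_1[of d] d by simp
  have "1 - X^a = (1 - X^d) * (\<Sum>i<x. (X^d)^i)" "1 - X^b = (1 - X^d) * (\<Sum>i<y. (X^d)^i)"
    unfolding xy power_mult by (rule one_diff_power_eq)+
  then have "(1 - X^a) / (1 - X^b) = (\<Sum>i<x. (X^d)^i) / (\<Sum>i<y. (X^d)^i)" using nz by simp
  moreover have "evals_to \<zeta> ((\<Sum>i<x. (X^d)^i) / (\<Sum>i<y. (X^d)^i)) ((\<Sum>i<x. (\<zeta>^d)^i) / (\<Sum>i<y. (\<zeta>^d)^i))"
    by (intro evals_to_intros evals_to_X') (use zd xy in simp)
  ultimately show ?thesis by (auto intro: vanishes_at_0I)
qed

text \<open>As b is invertible modulo d, the exponents in a block of d consecutive indices run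
  through all residues. So the single denominator factor that vanishes at \<zeta> can be paired with
  a vanishing numerator factor.\<close>

lemma q_binomial_block:
  assumes b: "coprime b d" "b > 0"
  shows "vanishes_at \<zeta> 0 ((\<Prod>i\<in>{k..<k+d}. 1 - X^(a+b*i)) / (\<Prod>i\<in>{k..<k+d}. 1 - X^(b+b*i)))"
proof -
  have d0: "d > 0" using d by simp
  have ex: "\<exists>i\<in>{k..<k+d}. d dvd c + b*i" for c
  proof -
    have "inj_on (\<lambda>i. (c + b*i) mod d) {k..<k+d}"
    proof (rule linorder_inj_onI)
      fix x y assume xy: "x < y" "x \<in> {k..<k+d}" "y \<in> {k..<k+d}"
      show "(c + b*x) mod d \<noteq> (c + b*y) mod d"
      proof
        assume "(c + b*x) mod d = (c + b*y) mod d"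
        then have "d dvd (c + b*y) - (c + b*x)" using xy by (metis mod_eq_dvd_iff_nat add_left_mono mult_le_mono2 less_imp_le)
        then have "d dvd b * (y - x)" by (simp add: diff_mult_distrib2)
        then have "d dvd y - x" using b(1) coprime_commute coprime_dvd_mult_right_iff by metis
        then show False using xy by (auto dest: dvd_imp_le)
      qed
    qed auto
    then have "card ((\<lambda>i. (c + b*i) mod d) ` {k..<k+d}) = d" by (simp add: card_image)
    moreover have "(\<lambda>i. (c + b*i) mod d) ` {k..<k+d} \<subseteq> {..<d}" using d0 by auto
    ultimately have "(\<lambda>i. (c + b*i) mod d) ` {k..<k+d} = {..<d}"
      by (intro card_subset_eq) auto
    then have "0 \<in> (\<lambda>i. (c + b*i) mod d) ` {k..<k+d}" using d0 by auto
    then show ?thesis by (auto simp: dvd_eq_mod_eq_0)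
  qed
  obtain i0 where i0: "i0 \<in> {k..<k+d}" "d dvd a + b*i0" using ex by blast
  obtain i1 where i1: "i1 \<in> {k..<k+d}" "d dvd b + b*i1" using ex by blast
  have uniq: "\<zeta>^(b+b*i) \<noteq> 1" if "i \<in> {k..<k+d} - {i1}" for i
  proof
    assume "\<zeta>^(b+b*i) = 1"
    then have "d dvd b + b*i" using zeta_power_eq_1_iff by blast
    then have "d dvd b * (i + 1)" "d dvd b * (i1 + 1)" using i1 by (simp_all add: add.commute)
    then have "d dvd i + 1" "d dvd i1 + 1" using b(1) coprime_commute coprime_dvd_mult_right_iff by metis+
    then have "d dvd (i+1) - (i1+1)" "d dvd (i1+1) - (i+1)" by (simp_all only: dvd_diff_nat)
    moreover have "i \<noteq> i1" using that by simp
    ultimately show False using that i1(1) by (auto dest!: dvd_imp_le)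
  qed
  have eq: "(\<Prod>i\<in>{k..<k+d}. 1 - X^(a+b*i)) / (\<Prod>i\<in>{k..<k+d}. 1 - X^(b+b*i)) =
    ((1 - X^(a+b*i0)) / (1 - X^(b+b*i1))) *
      ((\<Prod>i\<in>{k..<k+d}-{i0}. 1 - X^(a+b*i)) / (\<Prod>i\<in>{k..<k+d}-{i1}. 1 - X^(b+b*i)))"
    using prod.remove[OF _ i0(1), of "\<lambda>i. 1 - X^(a+b*i)"] prod.remove[OF _ i1(1), of "\<lambda>i. 1 - X^(b+b*i)"]
    by simp
  have r: "vanishes_at \<zeta> 0 ((1 - X^(a+b*i0)) / (1 - X^(b+b*i1)))"
    using i0 i1 b by (intro ratio_1_minus) auto
  have "evals_to \<zeta> ((\<Prod>i\<in>{k..<k+d}-{i0}. 1 - X^(a+b*i)) / (\<Prod>i\<in>{k..<k+d}-{i1}. 1 - X^(b+b*i)))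
     ((\<Prod>i\<in>{k..<k+d}-{i0}. 1 - \<zeta>^(a+b*i)) / (\<Prod>i\<in>{k..<k+d}-{i1}. 1 - \<zeta>^(b+b*i)))"
    by (intro evals_to_intros evals_to_X') (use uniq in auto)
  from vanishes_at_mult[OF r vanishes_at_0I[OF this]] show ?thesis unfolding eq by (simp only: add_0)
qed

text \<open>Blocks of length d are split off until k < d, where the denominator is nonzero at
  \<zeta>. This keeps the summands under control for k >= d, although their denominators vanish at
  \<zeta>.\<close>

lemma q_binomial_integral:
  assumes b: "coprime b d" "b > 0"
  shows "vanishes_at \<zeta> 0 (q_pochhammer (X^a) (X^b) k / q_pochhammer (X^b) (X^b) k)"
proof (induction k rule: less_induct)
  case (less k)
  show ?case
  proof (cases "k < d")
    case True
    have "\<zeta>^(b+b*i) \<noteq> 1" if "i < k" for i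
    proof
      assume "\<zeta>^(b+b*i) = 1"
      then have "d dvd b * (i + 1)" using zeta_power_eq_1_iff by (simp add: add.commute)
      then have "d dvd i + 1" using b(1) coprime_commute coprime_dvd_mult_right_iff by metis
      then show False using that True by (auto dest: dvd_imp_le)
    qed
    then have "evals_to \<zeta> (q_pochhammer (X^a) (X^b) k / q_pochhammer (X^b) (X^b) k)
      ((\<Prod>i<k. 1 - \<zeta>^(a+b*i)) / (\<Prod>i<k. 1 - \<zeta>^(b+b*i)))"
      unfolding q_pochhammer_power
      by (intro evals_to_intros evals_to_X') auto
    then show ?thesis by (rule vanishes_at_0I)
  next
    case False
    define l where "l = k - d"
    have k: "k = l + d" "l < k" using False d by (auto simp: l_def)
    have split: "(\<Prod>i<k. f i) = (\<Prod>i<l. f i) * (\<Prod>i\<in>{l..<l+d}. f i)" for f :: "nat \<Rightarrow> complex poly fract"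
    proof -
      have "{..<k} = {..<l} \<union> {l..<l+d}" using k by auto
      then show ?thesis by (simp add: prod.union_disjoint ivl_disj_int)
    qed
    have "vanishes_at \<zeta> (0+0) (((\<Prod>i<l. 1 - X^(a+b*i)) / (\<Prod>i<l. 1 - X^(b+b*i))) *
      ((\<Prod>i\<in>{l..<l+d}. 1 - X^(a+b*i)) / (\<Prod>i\<in>{l..<l+d}. 1 - X^(b+b*i))))"
      using less.IH[OF k(2)] unfolding q_pochhammer_power by (rule vanishes_at_mult[OF _ q_binomial_block[OF b]])
    then show ?thesis unfolding q_pochhammer_power split by simp
  qed
qed

lemma vanishes_at_0_power: "vanishes_at \<zeta> 0 A \<Longrightarrow> vanishes_at \<zeta> 0 (A^n)"
  by (auto elim!: vanishes_at_0E intro: vanishes_at_0I evals_to_power)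

lemma prod_summand_ratio_integral: "vanishes_at \<zeta> 0 (\<Prod>i<k. summand_ratio X i)"
proof -
  have *: "vanishes_at \<zeta> 0 (A * B)" if "vanishes_at \<zeta> 0 A" "vanishes_at \<zeta> 0 B" for A B
    using vanishes_at_mult[OF that] by simp
  show ?thesis unfolding prod_summand_ratio
    using q_binomial_integral[of 2 1 k] q_binomial_integral[of 4 1 k] q_binomial_integral[of 4 2 k] coprime_d
    by (intro * vanishes_at_0_power) simp_all
qed

text \<open>
  At a root of unity of order \<open>d\<close> the terms \<open>l d + r\<close>, for fixed \<open>l\<close>, are proportional to the terms \<open>r\<close>.
\<close>

lemma block_sum:
  assumes R: "R = m + 1 \<or> R = d"
  shows "vanishes_at \<zeta> 1 (\<Sum>r<R. (1 - X^(6*(l*d+r)+1)) * X^(2*(l*d+r)) * (\<Prod>i<l*d+r. summand_ratio X i))"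
proof -
  have red: "\<zeta>^(c * (l*d+r) + e) = \<zeta>^(c * r + e)" for c r e
  proof -
    have "\<zeta>^(c * (l*d+r) + e) = (\<zeta>^d)^(c*l) * \<zeta>^(c*r+e)"
      by (simp add: algebra_simps flip: power_mult power_add)
    then show ?thesis by (simp add: zd)
  qed
  \<comment> \<open>Since r < R <= d, only indices i <= d - 2 occur; at i = d - 1 the denominator
    would vanish at \<zeta>.\<close>
  have sig: "evals_to \<zeta> (summand_ratio X (l*d+i)) (summand_ratio \<zeta> i)" if "i < d - 1" for i
  proof -
    have "\<not> d dvd i + 1" using that by (auto dest: dvd_imp_le)
    then have "\<not> d dvd 2 * (i + 1)" "\<not> d dvd 4 * (i + 1)"
      using coprime_d coprime_commute coprime_dvd_mult_right_iff by metis+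
    moreover have e: "2*i+2 = 2*(i+1)" "4*i+4 = 4*(i+1)" by simp_all
    ultimately have nz: "\<zeta>^(2*i+2) \<noteq> 1" "\<zeta>^(4*i+4) \<noteq> 1" unfolding e zeta_power_eq_1_iff by simp_all
    have den: "(1 - \<zeta>^(2*(l*d+i)+2))^2 * (1 - \<zeta>^(4*(l*d+i)+4))^3 \<noteq> 0"
      unfolding red using nz by simp
    show ?thesis
      unfolding summand_ratio_def red[symmetric, of _ i]
      by (intro evals_to_intros evals_to_X') (rule den)
  qed
  have eq: "(\<Sum>r<R. (1 - X^(6*(l*d+r)+1)) * X^(2*(l*d+r)) * (\<Prod>i<l*d+r. summand_ratio X i)) =
    (\<Prod>i<l*d. summand_ratio X i) * (\<Sum>r<R. (1 - X^(6*(l*d+r)+1)) * X^(2*(l*d+r)) * (\<Prod>i<r. summand_ratio X (l*d+i)))"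
    unfolding sum_distrib_left
  proof (intro sum.cong refl)
    fix r
    have "(\<Prod>i<l*d+r. summand_ratio X i) = (\<Prod>i<l*d. summand_ratio X i) * (\<Prod>i<r. summand_ratio X (l*d+i))"
      by (induction r) (simp_all add: mult.assoc)
    then show "(1 - X^(6*(l*d+r)+1)) * X^(2*(l*d+r)) * (\<Prod>i<l*d+r. summand_ratio X i) =
      (\<Prod>i<l*d. summand_ratio X i) * ((1 - X^(6*(l*d+r)+1)) * X^(2*(l*d+r)) * (\<Prod>i<r. summand_ratio X (l*d+i)))"
      by (simp add: mult_ac)
  qed
  \<comment> \<open>The \<open>+0\<close> gives the exponent the shape expected by
    \<open>red\<close>.\<close>
  have "evals_to \<zeta> (\<Sum>r<R. (1 - X^(6*(l*d+r)+1)) * X^(2*(l*d+r)+0) * (\<Prod>i<r. summand_ratio X (l*d+i)))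
    (\<Sum>r<R. (1 - \<zeta>^(6*(l*d+r)+1)) * \<zeta>^(2*(l*d+r)+0) * (\<Prod>i<r. summand_ratio \<zeta> i))"
    by (intro evals_to_intros evals_to_X' sig) (use R d in auto)
  moreover have "(\<Sum>r<R. (1 - \<zeta>^(6*(l*d+r)+1)) * \<zeta>^(2*(l*d+r)+0) * (\<Prod>i<r. summand_ratio \<zeta> i)) = 0"
  proof -
    have "(\<Sum>r<R. (1 - \<zeta>^(6*r+1)) * \<zeta>^(2*r+0) * (\<Prod>i<r. summand_ratio \<zeta> i)) =
      (\<Sum>r\<le>m. (1 - \<zeta>^(6*r+1)) * \<zeta>^(2*r+0) * (\<Prod>i<r. summand_ratio \<zeta> i))"
    proof (rule sum.mono_neutral_right)
      show "\<forall>r\<in>{..<R} - {..m}. (1 - \<zeta>^(6*r+1)) * \<zeta>^(2*r+0) * (\<Prod>i<r. summand_ratio \<zeta> i) = 0"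
      proof
        fix r assume "r \<in> {..<R} - {..m}"
        \<comment> \<open>The factor 1 - \<zeta>^(2m+1) kills every term with r > m, so a half block
          and a full block have the same value at \<zeta>.\<close>
        moreover have "summand_ratio \<zeta> m = 0" using zd d by (simp add: summand_ratio_def)
        ultimately have "(\<Prod>i<r. summand_ratio \<zeta> i) = 0" by (intro prod_zero) auto
        then show "(1 - \<zeta>^(6*r+1)) * \<zeta>^(2*r+0) * (\<Prod>i<r. summand_ratio \<zeta> i) = 0" by simp
      qed
    qed (use R d in auto)
    also have "\<dots> = 0"
      using sum_root_of_unity[of \<zeta> m] zd root_power_ne_1 m d by simp
    finally show ?thesis unfolding red .
  qed
  ultimately have "vanishes_at \<zeta> 1 (\<Sum>r<R. (1 - X^(6*(l*d+r)+1)) * X^(2*(l*d+r)+0) * (\<Prod>i<r. summand_ratio X (l*d+i)))"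
    by (intro vanishes_at_1I) simp
  from vanishes_at_mult[OF prod_summand_ratio_integral[of "l*d"] this] show ?thesis
    unfolding eq by simp
qed

text \<open>The range k < n consists of 2l + 1 blocks of length d, and the range k <= (n-1)/2 = l d
  + m of l blocks followed by a half block of length m + 1: the two lengths R of
  \<open>block_sum\<close>.\<close>

lemma sum_summand_vanishes:
  assumes n: "n = d * (2 * l + 1)" and M: "M = (n - 1) div 2 \<or> M = n - 1"
  shows "vanishes_at \<zeta> 1 (\<Sum>k=0..M. summand X k)"
proof -
  define t where "t k = (1 - X^(6*k+1)) * X^(2*k) * (\<Prod>i<k. summand_ratio X i)" for k
  have shift: "(\<Sum>k\<in>{a*d..<a*d+R}. t k) = (\<Sum>r<R. t (a*d+r))" for a R
    by (rule sum.reindex_bij_witness[of _ "\<lambda>r. a*d+r" "\<lambda>k. k - a*d"]) auto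
  have full: "vanishes_at \<zeta> 1 (\<Sum>k<a*d. t k)" for a
  proof -
    have "(\<Sum>k<a*d. t k) = (\<Sum>b<a. \<Sum>k\<in>{b*d..<b*d+d}. t k)"
      by (rule sum.nat_group[symmetric])
    also have "vanishes_at \<zeta> 1 \<dots>"
      unfolding shift unfolding t_def by (rule vanishes_at_sum, rule block_sum) simp
    finally show ?thesis .
  qed
  have "vanishes_at \<zeta> 1 (\<Sum>k<Suc M. t k)"
    using M
  proof
    assume "M = n - 1"
    then have "Suc M = (2*l+1)*d" using n d by (simp add: mult.commute)
    then show ?thesis using full by metis
  next
    assume "M = (n - 1) div 2"
    moreover have "n = 2 * (l*d+m) + 1" using n d by (simp add: algebra_simps)
    ultimately have M': "Suc M = l*d + (m+1)" by simp
    have "{..<Suc M} = {..<l*d} \<union> {l*d..<l*d+(m+1)}" unfolding M' by auto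
    then have "(\<Sum>k<Suc M. t k) = (\<Sum>k<l*d. t k) + (\<Sum>k\<in>{l*d..<l*d+(m+1)}. t k)"
      by (simp only: sum.union_disjoint finite_lessThan finite_atLeastLessThan ivl_disj_int)
    moreover have "vanishes_at \<zeta> 1 (\<Sum>k\<in>{l*d..<l*d+(m+1)}. t k)"
      unfolding shift unfolding t_def by (rule block_sum) simp
    ultimately show ?thesis using vanishes_at_add full by metis
  qed
  moreover have "(\<Sum>k<Suc M. t k) = (1 - X) * (\<Sum>k=0..M. summand X k)"
    unfolding t_def summand_eq[OF X_ne(2), symmetric] sum_distrib_left[symmetric]
    by (simp add: lessThan_Suc_atMost atMost_atLeast0)
  ultimately have "vanishes_at \<zeta> 1 ((1 - X) * (\<Sum>k=0..M. summand X k) / (1 - X^1))"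
    by (intro vanishes_at_divide_unit[OF _ evals_to_1_minus]) (use root_power_ne_1[of 1] d m in auto)
  then show ?thesis using X_ne by simp
qed

end

end

section \<open>The congruence modulo the fifth power\<close>

definition congruence_rhs :: "'a::field \<Rightarrow> nat \<Rightarrow> 'a"
  where "congruence_rhs q n = q_int q n *
       ((q_pochhammer (q ^ 2) (q ^ 4) ((n - 1) div 4)) ^ 2 /
        (q_pochhammer (q ^ 4) (q ^ 4) ((n - 1) div 4)) ^ 2) *
       (1 + (q_int q n) ^ 2 * (2 - q ^ n) *
          (\<Sum>j=1..(n - 1) div 2. (- 1) ^ (j + 1) * q ^ (2 * j) / (q_int q (2 * j)) ^ 2))"

text \<open>Pairing [n] with [2j] gives quotients that are regular at each n-th root of unity other
  than 1, which 1/[2j] alone need not be.\<close>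

lemma correction_term:
  fixes q :: "'a::field"
  assumes "q \<noteq> 1"
  shows "(q_int q n) ^ 2 * (2 - q ^ n) * (\<Sum>j=1..N. (- 1) ^ (j + 1) * q ^ (2 * j) / (q_int q (2 * j)) ^ 2)
    = (2 - q^n) * (\<Sum>j=1..N. (- 1) ^ (j + 1) * q ^ (2 * j) * ((1 - q^n) / (1 - q ^ (2 * j))) ^ 2)"
proof -
  have "(q_int q n)^2 * ((- 1) ^ (j + 1) * q ^ (2 * j) / (q_int q (2 * j)) ^ 2)
    = (- 1) ^ (j + 1) * q ^ (2 * j) * ((1 - q^n) / (1 - q ^ (2 * j))) ^ 2" for j
    using assms by (simp add: q_int_def power_divide)
  then have "(q_int q n)^2 * (\<Sum>j=1..N. (- 1) ^ (j + 1) * q ^ (2 * j) / (q_int q (2 * j)) ^ 2)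
    = (\<Sum>j=1..N. (- 1) ^ (j + 1) * q ^ (2 * j) * ((1 - q^n) / (1 - q ^ (2 * j))) ^ 2)"
    by (simp only: sum_distrib_left)
  from this[symmetric] show ?thesis by (simp only: mult_ac)
qed

text \<open>With h depending on q^(2l), the indices 2i+1 and 2i+2 produce the exponents 4i+2 and
  4i+4 of numerator and denominator in \<open>closed_form\<close>.\<close>

lemma alternating_sum_pairs:
  fixes h :: "nat \<Rightarrow> 'a::comm_ring_1"
  shows "(\<Sum>l=1..2*j. (- 1)^(l+1) * h l) = (\<Sum>i<j. h (2*i+1) - h (2*i+2))"
proof (induction j)
  case (Suc j)
  have "2 * Suc j = Suc (Suc (2*j))" by simp
  then have "(\<Sum>l=1..2*Suc j. (- 1)^(l+1) * h l)
    = (\<Sum>l=1..2*j. (- 1)^(l+1) * h l) + ((-1)^(2*j+2) * h (2*j+1) + (-1)^(2*j+3) * h (2*j+2))"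
    by (simp add: eval_nat_numeral)
  also have "(-1)^(2*j+2) * h (2*j+1) + (-1)^(2*j+3) * h (2*j+2) = h (2*j+1) - h (2*j+2)"
    by (simp add: power_add)
  finally show ?case using Suc.IH by simp
qed simp

context
  fixes q :: "complex poly fract"
  assumes q: "q = to_fract [:0, 1:]"
begin

lemmas q_power_ne_1 = X_power_ne_1[folded q]
lemmas q_ne = X_ne[folded q]
lemmas evals_to_q = evals_to_X'[folded q]
lemmas evals_to_1_minus_q = evals_to_1_minus[folded q]

context
  fixes \<zeta> :: complex and d m :: nat
  assumes zd: "\<zeta>^d = 1" and zc': "\<forall>c. 0 < c \<and> c < d \<longrightarrow> \<zeta>^c \<noteq> 1" and d: "d = 2*m+1" and m: "m > 0"
begin

lemmas zeta_power_ne_1 = root_power_ne_1[OF zd zc' d m]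

lemmas zeta_power_eq_1 = zeta_power_eq_1_iff[OF zd zc' d m]

lemma vanishes_at_0_mult: "vanishes_at \<zeta> 0 A \<Longrightarrow> vanishes_at \<zeta> 0 B \<Longrightarrow> vanishes_at \<zeta> 0 (A * B)"
  using vanishes_at_mult[of \<zeta> 0 A 0 B] by simp

lemma ratio_integral:
  assumes "d dvd a" "b > 0"
  shows "vanishes_at \<zeta> 0 ((1 - q^a) / (1 - q^b))"
proof (cases "d dvd b")
  case True
  then show ?thesis using ratio_1_minus[OF zd zc' d m assms(1)] assms(2) unfolding q by blast
next
  case False
  then have "1 - \<zeta>^b \<noteq> 0" by (simp add: zeta_power_eq_1)
  then show ?thesis
    by (intro vanishes_at_0I[OF evals_to_divide[OF evals_to_1_minus_q evals_to_1_minus_q]])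
qed

lemma one_minus_zeta: "1 - \<zeta>^1 \<noteq> 0"
  using zeta_power_ne_1[of 1] d m by simp

lemma congruence_rhs_vanishes:
  assumes "d dvd n"
  shows "vanishes_at \<zeta> 1 (congruence_rhs q n)"
proof -
  have 1: "vanishes_at \<zeta> 1 (q_int q n)"
    unfolding q_int_def
    using vanishes_at_divide_unit[OF _ evals_to_1_minus_q one_minus_zeta]
      vanishes_at_1_minus[OF zd zc' d m assms, folded q] by simp
  have 2: "vanishes_at \<zeta> 0 ((q_pochhammer (q^2) (q^4) ((n - 1) div 4)) ^ 2 / (q_pochhammer (q^4) (q^4) ((n - 1) div 4)) ^ 2)"
    unfolding power_divide[symmetric]
    using q_binomial_integral[OF zd zc' d m coprime_d(2)[OF zd zc' d m], of 2 "(n - 1) div 4", folded q]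
      vanishes_at_0_power[OF zd zc' d m] by simp
  have 3: "vanishes_at \<zeta> 0 (1 + (2 - q^n) * (\<Sum>j=1..N. (- 1) ^ (j + 1) * q ^ (2 * j) * ((1 - q^n) / (1 - q ^ (2 * j))) ^ 2))" for N
  proof -
    have "evals_to \<zeta> (2 - q^n) (2 - \<zeta>^n)" by (intro evals_to_intros evals_to_q)
    note base = vanishes_at_0I[OF this] vanishes_at_0I[OF evals_to_1] vanishes_at_0I[OF evals_to_q]
      vanishes_at_0I[OF evals_to_uminus[OF evals_to_1]]
    show ?thesis
      by (intro vanishes_at_add vanishes_at_0_mult vanishes_at_sum vanishes_at_0_power[OF zd zc' d m]
          ratio_integral assms base) auto
  qed
  show ?thesis
    unfolding congruence_rhs_def correction_term[OF q_ne(2)]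
    using vanishes_at_mult[OF vanishes_at_mult[OF 1 2] 3] by simp
qed

lemma pochhammer_vanishes:
  assumes "i < k" "d dvd a + b * i"
  shows "vanishes_at \<zeta> 1 (q_pochhammer (q^a) (q^b) k)"
proof (rule vanishes_at_1I)
  have "evals_to \<zeta> (q_pochhammer (q^a) (q^b) k) (\<Prod>i<k. 1 - \<zeta>^(a+b*i))"
    unfolding q_pochhammer_power by (intro evals_to_intros evals_to_q)
  moreover have "(\<Prod>i<k. 1 - \<zeta>^(a+b*i)) = 0"
    using assms by (auto intro!: prod_zero bexI[of _ i] simp: zeta_power_eq_1)
  ultimately show "evals_to \<zeta> (q_pochhammer (q^a) (q^b) k) 0" by simp
qed

lemma pochhammer_unit:
  assumes "k < d" "coprime b d"
  obtains v where "evals_to \<zeta> (q_pochhammer (q^b) (q^b) k) v" "v \<noteq> 0"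
proof
  show "evals_to \<zeta> (q_pochhammer (q^b) (q^b) k) (\<Prod>i<k. 1 - \<zeta>^(b+b*i))"
    unfolding q_pochhammer_power by (intro evals_to_intros evals_to_q)
  have "\<not> d dvd b * (i + 1)" if "i < k" for i
  proof
    assume "d dvd b * (i + 1)"
    then have "d dvd i + 1" using assms(2) coprime_commute coprime_dvd_mult_right_iff by metis
    then show False using that assms(1) by (auto dest: dvd_imp_le)
  qed
  then show "(\<Prod>i<k. 1 - \<zeta>^(b+b*i)) \<noteq> 0"
    by (simp add: zeta_power_eq_1)
qed

text \<open>This makes the two choices of M equivalent. The exponents 1 + 2(2j) = d, 2 + 4(2j) = 2d
  and 1 + 4j = d give zeros of the three numerator symbols, of multiplicities 2, 1 and 2, while k <
  d keeps the denominator nonzero at \<zeta>.\<close>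

lemma late_summand_vanishes:
  assumes dj: "d = 4*j+1" and k: "2*j < k" "k < d"
  shows "vanishes_at \<zeta> 5 (summand q k)"
proof -
  obtain v2 where v2: "evals_to \<zeta> (q_pochhammer (q^2) (q^2) k) v2" "v2 \<noteq> 0"
    using pochhammer_unit[OF k(2) coprime_d(1)[OF zd zc' d m]] .
  obtain v4 where v4: "evals_to \<zeta> (q_pochhammer (q^4) (q^4) k) v4" "v4 \<noteq> 0"
    using pochhammer_unit[OF k(2) coprime_d(2)[OF zd zc' d m]] .
  have 1: "vanishes_at \<zeta> 1 (q_pochhammer (q^1) (q^2) k)"
    using k dj by (intro pochhammer_vanishes[of "2*j"]) auto
  have 2: "vanishes_at \<zeta> 1 (q_pochhammer (q^2) (q^4) k)"
  proof (rule pochhammer_vanishes[of "2*j"])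
    have "2 + 4*(2*j) = d * 2" using dj by simp
    then show "d dvd 2 + 4*(2*j)" by simp
  qed (use k in simp)
  have 3: "vanishes_at \<zeta> 1 (q_pochhammer (q^1) (q^4) k)"
    using k dj by (intro pochhammer_vanishes[of j]) auto
  have v: "vanishes_at \<zeta> (((1+1)+1)+(1+1)) ((q_pochhammer (q^1) (q^2) k * q_pochhammer (q^1) (q^2) k) * q_pochhammer (q^2) (q^4) k
          * (q_pochhammer (q^1) (q^4) k * q_pochhammer (q^1) (q^4) k))"
    by (intro vanishes_at_mult 1 2 3)
  have ev: "evals_to \<zeta> ((1 - q^(6*k+1)) / (1 - q^1) * q^(2*k) / ((q_pochhammer (q^2) (q^2) k)^2 * (q_pochhammer (q^4) (q^4) k)^3))
     ((1 - \<zeta>^(6*k+1)) / (1 - \<zeta>^1) * \<zeta>^(2*k) / (v2^2 * v4^3))"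
    using v2 v4 one_minus_zeta by (intro evals_to_intros evals_to_q v2 v4) auto
  have "vanishes_at \<zeta> ((((1+1)+1)+(1+1)) + 0) (((q_pochhammer (q^1) (q^2) k * q_pochhammer (q^1) (q^2) k) * q_pochhammer (q^2) (q^4) k
          * (q_pochhammer (q^1) (q^4) k * q_pochhammer (q^1) (q^4) k)) *
      ((1 - q^(6*k+1)) / (1 - q^1) * q^(2*k) / ((q_pochhammer (q^2) (q^2) k)^2 * (q_pochhammer (q^4) (q^4) k)^3)))"
    by (rule vanishes_at_mult[OF v vanishes_at_0I[OF ev]])
  moreover have "(((1+1)+1)+(1+1)) + 0 = (5::nat)" by simp
  moreover have "((q_pochhammer (q^1) (q^2) k * q_pochhammer (q^1) (q^2) k) * q_pochhammer (q^2) (q^4) k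
          * (q_pochhammer (q^1) (q^4) k * q_pochhammer (q^1) (q^4) k)) *
      ((1 - q^(6*k+1)) / (1 - q^1) * q^(2*k) / ((q_pochhammer (q^2) (q^2) k)^2 * (q_pochhammer (q^4) (q^4) k)^3)) = summand q k"
    unfolding summand_def q_int_def by (simp add: power2_eq_square mult_ac)
  ultimately show ?thesis by metis
qed

lemma primitive_congruence_half:
  assumes dj: "d = 4*j+1"
  shows "vanishes_at \<zeta> 5 ((\<Sum>k=0..2*j. summand q k) - congruence_rhs q d)"
proof -
  define s where "s = 2 - q^d - 1 / q^d"
  define D where "D = 1 - q^d"
  have z0: "\<zeta> \<noteq> 0" using zd d by auto
  have j: "m = 2*j" using d dj by simp
  have qd: "q^d \<noteq> 0" using q_ne by simp
  have s_eq: "s = - (D^2 / q^d)"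
  proof -
    have "2 - Q - 1 / Q = - ((1 - Q)^2 / Q)" if "Q \<noteq> 0" for Q :: "complex poly fract"
      using that by (simp add: field_simps power2_eq_square)
    then show ?thesis unfolding s_def D_def using qd by blast
  qed
  have vD: "vanishes_at \<zeta> 1 D" unfolding D_def by (rule vanishes_at_1_minus[OF zd zc' d m dvd_refl, folded q])
  have "vanishes_at \<zeta> (1+1) (D * D / q^d)"
    by (rule vanishes_at_divide_unit[OF vanishes_at_mult[OF vD vD] evals_to_power[OF evals_to_q]]) (use z0 in simp)
  then have vs: "vanishes_at \<zeta> (1+1) s" unfolding s_eq power2_eq_square by (rule vanishes_at_uminus)
  have "evals_to \<zeta> s (2 - \<zeta>^d - 1 / \<zeta>^d)" unfolding s_def
    by (intro evals_to_intros evals_to_q) (use z0 in simp)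
  then have es: "evals_to \<zeta> s 0" using zd by simp
  have nz4: "\<zeta>^(4*i+4) \<noteq> 1" if "i < 2*j" for i
  proof -
    have "\<not> d dvd i + 1" using that dj by (auto dest: dvd_imp_le)
    then have "\<not> d dvd 4 * (i + 1)"
      using coprime_d[OF zd zc' d m] coprime_commute coprime_dvd_mult_right_iff by metis
    moreover have e: "4*i+4 = 4*(i+1)" by simp
    ultimately show ?thesis unfolding e by (simp add: zeta_power_eq_1)
  qed
  have nz2: "\<zeta>^(2*i+2) \<noteq> 1" if "i < 2*j" for i using zeta_power_ne_1[of "2*i+2"] that dj by simp

  define S where "S a b = (\<Sum>k\<le>2*j. ((1 - q^(6*k+1)) * q^(2*k)) * (factor_s q a k * factor_t q b k))" for a b
  have S: "S a b = (\<Sum>k<2*j+1. quad_term (q^2) q (q * (2 - a)) (q * (2 - b)) k)" for a b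
  proof -
    have "quad_term (q^2) q (q * (2 - a)) (q * (2 - b)) k = ((1 - q^(6*k+1)) * q^(2*k)) * (factor_s q a k * factor_t q b k)" for k
      by (rule quad_term_factor) (rule q_ne(1), rule q_power_ne_1, simp)
    then show ?thesis unfolding S_def by (simp add: lessThan_Suc_atMost)
  qed
  have ne: "q^a \<noteq> q^b" if "a < b" for a b
    using power_eq_power_iff[OF q_ne(1), of a b] q_power_ne_1 that by simp
  note special = q_ne(1) q_power_ne_1
  have S1: "S s 0 = closed_form q j 0"
    using sum_special_s[OF special, of j] unfolding S s_def dj by simp
  have S2: "S 0 s = closed_form q j 0"
    using sum_special_t[OF special, of 0 j] q_power_ne_1 unfolding S s_def dj by simp
  have S3: "S s s = closed_form q j s"
  proof -
    have "(1 - q^(4*i+4))^2 + q^(4*i+4) * s \<noteq> 0" for i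
    proof -
      \<comment> \<open>As a polynomial in C = q^(4i+4) this vanishes only at q^d and q^(-d); the
        first is excluded by d = 1 mod 4.\<close>
      have "(1 - q^(4*i+4))^2 + q^(4*i+4) * s = (1 - q^(4*i+4) * q^d) * (q^d - q^(4*i+4)) / q^d"
      proof -
        have "(1 - C)^2 + C * (2 - Q - 1 / Q) = (1 - C * Q) * (Q - C) / Q" if "Q \<noteq> 0" for C Q :: "complex poly fract"
          using that by (simp add: field_simps power2_eq_square)
        then show ?thesis unfolding s_def using qd by blast
      qed
      moreover have "q^(4*i+4) * q^d \<noteq> 1" using q_power_ne_1[of "4*i+4+d"] by (simp add: power_add)
      moreover have "q^d \<noteq> q^(4*i+4)"
      proof (cases "d < 4*i+4")
        case False
        then have "4*i+4 < d" using dj by presburger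
        then show ?thesis using ne by metis
      qed (rule ne)
      ultimately show ?thesis using qd by simp
    qed
    then show ?thesis
      using sum_special_t[OF special, of s j] unfolding S s_def dj by simp
  qed
  obtain E where E: "evals_to \<zeta> E 0"
    "(\<Sum>k\<in>{..2*j}. ((1 - q^(6*k+1)) * q^(2*k)) * ((factor_s q s k - factor_s q 0 k) * (factor_t q s k - factor_t q 0 k))) = s^2 * E"
  proof (rule second_difference[OF es])
    show "evals_to \<zeta> ((1 - q^(6*k+1)) * q^(2*k)) ((1 - \<zeta>^(6*k+1)) * \<zeta>^(2*k))" for k
      by (intro evals_to_intros evals_to_q)
    show "first_order \<zeta> s (factor_s q 0 k) (factor_s q s k) (\<lambda>y. factor_s \<zeta> y k)" if "k \<in> {..2*j}" for k
      by (rule first_order_factor_s[OF es evals_to_q nz4]) (use that in simp)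
    show "first_order \<zeta> s (factor_t q 0 k) (factor_t q s k) (\<lambda>y. factor_t \<zeta> y k)" if "k \<in> {..2*j}" for k
      by (rule first_order_factor_t[OF es evals_to_q nz4 nz2]) (use that in simp_all)
    show "\<forall>\<^sub>F y in nhds 0. \<forall>\<^sub>F x in nhds 0. (\<Sum>k\<in>{..2*j}. ((1 - \<zeta>^(6*k+1)) * \<zeta>^(2*k)) * (factor_s \<zeta> x k * factor_t \<zeta> y k)) = 0"
      using sum_root_of_unity_deformed[of \<zeta> m] zd zeta_power_ne_1 m unfolding d unfolding j by simp
  qed simp_all
  have "(\<Sum>k\<in>{..2*j}. ((1 - q^(6*k+1)) * q^(2*k)) * ((factor_s q s k - factor_s q 0 k) * (factor_t q s k - factor_t q 0 k)))
    = S s s - S 0 s - S s 0 + S 0 0"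
    unfolding S_def sum_subtractf[symmetric] sum.distrib[symmetric] by (intro sum.cong refl) algebra
  then have S00: "S 0 0 = 2 * closed_form q j 0 - closed_form q j s + s^2 * E"
    using E(2) S1 S2 S3 by (simp add: algebra_simps)
  \<comment> \<open>Multiplication by 1 - q clears the denominator of [6k+1]; it is undone at the
    end, as 1 - \<zeta> is nonzero.\<close>
  have lhs: "(1 - q) * (\<Sum>k=0..2*j. summand q k) = S 0 0"
    unfolding sum_distrib_left S_def atMost_atLeast0 factor_at_0 summand_eq[OF q_ne(2)] ..

  \<comment> \<open>From (1 - c)^2 + c s = (1 - c)^2 (1 + s c/(1 - c)^2), so that T is the
    logarithmic derivative of \<open>closed_form\<close> at 0.\<close>
  define u where "u i = q^(4*i+2) / (1 - q^(4*i+2))^2" for i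
  define v where "v i = q^(4*i+4) / (1 - q^(4*i+4))^2" for i
  define T where "T = (\<Sum>i<j. u i - v i)"
  have eu: "vanishes_at \<zeta> 0 (u i)" "vanishes_at \<zeta> 0 (v i)" if "i < j" for i
  proof -
    have "\<zeta>^(4*i+2) \<noteq> 1" "\<zeta>^(4*i+4) \<noteq> 1" using zeta_power_ne_1[of "4*i+2"] zeta_power_ne_1[of "4*i+4"] that dj by simp_all
    then have "evals_to \<zeta> (u i) (\<zeta>^(4*i+2) / (1 - \<zeta>^(4*i+2))^2)" "evals_to \<zeta> (v i) (\<zeta>^(4*i+4) / (1 - \<zeta>^(4*i+4))^2)"
      unfolding u_def v_def by (intro evals_to_intros evals_to_q; simp)+
    then show "vanishes_at \<zeta> 0 (u i)" "vanishes_at \<zeta> 0 (v i)" by (auto intro: vanishes_at_0I)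
  qed
  obtain \<omega> where \<omega>: "vanishes_at \<zeta> 0 \<omega>" "(\<Prod>i<j. (1 + u i * s) / (1 + v i * s)) = 1 + s * T + s^2 * \<omega>"
    using product_second_order[OF es, of j u v] eu unfolding T_def by blast
  have Gs: "closed_form q j s = closed_form q j 0 * (\<Prod>i<j. (1 + u i * s) / (1 + v i * s))"
  proof -
    have "((1 - q^(4*i+2))^2 + q^(4*i+2) * s) / ((1 - q^(4*i+4))^2 + q^(4*i+4) * s)
      = ((1 - q^(4*i+2))^2 + q^(4*i+2) * 0) / ((1 - q^(4*i+4))^2 + q^(4*i+4) * 0) * ((1 + u i * s) / (1 + v i * s))" for i
    proof -
      have n: "(1 - q^(4*i+2))^2 \<noteq> 0" "(1 - q^(4*i+4))^2 \<noteq> 0"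
        using q_power_ne_1[of "4*i+2"] q_power_ne_1[of "4*i+4"] by simp_all
      have "(1 - q^(4*i+2))^2 + q^(4*i+2) * s = (1 - q^(4*i+2))^2 * (1 + u i * s)"
        "(1 - q^(4*i+4))^2 + q^(4*i+4) * s = (1 - q^(4*i+4))^2 * (1 + v i * s)"
        using n unfolding u_def v_def by (simp_all add: distrib_left del: power_eq_0_iff)
      then show ?thesis by simp
    qed
    then show ?thesis unfolding closed_form_def mult.assoc prod.distrib[symmetric]
      by (intro arg_cong2[of _ _ _ _ "(*)"] prod.cong refl) blast
  qed
  have G0: "closed_form q j 0 = D * ((q_pochhammer (q^2) (q^4) j)^2 / (q_pochhammer (q^4) (q^4) j)^2)"
    unfolding closed_form_def D_def dj q_pochhammer_power prod_power_distrib prod_dividef by (simp add: add.commute)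
  have idx: "(d - 1) div 4 = j" "(d - 1) div 2 = 2*j" using dj by simp_all
  have rhs: "(1 - q) * congruence_rhs q d = closed_form q j 0 * (1 + D^2 * (2 - q^d) * T)"
  proof -
    define h where "h l = q^(2*l) / (1 - q^(2*l))^2" for l
    have "(\<Sum>l=1..2*j. (- 1) ^ (l + 1) * q ^ (2 * l) * ((1 - q^d) / (1 - q ^ (2 * l))) ^ 2)
      = D^2 * (\<Sum>l=1..2*j. (- 1) ^ (l + 1) * h l)"
      unfolding sum_distrib_left h_def D_def by (intro sum.cong refl) (simp add: power_divide mult_ac)
    also have "(\<Sum>l=1..2*j. (- 1) ^ (l + 1) * h l) = T"
    proof -
      have "2*(2*i+1) = 4*i+2" "2*(2*i+2) = 4*i+4" for i :: nat by simp_all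
      note idx = this
      show ?thesis unfolding alternating_sum_pairs T_def u_def v_def h_def idx ..
    qed
    finally have *: "(\<Sum>l=1..2*j. (- 1) ^ (l + 1) * q ^ (2 * l) * ((1 - q^d) / (1 - q ^ (2 * l))) ^ 2) = D^2 * T" .
    have "(1 - q) * q_int q d = D" using q_ne by (simp add: q_int_def D_def)
    then show ?thesis
      unfolding congruence_rhs_def correction_term[OF q_ne(2)] idx * G0 by (simp add: mult.assoc[symmetric] mult.commute[of "2 - q^d"])
  qed
  have vG: "vanishes_at \<zeta> (1+0) (closed_form q j 0)"
    unfolding G0 power_divide[symmetric]
    by (intro vanishes_at_mult vD vanishes_at_0_power[OF zd zc' d m]
       q_binomial_integral[OF zd zc' d m coprime_d(2)[OF zd zc' d m], folded q]) simp
  have vT: "vanishes_at \<zeta> 0 T" unfolding T_def by (intro vanishes_at_sum vanishes_at_diff eu) simp_all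
  have vq: "vanishes_at \<zeta> 0 (q^d)" by (rule vanishes_at_0I[OF evals_to_power[OF evals_to_q]])
  have Ds: "D^2 = - (q^d * s)" unfolding s_eq using qd by simp
  \<comment> \<open>With D^2 = - q^d s, the coefficient of T on the two sides differs by D^2 (2 -
    q^d - 1/q^d) = D^2 s. This is why 2 - q^n appears in the theorem.\<close>
  have sD: "s + D^2 * (2 - q^d) = D^2 * s"
  proof -
    have "D^2 = - (q^d * (2 - q^d - 1 / q^d))" using Ds unfolding s_def .
    moreover have "S + - (Q * S) * (2 - Q) = - (Q * S) * S" if "Q \<noteq> 0" "S = 2 - Q - 1 / Q" for Q S :: "complex poly fract"
      unfolding that(2) using that(1) by (simp add: field_simps)
    ultimately show ?thesis unfolding Ds using qd s_def by blast
  qed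
  have "(1 - q) * ((\<Sum>k=0..2*j. summand q k) - congruence_rhs q d) =
    2 * closed_form q j 0 - closed_form q j 0 * (1 + s * T + s^2 * \<omega>) + s^2 * E - closed_form q j 0 * (1 + D^2 * (2 - q^d) * T)"
    unfolding right_diff_distrib lhs rhs S00 Gs \<omega>(2) ..
  also have "\<dots> = - (closed_form q j 0 * T * (s + D^2 * (2 - q^d))) - closed_form q j 0 * s^2 * \<omega> + s^2 * E"
    by algebra
  also have "\<dots> = (s * s) * (closed_form q j 0 * (T * q^d - \<omega>) + E)"
    unfolding sD unfolding Ds by algebra
  finally have eq: "(1 - q) * ((\<Sum>k=0..2*j. summand q k) - congruence_rhs q d) = (s * s) * (closed_form q j 0 * (T * q^d - \<omega>) + E)" .
  \<comment> \<open>Order count: four from s * s, and one from the bracket, through the factor 1 -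
    q^d of \<open>closed_form\<close> and the value 0 of E.\<close>
  have "vanishes_at \<zeta> ((1+0)+0) (closed_form q j 0 * (T * q^d - \<omega>))"
    by (intro vanishes_at_mult[OF vG] vanishes_at_diff vanishes_at_0_mult vT vq \<omega>)
  then have "vanishes_at \<zeta> 1 (closed_form q j 0 * (T * q^d - \<omega>) + E)"
    using vanishes_at_1I[OF E(1)] by (intro vanishes_at_add) simp_all
  from vanishes_at_mult[OF vanishes_at_mult[OF vs vs] this]
  have "vanishes_at \<zeta> 5 ((1 - q) * ((\<Sum>k=0..2*j. summand q k) - congruence_rhs q d))"
    unfolding eq by (simp add: eval_nat_numeral)
  from vanishes_at_divide_unit[OF this evals_to_1_minus_q one_minus_zeta] show ?thesis
    using q_ne by simp
qed

lemma primitive_congruence: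
  assumes dj: "d = 4*j+1" and M: "M = (d - 1) div 2 \<or> M = d - 1"
  shows "vanishes_at \<zeta> 5 ((\<Sum>k=0..M. summand q k) - congruence_rhs q d)"
  using M
proof
  assume "M = (d - 1) div 2"
  then show ?thesis using primitive_congruence_half[OF dj] dj by simp
next
  assume "M = d - 1"
  then have "{0..M} = {0..2*j} \<union> {2*j<..<d}" using dj by auto
  then have "(\<Sum>k=0..M. summand q k) = (\<Sum>k=0..2*j. summand q k) + (\<Sum>k\<in>{2*j<..<d}. summand q k)"
    by (simp add: sum.union_disjoint ivl_disj_int)
  then have "(\<Sum>k=0..M. summand q k) - congruence_rhs q d = ((\<Sum>k=0..2*j. summand q k) - congruence_rhs q d) + (\<Sum>k\<in>{2*j<..<d}. summand q k)"
    by simp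
  moreover have "vanishes_at \<zeta> 5 (\<Sum>k\<in>{2*j<..<d}. summand q k)"
    using late_summand_vanishes[OF dj] by (intro vanishes_at_sum) auto
  ultimately show ?thesis using vanishes_at_add[OF primitive_congruence_half[OF dj]] by metis
qed

end

end

theorem theorem1p4:
  fixes n M :: nat and q :: "complex poly fract"
  assumes "q = to_fract [:0, 1:]"
    and "n > 0" and "n mod 4 = 1"
    and "M = (n - 1) div 2 \<or> M = n - 1"
  shows "ratfun_cong
    (\<Sum>k=0..M. q_int q (6 * k + 1) *
       ((q_pochhammer q (q ^ 2) k) ^ 2 * q_pochhammer (q ^ 2) (q ^ 4) k
          * (q_pochhammer q (q ^ 4) k) ^ 2) /
       ((q_pochhammer (q ^ 2) (q ^ 2) k) ^ 2 * (q_pochhammer (q ^ 4) (q ^ 4) k) ^ 3)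
       * q ^ (2 * k))
    (q_int q n *
       ((q_pochhammer (q ^ 2) (q ^ 4) ((n - 1) div 4)) ^ 2 /
        (q_pochhammer (q ^ 4) (q ^ 4) ((n - 1) div 4)) ^ 2) *
       (1 + (q_int q n) ^ 2 * (2 - q ^ n) *
          (\<Sum>j=1..(n - 1) div 2. (- 1) ^ (j + 1) * q ^ (2 * j) / (q_int q (2 * j)) ^ 2)))
    (q_int [:0, 1:] n * cyclotomic_poly n ^ 4)"
  unfolding summand_def[symmetric] congruence_rhs_def[symmetric]
proof (cases "n = 1")
  \<comment> \<open>For n = 1 the modulus has the root 1, where 1 - q is not a unit and the local
    argument does not apply. Both sides are then equal to 1.\<close>
  case True
  then have M: "M = 0" using assms(4) by auto
  have "q_int q 1 = 1" using X_ne(3) unfolding assms(1) by (simp add: q_int_def)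
  then have 1: "(\<Sum>k=0..M. summand q k) = 1" "congruence_rhs q n = 1"
    unfolding M True by (simp_all add: summand_def congruence_rhs_def q_pochhammer_def)
  have "denom_coprime P (1 :: complex poly fract)" for P
    unfolding denom_coprime_def One_fract_def by (intro exI[of _ 1]) simp
  moreover have "\<exists>a b. b \<noteq> 0 \<and> coprime b P \<and> P dvd a \<and> 1 - 1 = Fract a b" for P :: "complex poly"
    by (intro exI[of _ 0] exI[of _ 1]) (simp add: Zero_fract_def)
  ultimately show "ratfun_cong (\<Sum>k=0..M. summand q k) (congruence_rhs q n) (q_int [:0, 1:] n * cyclotomic_poly n ^ 4)"
    unfolding 1 ratfun_cong_def by blast
next
  case False
  then have n: "n > 1" using assms(2) by simp
  define j where "j = n div 4"
  have nj: "n = 4*j+1" unfolding j_def using assms(3) by presburger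
  show "ratfun_cong (\<Sum>k=0..M. summand q k) (congruence_rhs q n) (q_int [:0, 1:] n * cyclotomic_poly n ^ 4)"
  proof (rule ratfun_congI[OF _ modulus_dvd[OF n]])
    show "finite {\<zeta>::complex. \<zeta>^n = 1 \<and> \<zeta> \<noteq> 1}"
      using n by (intro finite_subset[OF _ finite_roots_unity[of n]]) auto
  next
    fix \<zeta> :: complex assume "\<zeta> \<in> {\<zeta>. \<zeta>^n = 1 \<and> \<zeta> \<noteq> 1}"
    then have z: "\<zeta>^n = 1" "\<zeta> \<noteq> 1" by auto
    define d where "d = (LEAST c. 0 < c \<and> \<zeta>^c = 1)"
    have ex: "0 < n \<and> \<zeta>^n = 1" using z n by simp
    have "0 < d \<and> \<zeta>^d = 1" unfolding d_def by (rule LeastI[of "\<lambda>c. 0 < c \<and> \<zeta>^c = 1" n, OF ex])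
    then have d: "0 < d" "\<zeta>^d = 1" by auto
    have least: "\<zeta>^c \<noteq> 1" if "0 < c" "c < d" for c
      using not_less_Least[of c "\<lambda>c. 0 < c \<and> \<zeta>^c = 1"] that unfolding d_def by auto
    have dn: "d dvd n" using root_of_unity_dvd[OF d(2) least d(1)] z(1) by blast
    have "odd d" using dn nj by (metis dvd_trans even_add even_mult_iff even_numeral odd_one)
    then obtain m where m: "d = 2*m+1" by (auto elim: oddE)
    have m0: "m > 0" using z(2) d(2) m by (cases m) auto
    have least': "\<forall>c. 0 < c \<and> c < d \<longrightarrow> \<zeta>^c \<noteq> 1" using least by blast
    note zeta = assms(1) d(2) least' m m0
    show "vanishes_at \<zeta> 0 (congruence_rhs q n)"
      using vanishes_at_mono[OF congruence_rhs_vanishes[OF zeta dn]] by simp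
    show "vanishes_at \<zeta> (modulus_exponent n \<zeta>) ((\<Sum>k=0..M. summand q k) - congruence_rhs q n)"
    proof (cases "d = n")
      case True
      then have "modulus_exponent n \<zeta> = 5" using least by (simp only: modulus_exponent_def) auto
      then show ?thesis using primitive_congruence[OF zeta, of j M] nj assms(4) True by simp
    next
      case False
      then have "d < n" using dn n by (auto dest: dvd_imp_le)
      then have e: "modulus_exponent n \<zeta> = 1" using d unfolding modulus_exponent_def by auto
      obtain c where c: "n = d * c" using dn by (auto elim: dvdE)
      \<comment> \<open>An odd cofactor makes (n-1)/2 fall at the end of a half block of length m +
        1.\<close>
      have "odd c" using c nj by (metis even_add even_mult_iff even_numeral odd_one)
      then obtain l where "c = 2*l+1" by (auto elim: oddE)
      then have "n = d * (2*l+1)" using c by simp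
      then show ?thesis unfolding e
        using sum_summand_vanishes[OF zeta(2-), of n l M, folded assms(1)] assms(4) congruence_rhs_vanishes[OF zeta dn]
        by (intro vanishes_at_diff) blast+
    qed
  qed
qed

end
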